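(* Let $M$ be a finite cell complex with residually finite infinite fundamental group $G$. Let $G_i\unlhd G$ be a residual chain of subgroups, and set $M_i=\widetilde M/G_i$, where $\widetilde M$ is the universal cover of $M$. Then either $b_1(M_i)>0$ for some $i$, or for any constant $\varepsilon>0$ there is, for some $i$, a nontrivial boundary $z\in\partial C_2(M_i;\mathbb{Z})$ such that for every $2$-chain $A\in C_2(M_i;\mathbb{Z})$ with $\partial A=z$ one has $\|z\|<\varepsilon\|A\|$.
   Context: A residual chain in $G$ is a nested decreasing sequence $G=G_0\ge G_1\ge G_2\ge\cdots$ of finite index normal subgroups of $G$ with $\bigcap_i G_i=\{1\}$. $C_*(M_i;\mathbb{Z})$ is the cellular chain complex of $M_i$ with the cell structure pulled back from $M$, and $\|\cdot\|$ is the $\ell^1$-norm with respect to the basis of cells. $b_1$ denotes the first Betti number. $M$ is connected. *)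

theory Defs
  imports "HOL-Complex_Analysis.Complex_Analysis" "HOL-Algebra.Free_Abelian_Groups"
begin

section \<open>Fundamental group and residual chains\<close>

definition path_class :: "'a::topological_space set \<Rightarrow> (real \<Rightarrow> 'a) \<Rightarrow> (real \<Rightarrow> 'a) set" where
  "path_class S g = {h. homotopic_paths S g h}"

definition loops_at :: "'a::topological_space set \<Rightarrow> 'a \<Rightarrow> (real \<Rightarrow> 'a) set" where
  "loops_at S x = {g. path g \<and> path_image g \<subseteq> S \<and> pathstart g = x \<and> pathfinish g = x}"

definition fundamental_group :: "'a::topological_space set \<Rightarrow> 'a \<Rightarrow> (real \<Rightarrow> 'a) set monoid" where
  "fundamental_group S x =
     \<lparr>carrier = path_class S ` loops_at S x,
      monoid.mult = (\<lambda>A B. \<Union>g\<in>A. \<Union>h\<in>B. path_class S (g +++ h)),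
      one = path_class S (\<lambda>_. x)\<rparr>"

definition residually_finite :: "('g, 'm) monoid_scheme \<Rightarrow> bool" where
  "residually_finite G \<longleftrightarrow>
     (\<forall>g \<in> carrier G - {\<one>\<^bsub>G\<^esub>}. \<exists>N. N \<lhd> G \<and> finite (rcosets\<^bsub>G\<^esub> N) \<and> g \<notin> N)"

definition residual_chain :: "('g, 'm) monoid_scheme \<Rightarrow> (nat \<Rightarrow> 'g set) \<Rightarrow> bool" where
  "residual_chain G N \<longleftrightarrow>
     N 0 = carrier G \<and> (\<forall>i. N (Suc i) \<subseteq> N i) \<and>
     (\<forall>i. N i \<lhd> G \<and> finite (rcosets\<^bsub>G\<^esub> (N i))) \<and>
     (\<Inter>i. N i) = {\<one>\<^bsub>G\<^esub>}"

lemma path_class_eq: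
  assumes "homotopic_paths S g h"
  shows "path_class S g = path_class S h"
  using assms unfolding path_class_def
  by (auto intro: homotopic_paths_trans homotopic_paths_sym)

lemma fundamental_group_mult_path_class:
  assumes "g \<in> loops_at S x" "h \<in> loops_at S x"
  shows "path_class S g \<otimes>\<^bsub>fundamental_group S x\<^esub> path_class S h = path_class S (g +++ h)"
proof -
  have gh: "pathfinish g = pathstart h"
    using assms by (simp add: loops_at_def)
  have *: "path_class S (g' +++ h') = path_class S (g +++ h)"
    if "g' \<in> path_class S g" "h' \<in> path_class S h" for g' h'
  proof -
    have "homotopic_paths S g g'" "homotopic_paths S h h'"
      using that by (simp_all add: path_class_def)
    then have "homotopic_paths S (g +++ h) (g' +++ h')"
      using gh by (rule homotopic_paths_join)
    then show ?thesis by (rule path_class_eq[symmetric])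
  qed
  have ne: "g \<in> path_class S g" "h \<in> path_class S h"
    using assms by (simp_all add: path_class_def loops_at_def)
  have "path_class S g \<otimes>\<^bsub>fundamental_group S x\<^esub> path_class S h =
      (\<Union>g'\<in>path_class S g. \<Union>h'\<in>path_class S h. path_class S (g' +++ h'))"
    by (simp add: fundamental_group_def)
  also have "\<dots> = (\<Union>g'\<in>path_class S g. \<Union>h'\<in>path_class S h. path_class S (g +++ h))"
    using * by (intro SUP_cong refl)
  also have "\<dots> = path_class S (g +++ h)"
    using ne by blast
  finally show ?thesis .
qed

lemma group_fundamental_group:
  assumes "x \<in> S"
  shows "group (fundamental_group S x)"
proof -
  let ?G = "fundamental_group S x"
  have mem: "path_class S g \<in> carrier ?G" if "g \<in> loops_at S x" for g
    using that by (simp add: fundamental_group_def)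
  have ex: "\<exists>g \<in> loops_at S x. A = path_class S g" if "A \<in> carrier ?G" for A
    using that by (auto simp: fundamental_group_def)
  have join: "g +++ h \<in> loops_at S x" if "g \<in> loops_at S x" "h \<in> loops_at S x" for g h
    using that by (auto simp: loops_at_def path_image_join)
  have const: "(\<lambda>_. x) \<in> loops_at S x"
    using assms by (auto simp: loops_at_def path_def path_image_def pathstart_def pathfinish_def)
  have one: "\<one>\<^bsub>?G\<^esub> = path_class S (\<lambda>_. x)"
    by (simp add: fundamental_group_def)
  note mult = fundamental_group_mult_path_class
  show ?thesis
  proof (rule groupI)
    fix A B assume "A \<in> carrier ?G" "B \<in> carrier ?G"
    then show "A \<otimes>\<^bsub>?G\<^esub> B \<in> carrier ?G"
      by (metis ex join mem mult)
  next
    show "\<one>\<^bsub>?G\<^esub> \<in> carrier ?G" using mem[OF const] one by simp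
  next
    fix A B C assume "A \<in> carrier ?G" "B \<in> carrier ?G" "C \<in> carrier ?G"
    then obtain g h k where gs: "g \<in> loops_at S x" "h \<in> loops_at S x" "k \<in> loops_at S x"
      and eqs: "A = path_class S g" "B = path_class S h" "C = path_class S k"
      using ex by metis
    have "homotopic_paths S (g +++ (h +++ k)) ((g +++ h) +++ k)"
      using gs by (intro homotopic_paths_assoc) (auto simp: loops_at_def)
    then show "A \<otimes>\<^bsub>?G\<^esub> B \<otimes>\<^bsub>?G\<^esub> C = A \<otimes>\<^bsub>?G\<^esub> (B \<otimes>\<^bsub>?G\<^esub> C)"
      using gs eqs path_class_eq by (metis mult join)
  next
    fix A assume "A \<in> carrier ?G"
    then obtain g where g: "g \<in> loops_at S x" "A = path_class S g"
      using ex by metis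
    have *: "homotopic_paths S ((\<lambda>_. x) +++ g) g"
    proof (rule homotopic_paths_sym, rule homotopic_paths_reparametrize)
      show "path g" "path_image g \<subseteq> S" using g by (auto simp: loops_at_def)
      show "continuous_on {0..1} (\<lambda>t::real. max 0 (2 * t - 1))"
        by (intro continuous_intros)
      show "(\<lambda>t::real. max 0 (2 * t - 1)) \<in> {0..1} \<rightarrow> {0..1}" by auto
      show "((\<lambda>_. x) +++ g) t = g (max 0 (2 * t - 1))" if "t \<in> {0..1}" for t
      proof (cases "t \<le> 1/2")
        case True
        then have "max 0 (2 * t - 1) = 0" by simp
        then show ?thesis using True g by (simp add: joinpaths_def loops_at_def pathstart_def)
      next
        case False
        then have "max 0 (2 * t - 1) = 2 * t - 1" by simp
        then show ?thesis using False by (simp add: joinpaths_def)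
      qed
    qed auto
    show "\<one>\<^bsub>?G\<^esub> \<otimes>\<^bsub>?G\<^esub> A = A"
      using path_class_eq[OF *] g const by (simp add: one mult)
  next
    fix A assume "A \<in> carrier ?G"
    then obtain g where g: "g \<in> loops_at S x" "A = path_class S g"
      using ex by metis
    have r: "reversepath g \<in> loops_at S x"
      using g by (auto simp: loops_at_def)
    have "homotopic_paths S (\<lambda>_. x) (reversepath g +++ g)"
      unfolding homotopic_paths
    proof (intro exI conjI ballI)
      let ?h = "\<lambda>(s, t). g (1 - s * min (2 * t) (2 - 2 * t))"
      have gc: "continuous_on {0..1} g" and gS: "g ` {0..1} \<subseteq> S" and g01: "g 0 = x" "g 1 = x"
        using g by (auto simp: loops_at_def path_def path_image_def pathstart_def pathfinish_def)
      have range: "1 - s * min (2 * t) (2 - 2 * t) \<in> {0..1}"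
        if "s \<in> {0..1}" "t \<in> {0..1}" for s t :: real
      proof -
        have "0 \<le> min (2 * t) (2 - 2 * t)" "min (2 * t) (2 - 2 * t) \<le> 1"
          using that by (auto simp: min_def)
        then show ?thesis using that by (simp add: mult_le_one)
      qed
      show "continuous_on ({0..1} \<times> {0..1}) ?h"
        unfolding case_prod_unfold
        by (rule continuous_on_compose2[OF gc])
           (use range in \<open>auto intro!: continuous_intros simp: mem_Times_iff\<close>)
      show "?h \<in> {0..1} \<times> {0..1} \<rightarrow> S"
        using range gS by (auto simp del: atLeastAtMost_iff)
      show "?h (0, t) = x" if "t \<in> {0..1}" for t
        using g01 by simp
      show "?h (1, t) = (reversepath g +++ g) t" if "t \<in> {0..1}" for t
      proof (cases "t \<le> 1/2")
        case True
        then have "min (2 * t) (2 - 2 * t) = 2 * t" by simp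
        then show ?thesis using True by (simp add: joinpaths_def reversepath_def)
      next
        case False
        then have "min (2 * t) (2 - 2 * t) = 2 - 2 * t" by simp
        then show ?thesis using False by (simp add: joinpaths_def)
      qed
      show "pathstart (?h \<circ> Pair s) = pathstart (\<lambda>_. x)"
        "pathfinish (?h \<circ> Pair s) = pathfinish (\<lambda>_. x)" if "s \<in> {0..1}" for s
        using g01 by (auto simp: pathstart_def pathfinish_def)
    qed
    then have "homotopic_paths S (reversepath g +++ g) (\<lambda>_. x)"
      by (rule homotopic_paths_sym)
    then show "\<exists>B \<in> carrier ?G. B \<otimes>\<^bsub>?G\<^esub> A = \<one>\<^bsub>?G\<^esub>"
      using mem[OF r] g(2) mult[OF r g(1)] one path_class_eq by metis
  qed
qed


section \<open>Quotients of a universal cover\<close>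

text \<open>
  The deck transformation \<open>f\<close> corresponds to the class of \<open>p \<circ> g\<close> for a path \<open>g\<close> in the cover
  from the base point \<open>b\<close> to \<open>f b\<close>. This is the usual identification of the deck group of a
  universal cover with the fundamental group at \<open>p b\<close>; whether it is an isomorphism or an
  anti-isomorphism depends on conventions and does not matter for subgroups.
\<close>

definition deck_transformation ::
    "'b::topological_space set \<Rightarrow> ('b \<Rightarrow> 'a) \<Rightarrow> ('b \<Rightarrow> 'b) \<Rightarrow> bool" where
  "deck_transformation T p f \<longleftrightarrow> (\<exists>f'. homeomorphism T T f f') \<and> (\<forall>x\<in>T. p (f x) = p x)"

definition deck_subgroup ::
    "'b::topological_space set \<Rightarrow> ('b \<Rightarrow> 'a::topological_space) \<Rightarrow> 'a set \<Rightarrow> 'b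
      \<Rightarrow> (real \<Rightarrow> 'a) set set \<Rightarrow> ('b \<Rightarrow> 'b) set" where
  "deck_subgroup T p S b N =
     {f. deck_transformation T p f \<and>
         (\<exists>g. path g \<and> path_image g \<subseteq> T \<and> pathstart g = b \<and> pathfinish g = f b \<and>
              path_class S (p \<circ> g) \<in> N)}"

definition orbit_of :: "('b \<Rightarrow> 'b) set \<Rightarrow> 'b \<Rightarrow> 'b set" where
  "orbit_of H x = (\<lambda>f. f x) ` H"

definition quotient_topology :: "'b topology \<Rightarrow> ('b \<Rightarrow> 'c) \<Rightarrow> 'c topology" where
  "quotient_topology X q =
     topology (\<lambda>U. U \<subseteq> q ` topspace X \<and> openin X {x \<in> topspace X. q x \<in> U})"

definition orbit_space :: "'b::topological_space set \<Rightarrow> ('b \<Rightarrow> 'b) set \<Rightarrow> 'b set topology" where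
  "orbit_space T H = quotient_topology (top_of_set T) (orbit_of H)"

definition orbit_projection :: "('b \<Rightarrow> 'a) \<Rightarrow> 'b set \<Rightarrow> 'a" where
  "orbit_projection p Q = the_elem (p ` Q)"

lemma openin_quotient_topology:
  "openin (quotient_topology X q) U \<longleftrightarrow>
     U \<subseteq> q ` topspace X \<and> openin X {x \<in> topspace X. q x \<in> U}"
proof -
  have "istopology (\<lambda>U. U \<subseteq> q ` topspace X \<and> openin X {x \<in> topspace X. q x \<in> U})"
    unfolding istopology_def
  proof (intro conjI allI impI)
    fix U V
    assume U: "U \<subseteq> q ` topspace X \<and> openin X {x \<in> topspace X. q x \<in> U}"
      and V: "V \<subseteq> q ` topspace X \<and> openin X {x \<in> topspace X. q x \<in> V}"
    have "{x \<in> topspace X. q x \<in> U \<inter> V} = {x \<in> topspace X. q x \<in> U} \<inter> {x \<in> topspace X. q x \<in> V}"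
      by auto
    then show "openin X {x \<in> topspace X. q x \<in> U \<inter> V}" using U V by auto
    show "U \<inter> V \<subseteq> q ` topspace X" using U by auto
  next
    fix \<K>
    assume K: "\<forall>U\<in>\<K>. U \<subseteq> q ` topspace X \<and> openin X {x \<in> topspace X. q x \<in> U}"
    have "{x \<in> topspace X. q x \<in> \<Union>\<K>} = (\<Union>U\<in>\<K>. {x \<in> topspace X. q x \<in> U})" by auto
    then show "openin X {x \<in> topspace X. q x \<in> \<Union>\<K>}" using K by auto
    show "\<Union>\<K> \<subseteq> q ` topspace X" using K by auto
  qed
  then show ?thesis by (simp add: quotient_topology_def topology_inverse')
qed

lemma quotient_map_quotient_topology: "quotient_map X (quotient_topology X q) q"
proof -
  have "openin (quotient_topology X q) (q ` topspace X)"
  proof -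
    have "{x \<in> topspace X. q x \<in> q ` topspace X} = topspace X" by auto
    then show ?thesis by (simp add: openin_quotient_topology)
  qed
  moreover have "topspace (quotient_topology X q) \<subseteq> q ` topspace X"
    using openin_topspace openin_quotient_topology by metis
  ultimately have "topspace (quotient_topology X q) = q ` topspace X"
    by (simp add: openin_subset subset_antisym)
  then show ?thesis
    unfolding quotient_map_def openin_quotient_topology by blast
qed


section \<open>Cell complexes\<close>

definition disk :: "nat \<Rightarrow> (nat \<Rightarrow> real) topology" where
  "disk n = subtopology (Euclidean_space n) {x. (\<Sum>i<n. (x i)\<^sup>2) \<le> 1}"

definition open_disk :: "nat \<Rightarrow> (nat \<Rightarrow> real) set" where
  "open_disk n = {x \<in> topspace (disk n). (\<Sum>i<n. (x i)\<^sup>2) < 1}"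

definition disk_boundary :: "nat \<Rightarrow> (nat \<Rightarrow> real) set" where
  "disk_boundary n = {x \<in> topspace (disk n). (\<Sum>i<n. (x i)\<^sup>2) = 1}"

text \<open>A cell is given by its dimension and its characteristic map.\<close>

type_synonym 'a cell = "nat \<times> ((nat \<Rightarrow> real) \<Rightarrow> 'a)"

definition open_cell :: "'a cell \<Rightarrow> 'a set" where
  "open_cell e = snd e ` open_disk (fst e)"

definition cells_of_dim :: "'a cell set \<Rightarrow> nat \<Rightarrow> 'a cell set" where
  "cells_of_dim K n = {e \<in> K. fst e = n}"

text \<open>
  Finite CW complexes. Since \<open>K\<close> is finite and \<open>X\<close> is Hausdorff, closure finiteness, the weak
  topology and the fact that the characteristic maps are homeomorphisms on open disks are
  automatic. Characteristic maps are extensional, so that a cell is determined by the values of its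
  characteristic map on the closed disk.
\<close>

definition finite_cell_complex :: "'a topology \<Rightarrow> 'a cell set \<Rightarrow> bool" where
  "finite_cell_complex X K \<longleftrightarrow>
     Hausdorff_space X \<and> finite K \<and>
     (\<forall>(n, \<phi>) \<in> K.
        \<phi> \<in> extensional (topspace (disk n)) \<and>
        continuous_map (disk n) X \<phi> \<and>
        inj_on \<phi> (open_disk n) \<and>
        \<phi> ` disk_boundary n \<subseteq> (\<Union>e \<in> {e \<in> K. fst e < n}. open_cell e)) \<and>
     disjoint_family_on open_cell K \<and>
     (\<Union>e\<in>K. open_cell e) = topspace X"

text \<open>
  The cell structure on \<open>Y\<close> pulled back along a covering map \<open>p\<close> to a cell complex with cells \<open>K\<close>:
  its cells are all lifts to \<open>Y\<close> of characteristic maps of cells in \<open>K\<close>. A characteristic map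
  has exactly one lift through each point over a given point of the open cell.
\<close>

definition pullback_cells :: "'a cell set \<Rightarrow> 'c topology \<Rightarrow> ('c \<Rightarrow> 'a) \<Rightarrow> 'c cell set" where
  "pullback_cells K Y p =
     {(n, \<psi>). \<psi> \<in> extensional (topspace (disk n)) \<and> continuous_map (disk n) Y \<psi> \<and>
              (n, restrict (p \<circ> \<psi>) (topspace (disk n))) \<in> K}"

definition quotient_cells ::
    "'a::topological_space set \<Rightarrow> 'a cell set \<Rightarrow> 'b::topological_space set \<Rightarrow> ('b \<Rightarrow> 'a) \<Rightarrow> 'b
      \<Rightarrow> (real \<Rightarrow> 'a) set set \<Rightarrow> 'b set cell set" where
  "quotient_cells S K T p b N =
     pullback_cells K (orbit_space T (deck_subgroup T p S b N)) (orbit_projection p)"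


section \<open>The cellular chain complex in degrees at most two\<close>

definition chain_group :: "'a cell set \<Rightarrow> nat \<Rightarrow> ('a cell \<Rightarrow>\<^sub>0 int) monoid" where
  "chain_group K n = free_Abelian_group (cells_of_dim K n)"

definition chain_norm :: "('a cell \<Rightarrow>\<^sub>0 int) \<Rightarrow> real" where
  "chain_norm c = (\<Sum>e \<in> Poly_Mapping.keys c. real_of_int \<bar>Poly_Mapping.lookup c e\<bar>)"

definition point1 :: "real \<Rightarrow> nat \<Rightarrow> real" where
  "point1 t = (\<lambda>i. if i = 0 then t else 0)"

definition point2 :: "real \<Rightarrow> real \<Rightarrow> nat \<Rightarrow> real" where
  "point2 s t = (\<lambda>i. if i = 0 then s else if i = 1 then t else 0)"

definition vertex_cell :: "'a \<Rightarrow> 'a cell" where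
  "vertex_cell v = (0, restrict (\<lambda>_. v) (topspace (disk 0)))"

definition boundary1 :: "('a cell \<Rightarrow>\<^sub>0 int) \<Rightarrow> ('a cell \<Rightarrow>\<^sub>0 int)" where
  "boundary1 = frag_extend (\<lambda>e.
     frag_of (vertex_cell (snd e (point1 1))) - frag_of (vertex_cell (snd e (point1 (- 1)))))"

text \<open>
  For a 1-cell \<open>e\<close> the map \<open>collapse e\<close> sends the 1-skeleton to the unit circle: it collapses the
  complement of the open cell to the point 1 and runs once, counterclockwise, around the circle
  along \<open>e\<close>. The coefficient of \<open>e\<close> in the cellular boundary of a 2-cell \<open>f\<close> is the degree of the
  attaching map of \<open>f\<close> followed by \<open>collapse e\<close>. The degree of a self-map of the circle is
  the winding number around 0 of the corresponding loop.
\<close>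

definition collapse :: "'a cell \<Rightarrow> 'a \<Rightarrow> complex" where
  "collapse e x =
     (if x \<in> open_cell e then cis (pi * (1 + inv_into (open_disk 1) (snd e) x 0)) else 1)"

definition attaching_loop :: "'a cell \<Rightarrow> real \<Rightarrow> 'a" where
  "attaching_loop f s = snd f (point2 (cos (2 * pi * s)) (sin (2 * pi * s)))"

definition incidence :: "'a cell \<Rightarrow> 'a cell \<Rightarrow> int" where
  "incidence f e = (THE k. winding_number (collapse e \<circ> attaching_loop f) 0 = of_int k)"

definition boundary2 :: "'a cell set \<Rightarrow> ('a cell \<Rightarrow>\<^sub>0 int) \<Rightarrow> ('a cell \<Rightarrow>\<^sub>0 int)" where
  "boundary2 K = frag_extend (\<lambda>f.
     \<Sum>e \<in> {e \<in> cells_of_dim K 1. incidence f e \<noteq> 0}. frag_cmul (incidence f e) (frag_of e))"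

definition homology1 :: "'a cell set \<Rightarrow> ('a cell \<Rightarrow>\<^sub>0 int) set monoid" where
  "homology1 K =
     (chain_group K 1)\<lparr>carrier := kernel (chain_group K 1) (chain_group K 0) boundary1\<rparr>
       Mod (boundary2 K ` carrier (chain_group K 2))"

definition int_independent :: "('g, 'm) monoid_scheme \<Rightarrow> 'g set \<Rightarrow> bool" where
  "int_independent A S \<longleftrightarrow>
     finite S \<and> S \<subseteq> carrier A \<and>
     (\<forall>c::'g \<Rightarrow> int. (\<Otimes>\<^bsub>A\<^esub>x\<in>S. x [^]\<^bsub>A\<^esub> c x) = \<one>\<^bsub>A\<^esub> \<longrightarrow> (\<forall>x\<in>S. c x = 0))"

definition abelian_rank :: "('g, 'm) monoid_scheme \<Rightarrow> enat" where
  "abelian_rank A = (SUP S \<in> {S. int_independent A S}. enat (card S))"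

definition betti1 :: "'a cell set \<Rightarrow> enat" where
  "betti1 K = abelian_rank (homology1 K)"

end

theory Submission
  imports Defs
begin

text \<open>
  Suppose that the first Betti numbers of all \<open>M\<^sub>i\<close> vanish. The proof produces cycles in the 1-skeletons of the \<open>M\<^sub>i\<close>
  which have multiples that bound, but only with large fillings.

  The subgroup \<open>G\<^sub>i\<close> acts on the universal cover by deck transformations. Let \<open>l\<close> be the least distance, in the graph
  of the cover, by which a nontrivial element of \<open>G\<^sub>i\<close> moves a vertex. A shortest edge path from such a vertex
  to its image projects to a closed edge path of length \<open>l\<close> in \<open>M\<^sub>i\<close>, and this loop is isometric: a shortcut in \<open>M\<^sub>i\<close>
  would lift to a shorter path or to a smaller displacement (\<open>shortest_loop\<close>). Since the \<open>G\<^sub>i\<close> are normal and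
  intersect trivially, and since there are finitely many orbits of vertices and finitely many vertices in each ball,
  \<open>l\<close> tends to infinity with \<open>i\<close> (\<open>long_displacement\<close>).

  Let \<open>z\<close> be the cycle of this loop, with vertices \<open>v\<^sub>0, v\<^sub>1, \<dots>\<close>. Since the Betti number is zero, \<open>k z = \<partial>A\<close> for some integer
  \<open>k \<noteq> 0\<close> and some chain \<open>A\<close> (\<open>betti1_zero_imp_torsion\<close>). The norm of \<open>A\<close> is bounded below by means of a cochain. Let \<open>m\<close> be a
  quarter of \<open>l\<close>, let \<open>F\<close> be the distance from \<open>v\<^sub>0\<close>, and let \<open>X\<close> be \<open>m\<close> minus the distance from \<open>v\<^sub>m\<close>, or zero where this is negative.
  The cochain \<open>\<phi> = 2X \<cdot> dF\<close> is at least \<open>m\<^sup>2\<close> on \<open>z\<close>, because \<open>F\<close> grows steadily along the part of \<open>z\<close> on which \<open>X\<close> is positive. On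
  the boundary of a 2-cell, which is a closed edge walk with at most \<open>N\<close> steps, \<open>X\<close> is almost constant and \<open>dF\<close> adds
  up to zero, so that \<open>\<phi>\<close> is at most \<open>2N\<^sup>2\<close> there. Therefore \<open>|k| m\<^sup>2 \<le> 2N\<^sup>2 \<parallel>A\<parallel>\<close> (\<open>isometric_loop_filling\<close>), whereas \<open>\<parallel>k z\<parallel> \<le> |k| l\<close>, and
  the quotient of \<open>\<parallel>k z\<parallel>\<close> by \<open>\<parallel>A\<parallel>\<close> is at most a constant divided by \<open>l\<close>.

  It is essential that \<open>N\<close> does not depend on \<open>i\<close>. An attaching loop is cut into finitely many pieces, each of which avoids
  the midpoints of all edges or stays in one open edge. This is done in \<open>M\<close>, and the pieces lift to all \<open>M\<^sub>i\<close>.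
  Comparing logarithms on each piece shows that the incidence numbers, which are winding numbers, count the signed
  passages through the edges (\<open>boundary_walk_bound\<close>).

  The topology of the cover is controlled by the lifts of the cells of \<open>M\<close>: a subset of a skeleton of the cover is open if
  its preimages under all lifted cells are open (\<open>openin_skt\<close>). This yields the deck transformations (\<open>deck_exists\<close>) and
  the connectedness of the graph of the cover (\<open>graph_connected\<close>), and similarly each cell of a quotient is the image of a
  cell of the cover (\<open>cell_lift\<close>).
\<close>

section \<open>Paths and lifts in covering spaces\<close>

text \<open>Two reparametrisations with the same ends are paths in an interval, hence homotopic by linear
  interpolation, and \<open>g\<close> carries this homotopy to \<open>S\<close>.\<close>

lemma homotopic_paths_reparam:
  fixes g :: "real \<Rightarrow> 'a::topological_space"
  assumes g: "path g" "path_image g \<subseteq> S"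
    and m: "continuous_on {0..1} m" "m ` {0..1} \<subseteq> {0..1}"
    and m': "continuous_on {0..1} m'" "m' ` {0..1} \<subseteq> {0..1}"
    and ends: "m 0 = m' 0" "m 1 = m' (1::real)"
  shows "homotopic_paths S (g \<circ> m) (g \<circ> m')"
proof -
  have "homotopic_paths {0..1} m m'"
    by (rule homotopic_paths_linear)
       (use m m' ends in \<open>auto simp: path_def pathstart_def pathfinish_def image_subset_iff
          simp del: atLeastAtMost_iff dest!: closed_segment_subset[of _ "{0..1}", THEN subsetD, rotated -1]\<close>)
  then have "homotopic_paths (g ` {0..1}) (g \<circ> m) (g \<circ> m')"
    by (rule homotopic_paths_continuous_image) (use g in \<open>auto simp: path_def\<close>)
  then show ?thesis
    by (rule homotopic_paths_subset) (use g in \<open>auto simp: path_image_def\<close>)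
qed

text \<open>A free null homotopy is a map of the square that is constant on the right edge and has the same values
  on the bottom and top edges. The left edge can be pushed across the square onto the other three edges,
  and there the image runs along a path and back.\<close>

lemma free_null_homotopic_imp_null_homotopic:
  fixes g :: "real \<Rightarrow> 'a::topological_space"
  assumes "homotopic_loops S g (\<lambda>_. a)"
  shows "homotopic_paths S g (\<lambda>_. g 0)"
proof -
  obtain h :: "real \<times> real \<Rightarrow> 'a" where conth: "continuous_on ({0..1} \<times> {0..1}) h"
    and him: "h \<in> {0..1} \<times> {0..1} \<rightarrow> S"
    and h0: "\<And>x. x \<in> {0..1} \<Longrightarrow> h (0, x) = g x" and h1: "\<And>x. x \<in> {0..1} \<Longrightarrow> h (1, x) = a"
    and loop: "\<And>t. t \<in> {0..1} \<Longrightarrow> h (t, 1) = h (t, 0)"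
    using assms unfolding homotopic_loops
    by (auto simp: pathstart_def pathfinish_def simp del: atLeastAtMost_iff)
  have g0: "h (0,0) = g 0" using h0 by auto
  define m where "m t = min 1 (min (3 * t) (3 - 3 * t))" for t :: real
  define c where "c t = min 1 (max 0 (3 * t - 1))" for t :: real
  have mc: "continuous_on {0..1} m" and cc: "continuous_on {0..1} c"
    unfolding m_def c_def by (intro continuous_intros)+
  have mr: "m t \<in> {0..1}" and cr: "c t \<in> {0..1}" if "t \<in> {0..1}" for t
    using that by (auto simp: m_def c_def)
  have "homotopic_paths ({0..1} \<times> {0..1}) (\<lambda>t::real. (0::real, t)) (\<lambda>t. (m t, c t))"
  proof (rule homotopic_paths_linear)
    show "path (\<lambda>t::real. (0::real, t))" "path (\<lambda>t. (m t, c t))"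
      unfolding path_def by (intro continuous_intros mc cc)+
    show "closed_segment (0, t) (m t, c t) \<subseteq> {0..1} \<times> {0..1}" if "t \<in> {0..1}" for t :: real
    proof (rule closed_segment_subset)
      show "convex ({0..1::real} \<times> {0..1::real})" by (intro convex_Times) auto
    qed (use that mr cr in auto)
  qed (auto simp: pathstart_def pathfinish_def m_def c_def)
  then have 1: "homotopic_paths (h ` ({0..1} \<times> {0..1})) (h \<circ> (\<lambda>t. (0, t))) (h \<circ> (\<lambda>t. (m t, c t)))"
    by (rule homotopic_paths_continuous_image) (use conth in auto)
  have 2: "homotopic_paths S (h \<circ> (\<lambda>t. (0, t))) (h \<circ> (\<lambda>t. (m t, c t)))"
    by (rule homotopic_paths_subset[OF 1]) (use him in auto)
  \<comment> \<open>the second path runs along the bottom, the right and the top edge of the square\<close>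
  have 3: "h (m t, c t) = h (m t, 0)" if "t \<in> {0..1}" for t
  proof -
    consider "t \<le> 1/3" | "1/3 \<le> t" "t \<le> 2/3" | "2/3 \<le> t" by linarith
    then show ?thesis
    proof cases
      case 1
      then have "c t = 0" by (auto simp: c_def)
      then show ?thesis by simp
    next
      case 2
      then have "m t = 1" by (auto simp: m_def)
      then show ?thesis using h1 cr[OF that] by simp
    next
      case 3
      then have "c t = 1" by (auto simp: c_def)
      then show ?thesis using loop mr[OF that] by simp
    qed
  qed
  let ?b = "\<lambda>s. h (s, 0)"
  have pb: "path ?b" "path_image ?b \<subseteq> S"
  proof -
    show "path ?b" unfolding path_def
      by (rule continuous_on_compose2[OF conth]) (auto intro!: continuous_intros)
    show "path_image ?b \<subseteq> S" using him by (auto simp: path_image_def)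
  qed
  have 4: "homotopic_paths S (?b \<circ> m) (?b \<circ> (\<lambda>_. 0))"
    by (rule homotopic_paths_reparam[OF pb mc]) (use mr in \<open>auto simp: m_def\<close>)
  have "homotopic_paths S g (h \<circ> (\<lambda>t. (0, t)))"
    by (rule homotopic_paths_eq)
      (use homotopic_loops_imp_path[OF assms] homotopic_loops_imp_subset[OF assms] h0 in auto)
  moreover have "homotopic_paths S (h \<circ> (\<lambda>t. (m t, c t))) (?b \<circ> m)"
  proof (rule homotopic_paths_eq)
    show "path (h \<circ> (\<lambda>t. (m t, c t)))" "path_image (h \<circ> (\<lambda>t. (m t, c t))) \<subseteq> S"
      using 2 homotopic_paths_imp_path homotopic_paths_imp_subset by blast+
  qed (use 3 in auto)
  moreover have "(?b \<circ> (\<lambda>_. 0)) = (\<lambda>_. g 0)" using g0 by auto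
  note 4 = 4[unfolded this]
  ultimately show ?thesis using homotopic_paths_trans[OF _ homotopic_paths_trans[OF 2 homotopic_paths_trans[OF _ 4]]]
    by blast
qed

lemma simply_connected_imp_path_connected_topological:
  fixes S :: "'a::topological_space set"
  assumes "simply_connected S"
  shows "path_connected S"
  unfolding path_connected_def
proof (intro ballI)
  fix x y assume xy: "x \<in> S" "y \<in> S"
  have "homotopic_loops S (\<lambda>_. x) (\<lambda>_. y)"
    using assms[unfolded simply_connected_def, rule_format, of "\<lambda>_. x" "\<lambda>_. y"] xy
    by (auto simp: path_def path_image_def pathstart_def pathfinish_def)
  then obtain h :: "real \<times> real \<Rightarrow> 'a" where conth: "continuous_on ({0..1} \<times> {0..1}) h"
    and him: "h \<in> {0..1} \<times> {0..1} \<rightarrow> S"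
    and h0: "\<And>t. t \<in> {0..1} \<Longrightarrow> h (0, t) = x" and h1: "\<And>t. t \<in> {0..1} \<Longrightarrow> h (1, t) = y"
    unfolding homotopic_loops by auto
  show "\<exists>g. path g \<and> path_image g \<subseteq> S \<and> pathstart g = x \<and> pathfinish g = y"
  proof (intro exI conjI)
    show "path (\<lambda>s. h (s, 0))" unfolding path_def
      by (rule continuous_on_compose2[OF conth]) (auto intro!: continuous_intros)
  qed (use him h0 h1 in \<open>auto simp: path_image_def pathstart_def pathfinish_def\<close>)
qed

lemma simply_connected_imp_null_homotopic:
  fixes S :: "'a::topological_space set"
  assumes "simply_connected S" "path g" "path_image g \<subseteq> S" "pathfinish g = pathstart g"
  shows "homotopic_paths S g (\<lambda>_. g 0)"
proof (rule free_null_homotopic_imp_null_homotopic)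
  have "g 0 \<in> S" using assms(3) by (auto simp: path_image_def)
  then show "homotopic_loops S g (\<lambda>_. g 0)"
    using assms(1)[unfolded simply_connected_def, rule_format, of g "\<lambda>_. g 0"] assms(2-)
    by (auto simp: path_def path_image_def pathstart_def pathfinish_def)
qed

lemma covering_sheets:
  assumes "covering_space C p S" "x \<in> S"
  obtains U v where "x \<in> U" "openin (top_of_set S) U" "\<Union>v = C \<inter> p -` U"
    "\<forall>V\<in>v. openin (top_of_set C) V" "\<forall>V\<in>v. \<forall>W\<in>v. V \<inter> W \<noteq> {} \<longrightarrow> V = W"
    "\<forall>V\<in>v. \<exists>s. homeomorphism V U p s"
  using assms unfolding covering_space_def pairwise_def disjnt_def by metis

lemma openin_preimage:
  assumes "continuous_on T f" "f \<in> T \<rightarrow> C" "openin (top_of_set C) V"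
  shows "openin (top_of_set T) (T \<inter> f -` V)"
  using assms continuous_openin_preimage by blast

text \<open>Over an evenly covered set two lifts that agree somewhere lie in the same sheet, where they are
  determined by their projection. So the set on which they agree is open and closed.\<close>

lemma covering_lift_unique:
  fixes g1 g2 :: "'c::topological_space \<Rightarrow> 'b::topological_space"
  assumes cov: "covering_space C p S" and T: "connected T"
    and g1: "continuous_on T g1" "g1 \<in> T \<rightarrow> C" and g2: "continuous_on T g2" "g2 \<in> T \<rightarrow> C"
    and eq: "\<And>x. x \<in> T \<Longrightarrow> p (g1 x) = p (g2 x)"
    and a: "a \<in> T" "g1 a = g2 a" and x: "x \<in> T"
  shows "g1 x = g2 x"
proof (rule connected_induction_simple[OF T a(1) x, of "\<lambda>x. g1 x = g2 x"])
  show "g1 a = g2 a" by fact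
next
  fix z assume z: "z \<in> T"
  then have "p (g1 z) \<in> S" using covering_space_imp_surjective[OF cov] g1(2) by auto
  from covering_sheets[OF cov this] obtain U v where U: "p (g1 z) \<in> U" "openin (top_of_set S) U" "\<Union>v = C \<inter> p -` U"
    "\<forall>V\<in>v. openin (top_of_set C) V" "\<forall>V\<in>v. \<forall>W\<in>v. V \<inter> W \<noteq> {} \<longrightarrow> V = W"
    "\<forall>V\<in>v. \<exists>s. homeomorphism V U p s" .
    note U = U(1-3) U(4-6)[rule_format]
  obtain V1 V2 where V: "V1 \<in> v" "g1 z \<in> V1" "V2 \<in> v" "g2 z \<in> V2"
    using U(1,3) eq[OF z] g1(2) g2(2) z by (metis IntI Pi_iff UnionE vimageI)
  let ?T = "(T \<inter> g1 -` V1) \<inter> (T \<inter> g2 -` V2)"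
  show "\<exists>Ta. openin (top_of_set T) Ta \<and> z \<in> Ta \<and> (\<forall>x\<in>Ta. \<forall>y\<in>Ta. g1 x = g2 x \<longrightarrow> g1 y = g2 y)"
  proof (intro exI[of _ ?T] conjI ballI impI)
    show "openin (top_of_set T) ?T"
      by (intro openin_Int openin_preimage[OF g1] openin_preimage[OF g2] U(4) V)
    show "z \<in> ?T" using z V by auto
    fix x y assume xy: "x \<in> ?T" "y \<in> ?T" "g1 x = g2 x"
    then have "V1 = V2" using U(5)[OF V(1,3)] by auto
    moreover obtain s where "homeomorphism V1 U p s" using U(6) V by blast
    ultimately show "g1 y = g2 y"
      using xy eq[of y] by (auto simp: homeomorphism_def) metis
  qed
qed

text \<open>Lifts over adjacent intervals can be joined, and a short interval is mapped into an evenly covered set;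
  bisection does the rest.\<close>

lemma covering_lift_path_interval:
  fixes g :: "real \<Rightarrow> 'a::topological_space"
  assumes cov: "covering_space C p S" and "s \<le> t"
    and g: "continuous_on {s..t} g" "g ` {s..t} \<subseteq> S" and a: "a \<in> C" "p a = g s"
  obtains k where "continuous_on {s..t} k" "k ` {s..t} \<subseteq> C" "k s = a"
    "\<And>r. r \<in> {s..t} \<Longrightarrow> p (k r) = g r"
proof -
  define P where "P u w \<longleftrightarrow> (s \<le> u \<and> u \<le> w \<and> w \<le> t \<longrightarrow> (\<forall>a\<in>C. p a = g u \<longrightarrow>
      (\<exists>k. continuous_on {u..w} k \<and> k ` {u..w} \<subseteq> C \<and> k u = a \<and> (\<forall>r\<in>{u..w}. p (k r) = g r))))" for u w
  have "P s t"
    using \<open>s \<le> t\<close>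
  proof (induction rule: Bolzano)
    case (trans u w y)
    show ?case unfolding P_def
    proof (intro impI ballI)
      fix a assume *: "s \<le> u \<and> u \<le> y \<and> y \<le> t" "a \<in> C" "p a = g u"
      have "s \<le> u \<and> u \<le> w \<and> w \<le> t" "s \<le> w \<and> w \<le> y \<and> y \<le> t" using * trans by auto
      note tr = trans(1)[unfolded P_def, rule_format, OF this(1)] trans(2)[unfolded P_def, rule_format, OF this(2)]
      obtain k1 where k1: "continuous_on {u..w} k1" "k1 ` {u..w} \<subseteq> C" "k1 u = a"
        "\<forall>r\<in>{u..w}. p (k1 r) = g r"
        using tr(1)[OF *(2,3)] by blast
      have "k1 w \<in> C" "p (k1 w) = g w" using k1 trans by auto
      then obtain k2 where k2: "continuous_on {w..y} k2" "k2 ` {w..y} \<subseteq> C" "k2 w = k1 w"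
        "\<forall>r\<in>{w..y}. p (k2 r) = g r"
        using tr(2)[of "k1 w"] by blast
      let ?k = "\<lambda>r. if r \<le> w then k1 r else k2 r"
      have "continuous_on ({u..w} \<union> {w..y}) ?k"
        by (rule continuous_on_cases) (use k1 k2 in auto)
      moreover have "{u..w} \<union> {w..y} = {u..y}" using trans by auto
      ultimately show "\<exists>k. continuous_on {u..y} k \<and> k ` {u..y} \<subseteq> C \<and> k u = a \<and> (\<forall>r\<in>{u..y}. p (k r) = g r)"
        using k1 k2 trans by (intro exI[of _ ?k]) (auto simp: image_subset_iff)
    qed
  next
    case (local x)
    then have "g x \<in> S" using g by auto
    from covering_sheets[OF cov this] obtain U v where U: "g x \<in> U" "openin (top_of_set S) U" "\<Union>v = C \<inter> p -` U"
    "\<forall>V\<in>v. openin (top_of_set C) V" "\<forall>V\<in>v. \<forall>W\<in>v. V \<inter> W \<noteq> {} \<longrightarrow> V = W"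
    "\<forall>V\<in>v. \<exists>s. homeomorphism V U p s" .
    note U = U(1-3) U(4-6)[rule_format]
    have "openin (top_of_set {s..t}) ({s..t} \<inter> g -` U)"
      by (rule openin_preimage[OF g(1) _ U(2)]) (use g in auto)
    then obtain d where d: "d > 0" "\<And>r. r \<in> {s..t} \<Longrightarrow> dist r x < d \<Longrightarrow> g r \<in> U"
      using local U(1) unfolding openin_euclidean_subtopology_iff
      by (metis (no_types, lifting) IntD2 IntI atLeastAtMost_iff vimageE vimageI)
    have "P u w" if uw: "u \<le> x" "x \<le> w" "w - u < d" for u w
      unfolding P_def
    proof (intro impI ballI)
      fix a assume *: "s \<le> u \<and> u \<le> w \<and> w \<le> t" "a \<in> C" "p a = g u"
      have gU: "g r \<in> U" if "r \<in> {u..w}" for r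
        by (rule d(2)) (use that * uw in \<open>auto simp: dist_real_def\<close>)
      then have "a \<in> \<Union>v" using * U(3) by auto
      then obtain V q where V: "V \<in> v" "a \<in> V" "homeomorphism V U p q" using U(6) by blast
      then have q: "continuous_on U q" "q ` U = V" "\<And>y. y \<in> U \<Longrightarrow> p (q y) = y" "\<And>y. y \<in> V \<Longrightarrow> q (p y) = y"
        by (auto simp: homeomorphism_def)
      show "\<exists>k. continuous_on {u..w} k \<and> k ` {u..w} \<subseteq> C \<and> k u = a \<and> (\<forall>r\<in>{u..w}. p (k r) = g r)"
      proof (intro exI[of _ "\<lambda>r. q (g r)"] conjI ballI)
        show "continuous_on {u..w} (\<lambda>r. q (g r))"
          by (rule continuous_on_compose2[OF q(1) continuous_on_subset[OF g(1)]]) (use * gU in auto)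
        show "(\<lambda>r. q (g r)) ` {u..w} \<subseteq> C" using gU q(2) V(1) U(3) by blast
        show "q (g u) = a" using q(4) V * by metis
      qed (use q gU in auto)
    qed
    then show ?case using d(1) by blast
  qed
  then have "\<exists>k. continuous_on {s..t} k \<and> k ` {s..t} \<subseteq> C \<and> k s = a \<and> (\<forall>r\<in>{s..t}. p (k r) = g r)"
    using a \<open>s \<le> t\<close> unfolding P_def by simp
  then show ?thesis using that by blast
qed


lemma continuous_on_openin_local:
  assumes "\<And>z. z \<in> T \<Longrightarrow> \<exists>N. openin (top_of_set T) N \<and> z \<in> N \<and> continuous_on N f"
  shows "continuous_on T f"
proof -
  have "\<exists>O'. open O' \<and> z \<in> O' \<and> continuous_on (T \<inter> O') f" if "z \<in> T" for z
    using assms[OF that] by (auto simp: openin_open)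
  then show ?thesis
    unfolding continuous_on_topological by (metis IntI Int_iff open_Int)
qed

text \<open>The lift is defined on one path at a time, and its continuity in the parameter propagates in time: over a
  product neighbourhood that is mapped into an evenly covered set, the lift is the local section applied to
  \<open>h\<close> as soon as it lies in the right sheet at a single time. So the times at which the lift is
  continuous in the parameter form an open and closed set, which contains 0.\<close>

lemma covering_lift_homotopy:
  fixes h :: "real \<times> 'c::topological_space \<Rightarrow> 'a::topological_space"
    and C :: "'b::topological_space set"
  assumes cov: "covering_space C p S"
    and h: "continuous_on ({0..1} \<times> Z) h" "h \<in> {0..1} \<times> Z \<rightarrow> S"
    and f: "continuous_on Z f" "f \<in> Z \<rightarrow> C" and hf: "\<And>z. z \<in> Z \<Longrightarrow> h (0, z) = p (f z)"
  obtains k where "continuous_on ({0..1} \<times> Z) k" "k \<in> {0..1} \<times> Z \<rightarrow> C"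
    "\<And>z. z \<in> Z \<Longrightarrow> k (0, z) = f z" "\<And>w. w \<in> {0..1} \<times> Z \<Longrightarrow> p (k w) = h w"
proof -
  have hz: "continuous_on {0..1} (\<lambda>t. h (t, z))" "(\<lambda>t. h (t, z)) ` {0..1} \<subseteq> S" if "z \<in> Z" for z
  proof -
    show "continuous_on {0..1} (\<lambda>t. h (t, z))"
      by (rule continuous_on_compose2[OF h(1)]) (use that in \<open>auto intro!: continuous_intros\<close>)
  qed (use h(2) that in auto)
  have "\<exists>k. continuous_on {0..1} k \<and> k ` {0..1} \<subseteq> C \<and> k 0 = f z \<and> (\<forall>r\<in>{0..1}. p (k r) = h (r, z))"
    if "z \<in> Z" for z
    using covering_lift_path_interval[OF cov zero_le_one hz[OF that], of "f z"] f(2) hf[OF that] that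
    by (metis Pi_iff)
  then obtain l where l: "\<And>z. z \<in> Z \<Longrightarrow> continuous_on {0..1} (l z)" "\<And>z. z \<in> Z \<Longrightarrow> l z ` {0..1} \<subseteq> C"
    "\<And>z. z \<in> Z \<Longrightarrow> l z 0 = f z" "\<And>z r. z \<in> Z \<Longrightarrow> r \<in> {0..1} \<Longrightarrow> p (l z r) = h (r, z)"
    by metis
  define k where "k w = l (snd w) (fst w)" for w
  (* near t0, continuity in the parameter at one time implies joint continuity *)
  have local: "\<exists>J. openin (top_of_set {0..1}) J \<and> t0 \<in> J \<and>
      (\<forall>t\<in>J. (\<exists>N. openin (top_of_set Z) N \<and> z0 \<in> N \<and> continuous_on N (\<lambda>z. l z t)) \<longrightarrow>
         (\<exists>N. openin (top_of_set Z) N \<and> z0 \<in> N \<and> continuous_on (J \<times> N) k))"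
    if t0: "t0 \<in> {0..1}" and z0: "z0 \<in> Z" for t0 z0
  proof -
    have "h (t0, z0) \<in> S" using h(2) t0 z0 by auto
    from covering_sheets[OF cov this] obtain U v where U: "h (t0, z0) \<in> U" "openin (top_of_set S) U" "\<Union>v = C \<inter> p -` U"
      "\<forall>V\<in>v. openin (top_of_set C) V" "\<forall>V\<in>v. \<forall>W\<in>v. V \<inter> W \<noteq> {} \<longrightarrow> V = W"
    "\<forall>V\<in>v. \<exists>s. homeomorphism V U p s" .
    note U = U(1-3) U(4-6)[rule_format]
    have "openin (top_of_set ({0..1} \<times> Z)) (({0..1} \<times> Z) \<inter> h -` U)"
      by (rule openin_preimage[OF h U(2)])
    then obtain O' where O': "open O'" "({0..1} \<times> Z) \<inter> h -` U = ({0..1} \<times> Z) \<inter> O'"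
      by (auto simp: openin_open)
    have "(t0, z0) \<in> O'" using O'(2) U(1) t0 z0 by auto
    from open_prod_elim[OF O'(1) this] obtain A N0 where AN: "open A" "open N0" "t0 \<in> A" "z0 \<in> N0" "A \<times> N0 \<subseteq> O'"
      by (metis mem_Times_iff fst_conv snd_conv)
    obtain e where e: "e > 0" "ball t0 e \<subseteq> A" using AN open_contains_ball by blast
    define J where "J = {0..1} \<inter> ball t0 e"
    have J: "openin (top_of_set {0..1}) J" "t0 \<in> J" "J \<subseteq> {0..1}" "connected J"
      unfolding J_def using t0 e(1) by (auto intro!: convex_connected convex_Int)
    have hU: "h (t, z) \<in> U" if "t \<in> J" "z \<in> Z \<inter> N0" for t z
    proof -
      have "(t, z) \<in> ({0..1} \<times> Z) \<inter> O'" using that AN(5) e(2) J_def by auto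
      then show ?thesis using O'(2) by auto
    qed
    have "\<exists>N. openin (top_of_set Z) N \<and> z0 \<in> N \<and> continuous_on (J \<times> N) k"
      if t: "t \<in> J" and N1: "openin (top_of_set Z) N1" "z0 \<in> N1" "continuous_on N1 (\<lambda>z. l z t)" for t N1
    proof -
      have tI: "t \<in> {0..1}" using t J(3) by auto
      have N1Z: "N1 \<subseteq> Z" using N1(1) openin_imp_subset by auto
      have "l z0 t \<in> C" using l(2)[OF z0] tI by blast
      moreover have "p (l z0 t) \<in> U" using l(4)[OF z0 tI] hU[OF t] z0 AN(4) by auto
      ultimately obtain V where V: "V \<in> v" "l z0 t \<in> V" using U(3) by blast
      then obtain s where s: "homeomorphism V U p s" using U(6) by blast
      have sc: "continuous_on U s" "s ` U = V" "\<And>y. y \<in> U \<Longrightarrow> p (s y) = y" "\<And>y. y \<in> V \<Longrightarrow> s (p y) = y"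
        using s by (auto simp: homeomorphism_def)
      have VC: "V \<subseteq> C" using U(4)[OF V(1)] openin_imp_subset by auto
      define N where "N = (N1 \<inter> (\<lambda>z. l z t) -` V) \<inter> N0"
      have 1: "openin (top_of_set N1) (N1 \<inter> (\<lambda>z. l z t) -` V)"
        by (rule openin_preimage[OF N1(3) _ U(4)[OF V(1)]]) (use l(2) tI N1Z in fastforce)
      have "openin (top_of_set Z) (N1 \<inter> (\<lambda>z. l z t) -` V)"
        using openin_trans[OF 1 N1(1)] .
      then have N: "openin (top_of_set Z) N"
        unfolding N_def using AN(2) by (rule openin_Int_open)
      have NZ: "N \<subseteq> Z \<inter> N0" using N1Z N_def by auto
      have z0N: "z0 \<in> N" using N1(2) V(2) AN(4) N_def by auto
      have ls: "l z r = s (h (r, z))" if z: "z \<in> N" and r: "r \<in> J" for z r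
      proof (rule covering_lift_unique[OF cov J(4) _ _ _ _ _ t _ r, of "l z" "\<lambda>r. s (h (r, z))"])
        have zZ: "z \<in> Z" using z NZ by auto
        show "continuous_on J (l z)" using continuous_on_subset[OF l(1)[OF zZ] J(3)] .
        show "l z \<in> J \<rightarrow> C" using l(2)[OF zZ] J(3) by auto
        show "continuous_on J (\<lambda>r. s (h (r, z)))"
          by (rule continuous_on_compose2[OF sc(1) continuous_on_subset[OF hz(1)[OF zZ] J(3)]])
            (use hU z NZ in auto)
        show "(\<lambda>r. s (h (r, z))) \<in> J \<rightarrow> C" using hU z NZ sc(2) VC by blast
        show "p (l z x) = p (s (h (x, z)))" if "x \<in> J" for x
        proof -
          have "h (x, z) \<in> U" using hU[OF that] z NZ by auto
          then show ?thesis using sc(3) l(4)[OF zZ] that J(3) by auto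
        qed
        show "l z t = s (h (t, z))" using sc(4)[of "l z t"] z N_def l(4)[OF zZ tI] by auto
      qed
      have "continuous_on (J \<times> N) (\<lambda>w. s (h w))"
        by (rule continuous_on_compose2[OF sc(1) continuous_on_subset[OF h(1)]])
          (use hU NZ J(3) in \<open>auto simp: subset_eq\<close>)
      then have "continuous_on (J \<times> N) k"
        by (rule continuous_on_eq) (auto simp: k_def ls)
      then show ?thesis using N z0N by blast
    qed
    then show ?thesis using J(1,2) by blast
  qed
  have good: "\<exists>N. openin (top_of_set Z) N \<and> z0 \<in> N \<and> continuous_on N (\<lambda>z. l z t)"
    if t: "t \<in> {0..1}" and z0: "z0 \<in> Z" for t :: real and z0
  proof (rule connected_induction_simple[of "{0..1}" 0 t
        "\<lambda>t. \<exists>N. openin (top_of_set Z) N \<and> z0 \<in> N \<and> continuous_on N (\<lambda>z. l z t)"])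
    show "\<exists>N. openin (top_of_set Z) N \<and> z0 \<in> N \<and> continuous_on N (\<lambda>z. l z 0)"
      by (rule exI[of _ Z]) (use z0 continuous_on_eq[OF f(1)] l(3) in auto)
    fix a :: real assume "a \<in> {0..1}"
    from local[OF this z0] obtain J where J: "openin (top_of_set {0..1}) J" "a \<in> J"
      "\<And>t. t \<in> J \<Longrightarrow> (\<exists>N. openin (top_of_set Z) N \<and> z0 \<in> N \<and> continuous_on N (\<lambda>z. l z t)) \<Longrightarrow>
         (\<exists>N. openin (top_of_set Z) N \<and> z0 \<in> N \<and> continuous_on (J \<times> N) k)" by auto
    have "continuous_on N (\<lambda>z. l z y)" if "continuous_on (J \<times> N) k" "y \<in> J" for y N
    proof -
      have "continuous_on N (\<lambda>z. k (y, z))"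
        by (rule continuous_on_compose2[OF that(1)]) (use that in \<open>auto intro!: continuous_intros\<close>)
      then show ?thesis by (simp add: k_def)
    qed
    with J show "\<exists>T. openin (top_of_set {0..1}) T \<and> a \<in> T \<and>
        (\<forall>x\<in>T. \<forall>y\<in>T. (\<exists>N. openin (top_of_set Z) N \<and> z0 \<in> N \<and> continuous_on N (\<lambda>z. l z x)) \<longrightarrow>
           (\<exists>N. openin (top_of_set Z) N \<and> z0 \<in> N \<and> continuous_on N (\<lambda>z. l z y)))"
      by (intro exI[of _ J]) blast
  qed (use t in auto)
  have "continuous_on ({0..1} \<times> Z) k"
  proof (rule continuous_on_openin_local)
    fix w :: "real \<times> 'c" assume "w \<in> {0..1} \<times> Z"
    then obtain t z where w: "w = (t, z)" "t \<in> {0..1}" "z \<in> Z" by auto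
    obtain J N where "openin (top_of_set {0..1}) J" "t \<in> J" "openin (top_of_set Z) N" "z \<in> N" "continuous_on (J \<times> N) k"
      using local[OF w(2,3)] good[OF w(2,3)] by blast
    then show "\<exists>N. openin (top_of_set ({0..1::real} \<times> Z)) N \<and> w \<in> N \<and> continuous_on N k"
      using w(1) by (intro exI[of _ "J \<times> N"]) (auto intro!: openin_Times)
  qed
  moreover have "k \<in> {0..1} \<times> Z \<rightarrow> C" using l(2) by (fastforce simp: k_def)
  moreover have "k (0, z) = f z" if "z \<in> Z" for z using l(3)[OF that] by (simp add: k_def)
  moreover have "p (k w) = h w" if "w \<in> {0..1} \<times> Z" for w
    using l(4)[of "snd w" "fst w"] that by (cases w) (simp add: k_def)
  ultimately show ?thesis by (rule that)
qed

section \<open>Disks\<close>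

lemma topspace_disk: "topspace (disk n) = {x. (\<forall>i\<ge>n. x i = 0) \<and> (\<Sum>i<n. (x i)\<^sup>2) \<le> 1}"
  by (auto simp: disk_def topspace_Euclidean_space)

lemma disk_eq: "disk n = top_of_set (topspace (disk n))"
proof -
  have "topspace (disk n) = {x. \<forall>i\<ge>n. x i = 0} \<inter> {x. (\<Sum>i<n. (x i)\<^sup>2) \<le> 1}"
    by (auto simp: topspace_disk)
  then show ?thesis
    by (simp only:) (simp only: disk_def Euclidean_space_def euclidean_product_topology subtopology_subtopology)
qed

lemma continuous_map_disk_iff:
  "continuous_map (disk n) (top_of_set S) f \<longleftrightarrow>
     continuous_on (topspace (disk n)) f \<and> f \<in> topspace (disk n) \<rightarrow> S"
  by (subst disk_eq) (rule continuous_map_subtopology_eu)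

lemma continuous_on_component:
  fixes f :: "'a::topological_space \<Rightarrow> nat \<Rightarrow> real"
  assumes "continuous_on S f" shows "continuous_on S (\<lambda>x. f x i)"
  using continuous_on_product_then_coordinatewise[OF assms] by blast

lemma compact_disk: "compact (topspace (disk n))"
proof -
  let ?B = "PiE UNIV (\<lambda>_::nat. {-1..1::real})"
  have "compactin (product_topology (\<lambda>_::nat. euclidean::real topology) UNIV) ?B"
    by (simp add: compactin_PiE)
  then have B: "compact ?B"
    by (simp add: euclidean_product_topology)
  have "topspace (disk n) \<subseteq> ?B"
  proof
    fix x assume x: "x \<in> topspace (disk n)"
    have "\<bar>x i\<bar> \<le> 1" for i
    proof (cases "i < n")
      case True
      then have "(x i)\<^sup>2 \<le> (\<Sum>i<n. (x i)\<^sup>2)" by (intro member_le_sum) auto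
      also have "\<dots> \<le> 1" using x by (simp add: topspace_disk)
      finally show ?thesis by (simp add: abs_square_le_1)
    qed (use x in \<open>simp add: topspace_disk\<close>)
    then show "x \<in> ?B" by (auto simp: abs_le_iff minus_le_iff)
  qed
  moreover have "closed (topspace (disk n))"
  proof -
    have "topspace (disk n) = (\<Inter>i\<in>{n..}. {x. x i = 0}) \<inter> {x. (\<Sum>i<n. (x i)\<^sup>2) \<le> 1}"
      by (auto simp: topspace_disk)
    moreover have "closed {x::nat \<Rightarrow> real. x i = 0}" for i
      by (intro closed_Collect_eq continuous_intros continuous_on_product_coordinates)
    moreover have "closed {x::nat \<Rightarrow> real. (\<Sum>i<n. (x i)\<^sup>2) \<le> 1}"
      by (intro closed_Collect_le continuous_intros continuous_on_product_coordinates)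
    ultimately show ?thesis by (simp only:) (intro closed_Int closed_INT ballI)
  qed
  ultimately show ?thesis
    using B by (metis compact_Int_closed inf.absorb_iff2)
qed

lemma disk_convex:
  assumes "x \<in> topspace (disk n)" "y \<in> topspace (disk n)" "0 \<le> t" "t \<le> 1"
  shows "(\<lambda>i. (1 - t) * x i + t * y i) \<in> topspace (disk n)"
proof -
  have sq: "((1 - t) * a + t * b)\<^sup>2 \<le> (1 - t) * a\<^sup>2 + t * b\<^sup>2" for a b :: real
  proof -
    have "(1 - t) * a\<^sup>2 + t * b\<^sup>2 - ((1 - t) * a + t * b)\<^sup>2 = (t * (1 - t)) * (a - b)\<^sup>2"
      by (simp add: power2_eq_square algebra_simps)
    moreover have "(t * (1 - t)) * (a - b)\<^sup>2 \<ge> 0" using assms by simp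
    ultimately show ?thesis by linarith
  qed
  have "(\<Sum>i<n. ((1 - t) * x i + t * y i)\<^sup>2) \<le> (\<Sum>i<n. (1 - t) * (x i)\<^sup>2 + t * (y i)\<^sup>2)"
    by (intro sum_mono sq)
  also have "\<dots> = (1 - t) * (\<Sum>i<n. (x i)\<^sup>2) + t * (\<Sum>i<n. (y i)\<^sup>2)"
    by (simp add: sum.distrib sum_distrib_left)
  also have "\<dots> \<le> (1 - t) * 1 + t * 1"
    using assms by (intro add_mono mult_left_mono) (auto simp: topspace_disk)
  finally show ?thesis using assms by (simp add: topspace_disk)
qed

lemma zero_in_open_disk: "(\<lambda>_. 0) \<in> open_disk n"
  by (simp add: open_disk_def topspace_disk)

lemma path_connected_disk: "path_connected (topspace (disk n))"
  unfolding path_connected_def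
proof (intro ballI)
  fix x y assume xy: "x \<in> topspace (disk n)" "y \<in> topspace (disk n)"
  show "\<exists>g. path g \<and> path_image g \<subseteq> topspace (disk n) \<and> pathstart g = x \<and> pathfinish g = y"
  proof (intro exI[of _ "\<lambda>t i. (1 - t) * x i + t * y i"] conjI)
    show "path (\<lambda>t i. (1 - t) * x i + t * y i)"
      unfolding path_def by (intro continuous_on_coordinatewise_then_product continuous_intros)
  qed (use disk_convex[OF xy] in \<open>auto simp: path_image_def pathstart_def pathfinish_def\<close>)
qed

lemmas connected_disk = path_connected_imp_connected[OF path_connected_disk]

lemma disk_split: "topspace (disk n) = open_disk n \<union> disk_boundary n"
  "open_disk n \<inter> disk_boundary n = {}"
  by (auto simp: open_disk_def disk_boundary_def topspace_disk)

lemma disk_zero: "topspace (disk 0) = {\<lambda>_. 0}" "open_disk 0 = {\<lambda>_. 0}"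
  by (auto simp: open_disk_def topspace_disk)

lemma disk_one: "topspace (disk 1) = point1 ` {-1..1}" "open_disk 1 = point1 ` {-1<..<1}"
  "disk_boundary 1 = {point1 (-1), point1 1}"
proof -
  have *: "x = point1 (x 0)" if "\<forall>i\<ge>1. x i = 0" for x
    using that by (auto simp: point1_def fun_eq_iff)
  show 1: "topspace (disk 1) = point1 ` {-1..1}"
  proof (intro equalityI subsetI)
    fix x assume "x \<in> topspace (disk 1)"
    then have "x = point1 (x 0)" "\<bar>x 0\<bar> \<le> 1" by (auto simp: topspace_disk abs_square_le_1 intro!: *)
    then show "x \<in> point1 ` {-1..1}" by (intro image_eqI[of _ _ "x 0"]) auto
  qed (auto simp: topspace_disk point1_def abs_square_le_1)
  show "open_disk 1 = point1 ` {-1<..<1}"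
    unfolding open_disk_def 1 by (auto simp: point1_def abs_square_less_1 abs_less_iff intro!: imageI)
  show "disk_boundary 1 = {point1 (-1), point1 1}"
    unfolding disk_boundary_def 1 by (auto simp: point1_def power2_eq_1_iff)
qed

lemma point1_0 [simp]: "point1 t 0 = t" by (simp add: point1_def)

lemma point1_inject [simp]: "point1 s = point1 t \<longleftrightarrow> s = t" by (metis point1_0)

lemma continuous_on_point1 [continuous_intros]:
  assumes "continuous_on S f" shows "continuous_on S (\<lambda>x. point1 (f x))"
proof (rule continuous_on_coordinatewise_then_product)
  show "continuous_on S (\<lambda>x. point1 (f x) i)" for i
    using assms by (cases "i = 0") (auto simp: point1_def)
qed

section \<open>Cell structures on covering spaces\<close>

locale covered_complex =
  fixes M :: "'a::topological_space set" and K :: "'a cell set"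
    and Mt :: "'b::topological_space set" and p :: "'b \<Rightarrow> 'a"
  assumes fin: "finite_cell_complex (top_of_set M) K"
    and cov: "covering_space Mt p M"
begin

abbreviation Kt :: "'b cell set" where
  "Kt \<equiv> pullback_cells K (top_of_set Mt) p"

definition skel :: "nat \<Rightarrow> 'a set" where
  "skel k = (\<Union>e \<in> {e \<in> K. fst e \<le> k}. open_cell e)"

definition skt :: "nat \<Rightarrow> 'b set" where
  "skt k = Mt \<inter> p -` skel k"

lemma Hausdorff: "Hausdorff_space (top_of_set M)" and finite_K: "finite K"
  and disjoint_cells: "disjoint_family_on open_cell K"
  and cells_cover: "(\<Union>e\<in>K. open_cell e) = M"
  using fin by (auto simp: finite_cell_complex_def)

lemma cell:
  assumes "(n, \<phi>) \<in> K"
  shows "\<phi> \<in> extensional (topspace (disk n))" "continuous_on (topspace (disk n)) \<phi>"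
    "\<phi> \<in> topspace (disk n) \<rightarrow> M" "inj_on \<phi> (open_disk n)"
    "\<phi> ` disk_boundary n \<subseteq> (\<Union>e \<in> {e \<in> K. fst e < n}. open_cell e)"
proof -
  have "\<forall>(n, \<phi>) \<in> K. \<phi> \<in> extensional (topspace (disk n)) \<and> continuous_map (disk n) (top_of_set M) \<phi> \<and>
     inj_on \<phi> (open_disk n) \<and> \<phi> ` disk_boundary n \<subseteq> (\<Union>e \<in> {e \<in> K. fst e < n}. open_cell e)"
    using fin unfolding finite_cell_complex_def by blast
  note * = bspec[OF this assms, simplified prod.case]
  show "\<phi> \<in> extensional (topspace (disk n))" "inj_on \<phi> (open_disk n)"
    "\<phi> ` disk_boundary n \<subseteq> (\<Union>e \<in> {e \<in> K. fst e < n}. open_cell e)"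
    using * by blast+
  show "continuous_on (topspace (disk n)) \<phi>" "\<phi> \<in> topspace (disk n) \<rightarrow> M"
    using * continuous_map_disk_iff by blast+
qed

lemma Kt_iff:
  "(n, \<psi>) \<in> Kt \<longleftrightarrow> \<psi> \<in> extensional (topspace (disk n)) \<and> continuous_on (topspace (disk n)) \<psi> \<and>
     \<psi> \<in> topspace (disk n) \<rightarrow> Mt \<and> (n, restrict (p \<circ> \<psi>) (topspace (disk n))) \<in> K"
  by (auto simp: pullback_cells_def continuous_map_disk_iff)

lemma Kt_cell:
  assumes "(n, \<psi>) \<in> Kt"
  shows "\<psi> \<in> extensional (topspace (disk n))" "continuous_on (topspace (disk n)) \<psi>"
    "\<psi> \<in> topspace (disk n) \<rightarrow> Mt" "(n, restrict (p \<circ> \<psi>) (topspace (disk n))) \<in> K"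
  using assms by (auto simp: Kt_iff)

lemma skel_mono: "j \<le> k \<Longrightarrow> skel j \<subseteq> skel k"
  by (force simp: skel_def)

lemma skel_subset: "skel k \<subseteq> M"
  using cells_cover by (auto simp: skel_def)

lemma skt_mono: "j \<le> k \<Longrightarrow> skt j \<subseteq> skt k"
  using skel_mono by (auto simp: skt_def)

lemma skt_subset: "skt k \<subseteq> Mt" by (auto simp: skt_def)

definition dimK :: nat where "dimK = Max (insert 0 (fst ` K))"

lemma skel_dimK: "dimK \<le> k \<Longrightarrow> skel k = M"
proof -
  assume "dimK \<le> k"
  then have "fst e \<le> k" if "e \<in> K" for e
    using that finite_K unfolding dimK_def by (meson Max_ge finite_imageI finite_insert image_eqI insertCI order_trans)
  then have "{e \<in> K. fst e \<le> k} = K" by auto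
  then show ?thesis using cells_cover by (simp add: skel_def)
qed

lemma p_Mt: "x \<in> Mt \<Longrightarrow> p x \<in> M"
  using covering_space_imp_surjective[OF cov] by auto

lemma skt_dimK: "dimK \<le> k \<Longrightarrow> skt k = Mt"
  using skel_dimK p_Mt by (auto simp: skt_def)

lemma cell_eqI:
  assumes "(n, \<phi>) \<in> K" "(n', \<phi>') \<in> K" "d \<in> open_disk n" "d' \<in> open_disk n'" "\<phi> d = \<phi>' d'"
  shows "n = n'" "\<phi> = \<phi>'" "d = d'"
proof -
  have "\<phi> d \<in> open_cell (n, \<phi>)" using assms(3) by (simp add: open_cell_def)
  moreover have "\<phi> d \<in> open_cell (n', \<phi>')" unfolding assms(5) using assms(4) by (simp add: open_cell_def)
  ultimately have eq: "(n, \<phi>) = (n', \<phi>')" using disjoint_cells assms(1,2) unfolding disjoint_family_on_def by blast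
  then show "n = n'" "\<phi> = \<phi>'" by auto
  show "d = d'" using eq assms cell(4)[OF assms(1)] by (auto dest: inj_onD)
qed

lemma open_disk_in_skel:
  assumes "(n, \<phi>) \<in> K" "d \<in> open_disk n"
  shows "\<phi> d \<in> skel k \<longleftrightarrow> n \<le> k"
proof
  assume "\<phi> d \<in> skel k"
  then obtain n' \<phi>' d' where "(n', \<phi>') \<in> K" "n' \<le> k" "d' \<in> open_disk n'" "\<phi> d = \<phi>' d'"
    by (auto simp: skel_def open_cell_def)
  then show "n \<le> k" using cell_eqI assms by metis
next
  assume "n \<le> k"
  then show "\<phi> d \<in> skel k" unfolding skel_def
    using assms by (intro UN_I[of "(n, \<phi>)"]) (auto simp: open_cell_def)
qed

lemma boundary_in_skel:
  assumes "(Suc n, \<phi>) \<in> K" "d \<in> disk_boundary (Suc n)"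
  shows "\<phi> d \<in> skel n"
  using cell(5)[OF assms(1)] assms(2) by (fastforce simp: skel_def)

lemma disk_in_skel:
  assumes "(n, \<phi>) \<in> K" "d \<in> topspace (disk n)" "n \<le> k"
  shows "\<phi> d \<in> skel k"
proof (cases "d \<in> open_disk n")
  case False
  then have b: "d \<in> disk_boundary n" using assms(2) disk_split by auto
  show ?thesis
  proof (cases n)
    case 0
    then show ?thesis using False assms(2) disk_zero by simp
  next
    case (Suc m)
    then show ?thesis using boundary_in_skel[of m \<phi> d] b assms(1,3) skel_mono[of m k] by auto
  qed
qed (use open_disk_in_skel assms in blast)

lemma Kt_apply: "d \<in> topspace (disk n) \<Longrightarrow> restrict (p \<circ> \<psi>) (topspace (disk n)) d = p (\<psi> d)"
  by simp

lemma open_diskD: "d \<in> open_disk n \<Longrightarrow> d \<in> topspace (disk n)"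
  by (auto simp: open_disk_def)

lemma boundaryD: "d \<in> disk_boundary n \<Longrightarrow> d \<in> topspace (disk n)"
  by (auto simp: disk_boundary_def)

lemma lift_open_disk_in_skt:
  assumes "(n, \<psi>) \<in> Kt" "d \<in> open_disk n"
  shows "\<psi> d \<in> skt k \<longleftrightarrow> n \<le> k"
  using open_disk_in_skel[OF Kt_cell(4)[OF assms(1)] assms(2)] Kt_cell(3)[OF assms(1)] open_diskD[OF assms(2)]
  by (auto simp: skt_def)

lemma lift_disk_in_skt:
  assumes "(n, \<psi>) \<in> Kt" "d \<in> topspace (disk n)" "n \<le> k"
  shows "\<psi> d \<in> skt k"
  using disk_in_skel[OF Kt_cell(4)[OF assms(1)] assms(2,3)] Kt_cell(3)[OF assms(1)] assms(2)
  by (auto simp: skt_def)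

lemma lift_boundary_in_skt:
  assumes "(Suc n, \<psi>) \<in> Kt" "d \<in> disk_boundary (Suc n)"
  shows "\<psi> d \<in> skt n"
  using boundary_in_skel[OF Kt_cell(4)[OF assms(1)] assms(2)] Kt_cell(3)[OF assms(1)] boundaryD[OF assms(2)]
  by (auto simp: skt_def)

lemma lift_unique:
  assumes "(n, \<psi>) \<in> Kt" "(n, \<psi>') \<in> Kt" "d \<in> topspace (disk n)" "\<psi> d = \<psi>' d"
    and eq: "\<And>y. y \<in> topspace (disk n) \<Longrightarrow> p (\<psi> y) = p (\<psi>' y)"
  shows "\<psi> = \<psi>'"
proof (rule extensionalityI[of _ "topspace (disk n)"])
  fix y assume "y \<in> topspace (disk n)"
  then show "\<psi> y = \<psi>' y"
    using covering_lift_unique[of Mt p M "topspace (disk n)" \<psi> \<psi>' d y] cov connected_disk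
      Kt_cell(2,3)[OF assms(1)] Kt_cell(2,3)[OF assms(2)] eq assms(3,4) by blast
qed (use Kt_cell assms in auto)

text \<open>A disk is contracted to any of its points, so the lift is found by lifting a homotopy.\<close>

lemma lift_through:
  assumes "(n, \<phi>) \<in> K" "d \<in> topspace (disk n)" "x \<in> Mt" "p x = \<phi> d"
  obtains \<psi> where "(n, \<psi>) \<in> Kt" "restrict (p \<circ> \<psi>) (topspace (disk n)) = \<phi>" "\<psi> d = x"
proof -
  let ?D = "topspace (disk n)"
  let ?c = "\<lambda>w i. (1 - fst w) * d i + fst w * snd w i"
  have cD: "?c w \<in> ?D" if "w \<in> {0..1} \<times> ?D" for w
    using disk_convex[OF assms(2), of "snd w" "fst w"] that by auto
  have c: "continuous_on ({0..1} \<times> ?D) ?c"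
    by (intro continuous_on_coordinatewise_then_product continuous_on_add continuous_on_mult
        continuous_on_diff continuous_on_const continuous_on_fst continuous_on_id
        continuous_on_component[OF continuous_on_snd])
  have "continuous_on ({0..1} \<times> ?D) (\<lambda>w. \<phi> (?c w))"
    by (rule continuous_on_compose2[OF cell(2)[OF assms(1)] c]) (use cD in blast)
  moreover have "(\<lambda>w. \<phi> (?c w)) \<in> {0..1} \<times> ?D \<rightarrow> M"
    using cell(3)[OF assms(1)] cD by blast
  ultimately obtain k where k: "continuous_on ({0..1} \<times> ?D) k" "k \<in> {0..1} \<times> ?D \<rightarrow> Mt"
    "\<And>z. z \<in> ?D \<Longrightarrow> k (0, z) = x" "\<And>w. w \<in> {0..1} \<times> ?D \<Longrightarrow> p (k w) = \<phi> (?c w)"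
    by (rule covering_lift_homotopy[OF cov, where f = "\<lambda>_. x"]) (use assms(3,4) in auto)
  define \<psi> where "\<psi> = restrict (\<lambda>y. k (1, y)) ?D"
  have p\<psi>: "p (\<psi> y) = \<phi> y" if "y \<in> ?D" for y
    using k(4)[of "(1, y)"] that by (simp add: \<psi>_def)
  have r: "restrict (p \<circ> \<psi>) ?D = \<phi>"
    by (rule extensionalityI[of _ ?D]) (use p\<psi> cell(1)[OF assms(1)] in auto)
  have "continuous_on ?D (\<lambda>y. k (1, y))"
    by (rule continuous_on_compose2[OF k(1)]) (auto intro!: continuous_intros)
  then have "continuous_on ?D \<psi>" by (rule continuous_on_eq) (simp add: \<psi>_def)
  then have "(n, \<psi>) \<in> Kt"
    unfolding Kt_iff using k(2) assms(1) r by (auto simp: \<psi>_def)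
  moreover have "k (1, d) = x"
  proof (rule covering_lift_unique[OF cov, of "{0..1::real}" "\<lambda>t. k (t, d)" "\<lambda>_. x" 0])
    show "continuous_on {0..1} (\<lambda>t. k (t, d))"
      by (rule continuous_on_compose2[OF k(1)]) (use assms(2) in \<open>auto intro!: continuous_intros\<close>)
    show "(\<lambda>t. k (t, d)) \<in> {0..1} \<rightarrow> Mt" using k(2) assms(2) by auto
    show "p (k (t, d)) = p x" if "t \<in> {0..1}" for t
      using k(4)[of "(t, d)"] that assms(2,4) by (simp add: algebra_simps)
  qed (use assms k(3) in auto)
  ultimately show ?thesis using that r assms(2) by (auto simp: \<psi>_def)
qed

lemma cell_point:
  assumes "x \<in> skt k"
  obtains n \<psi> d where "(n, \<psi>) \<in> Kt" "n \<le> k" "d \<in> open_disk n" "x = \<psi> d"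
proof -
  have "p x \<in> skel k" "x \<in> Mt" using assms by (auto simp: skt_def)
  then obtain n \<phi> d where *: "(n, \<phi>) \<in> K" "n \<le> k" "d \<in> open_disk n" "p x = \<phi> d"
    by (auto simp: skel_def open_cell_def)
  then show ?thesis using lift_through[OF *(1) open_diskD[OF *(3)] \<open>x \<in> Mt\<close> *(4)] that by metis
qed

lemma cell_point_unique:
  assumes "(n, \<psi>) \<in> Kt" "(n', \<psi>') \<in> Kt" "d \<in> open_disk n" "d' \<in> open_disk n'" "\<psi> d = \<psi>' d'"
  shows "n = n'" "\<psi> = \<psi>'" "d = d'"
proof -
  have eq: "restrict (p \<circ> \<psi>) (topspace (disk n)) d = restrict (p \<circ> \<psi>') (topspace (disk n')) d'"
    using assms open_diskD by auto
  note * = cell_eqI[OF Kt_cell(4)[OF assms(1)] Kt_cell(4)[OF assms(2)] assms(3,4) eq]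
  show 1: "n = n'" "d = d'" using * by auto
  show "\<psi> = \<psi>'"
  proof (rule lift_unique[OF assms(1) _ open_diskD[OF assms(3)]])
    show "p (\<psi> y) = p (\<psi>' y)" if "y \<in> topspace (disk n)" for y
      using *(2) that 1(1) Kt_apply by metis
  qed (use assms 1 in auto)
qed

text \<open>The complement is a finite union of images of compact sets, and these are closed in the Hausdorff space
  \<open>M\<close>.\<close>

lemma openin_skel:
  assumes "A \<subseteq> skel k"
    and "\<And>n \<phi>. (n, \<phi>) \<in> K \<Longrightarrow> n \<le> k \<Longrightarrow> openin (top_of_set (topspace (disk n))) (topspace (disk n) \<inter> \<phi> -` A)"
  shows "openin (top_of_set (skel k)) A"
proof -
  let ?F = "\<lambda>e. snd e ` (topspace (disk (fst e)) - snd e -` A)"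
  let ?K = "{e \<in> K. fst e \<le> k}"
  have "Hausdorff_space (subtopology (top_of_set M) (skel k))"
    using Hausdorff Hausdorff_space_subtopology by blast
  then have H: "Hausdorff_space (top_of_set (skel k))"
    using skel_subset by (metis subtopology_subtopology inf.absorb_iff2)
  have "closedin (top_of_set (skel k)) (?F e)" if "e \<in> ?K" for e
  proof -
    obtain n \<phi> where e1: "e = (n, \<phi>)" by fastforce
    with that have e: "e = (n, \<phi>)" "(n, \<phi>) \<in> K" "n \<le> k" by auto
    let ?D = "topspace (disk n)"
    have "closedin (top_of_set ?D) (?D - ?D \<inter> \<phi> -` A)"
      using assms(2)[OF e(2,3)] by (simp add: closedin_diff)
    then have "compact (?D - ?D \<inter> \<phi> -` A)" using closedin_compact compact_disk by blast
    moreover have "?D - ?D \<inter> \<phi> -` A = ?D - \<phi> -` A" by auto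
    ultimately have "compact (\<phi> ` (?D - \<phi> -` A))"
      by (metis compact_continuous_image continuous_on_subset cell(2)[OF e(2)] Diff_subset)
    moreover have "\<phi> ` (?D - \<phi> -` A) \<subseteq> skel k" using disk_in_skel e by auto
    ultimately have "compactin (top_of_set (skel k)) (\<phi> ` (?D - \<phi> -` A))"
      by (simp add: compactin_subtopology)
    then show ?thesis using compactin_imp_closedin[OF H] e by auto
  qed
  then have "closedin (top_of_set (skel k)) (\<Union>e\<in>?K. ?F e)"
    using finite_K by (intro closedin_Union) auto
  moreover have "(\<Union>e\<in>?K. ?F e) = skel k - A"
  proof (intro equalityI subsetI)
    fix x assume "x \<in> (\<Union>e\<in>?K. ?F e)"
    then show "x \<in> skel k - A" using disk_in_skel by auto
  next
    fix x assume x: "x \<in> skel k - A"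
    then obtain n \<phi> d where "(n, \<phi>) \<in> K" "n \<le> k" "d \<in> open_disk n" "x = \<phi> d"
      by (auto simp: skel_def open_cell_def)
    then show "x \<in> (\<Union>e\<in>?K. ?F e)" using x open_diskD
      by (intro UN_I[of "(n, \<phi>)"]) auto
  qed
  ultimately show ?thesis using assms(1) by (simp add: openin_closedin_eq)
qed

text \<open>The weak topology passes to the cover: a local section \<open>s\<close> over an evenly covered set reduces the claim to
  the base, because near a given point of a disk the lift of a cell \<open>\<phi>\<close> through that point of the sheet
  is \<open>s \<circ> \<phi>\<close>.\<close>

lemma openin_skt:
  assumes "W \<subseteq> skt k"
    and W: "\<And>n \<psi>. (n, \<psi>) \<in> Kt \<Longrightarrow> n \<le> k \<Longrightarrow> openin (top_of_set (topspace (disk n))) (topspace (disk n) \<inter> \<psi> -` W)"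
  shows "openin (top_of_set (skt k)) W"
proof (subst openin_subopen, intro ballI)
  fix x assume x: "x \<in> W"
  then have xM: "x \<in> Mt" "p x \<in> M" using assms(1) skt_subset p_Mt by auto
  from covering_sheets[OF cov xM(2)] obtain U v where U: "p x \<in> U" "openin (top_of_set M) U" "\<Union>v = Mt \<inter> p -` U"
    "\<forall>V\<in>v. openin (top_of_set Mt) V" "\<forall>V\<in>v. \<forall>W\<in>v. V \<inter> W \<noteq> {} \<longrightarrow> V = W"
    "\<forall>V\<in>v. \<exists>s. homeomorphism V U p s" .
  note U = U(1-3) U(4-6)[rule_format]
  obtain V where V: "V \<in> v" "x \<in> V" using U(1,3) xM(1) by blast
  then obtain s where "homeomorphism V U p s" using U(6) by blast
  then have s: "continuous_on U s" "s ` U = V" "\<And>y. y \<in> U \<Longrightarrow> p (s y) = y" "\<And>y. y \<in> V \<Longrightarrow> s (p y) = y" "p ` V = U"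
    by (auto simp: homeomorphism_def)
  have VM: "V \<subseteq> Mt" using U(4)[OF V(1)] openin_imp_subset by auto
  define A where "A = {y \<in> U \<inter> skel k. s y \<in> W}"
  have A: "openin (top_of_set (skel k)) A"
  proof (rule openin_skel)
    fix n \<phi> assume n: "(n, \<phi>) \<in> K" "n \<le> k"
    let ?D = "topspace (disk n)"
    show "openin (top_of_set ?D) (?D \<inter> \<phi> -` A)"
    proof (subst openin_subopen, intro ballI)
      fix d assume "d \<in> ?D \<inter> \<phi> -` A"
      then have d: "d \<in> ?D" "\<phi> d \<in> U" "s (\<phi> d) \<in> W" by (auto simp: A_def)
      have "s (\<phi> d) \<in> Mt" using d(2) s(2) VM by auto
      from lift_through[OF n(1) d(1) this] obtain \<psi> where \<psi>: "(n, \<psi>) \<in> Kt"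
        "restrict (p \<circ> \<psi>) ?D = \<phi>" "\<psi> d = s (\<phi> d)" using s(3)[OF d(2)] by metis
      let ?T = "(?D \<inter> \<psi> -` W) \<inter> (?D \<inter> \<psi> -` V)"
      have "openin (top_of_set ?D) (?D \<inter> \<psi> -` V)"
        using openin_preimage Kt_cell(2,3)[OF \<psi>(1)] U(4)[OF V(1)] by blast
      then have "openin (top_of_set ?D) ?T" using W[OF \<psi>(1) n(2)] by blast
      moreover have "d \<in> ?T" using d \<psi>(3) s(2) by auto
      moreover have "?T \<subseteq> ?D \<inter> \<phi> -` A"
      proof
        fix y assume y: "y \<in> ?T"
        have py: "p (\<psi> y) = \<phi> y" using \<psi>(2) y Kt_apply[of y n \<psi>] by auto
        then have "\<phi> y \<in> U" "s (\<phi> y) = \<psi> y" using y s(4,5) by force+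
        then show "y \<in> ?D \<inter> \<phi> -` A" using y disk_in_skel[OF n(1) _ n(2)] by (auto simp: A_def)
      qed
      ultimately show "\<exists>T. openin (top_of_set ?D) T \<and> d \<in> T \<and> T \<subseteq> ?D \<inter> \<phi> -` A" by blast
    qed
  qed (auto simp: A_def)
  have pc: "continuous_on (skt k) p" "p \<in> skt k \<rightarrow> skel k"
    using continuous_on_subset[OF covering_space_imp_continuous[OF cov] skt_subset] by (auto simp: skt_def)
  have 1: "openin (top_of_set (skt k)) (skt k \<inter> p -` A)" by (rule openin_preimage[OF pc A])
  have 2: "openin (top_of_set (skt k)) (skt k \<inter> V)"
  proof -
    obtain Q where "open Q" "V = Mt \<inter> Q" using U(4)[OF V(1)] by (auto simp: openin_open)
    then have "open Q" "skt k \<inter> V = skt k \<inter> Q" using skt_subset by auto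
    then show ?thesis by (simp add: openin_open_Int)
  qed
  show "\<exists>T. openin (top_of_set (skt k)) T \<and> x \<in> T \<and> T \<subseteq> W"
  proof (intro exI[of _ "(skt k \<inter> p -` A) \<inter> (skt k \<inter> V)"] conjI)
    show "x \<in> skt k \<inter> p -` A \<inter> (skt k \<inter> V)"
      using x assms(1) V(2) s(4,5) pc(2) by (auto simp: A_def)
    show "skt k \<inter> p -` A \<inter> (skt k \<inter> V) \<subseteq> W" using s(4) by (auto simp: A_def)
  qed (use 1 2 in blast)
qed

lemma continuous_on_skt:
  fixes f :: "'b \<Rightarrow> 'd::topological_space"
  assumes "\<And>n \<psi>. (n, \<psi>) \<in> Kt \<Longrightarrow> n \<le> k \<Longrightarrow> continuous_on (topspace (disk n)) (\<lambda>d. f (\<psi> d))"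
  shows "continuous_on (skt k) f"
proof -
  have "openin (top_of_set (skt k)) (skt k \<inter> f -` B)" if "open B" for B
  proof (rule openin_skt)
    fix n \<psi> assume n: "(n, \<psi>) \<in> Kt" "n \<le> k"
    let ?D = "topspace (disk n)"
    have "openin (top_of_set ?D) (?D \<inter> (\<lambda>d. f (\<psi> d)) -` B)"
      using continuous_openin_preimage_gen[OF assms[OF n] that] .
    moreover have "?D \<inter> (\<lambda>d. f (\<psi> d)) -` B = ?D \<inter> \<psi> -` (skt k \<inter> f -` B)"
      using lift_disk_in_skt[OF n(1) _ n(2)] by auto
    ultimately show "openin (top_of_set ?D) (?D \<inter> \<psi> -` (skt k \<inter> f -` B))" by simp
  qed auto
  then show ?thesis
    unfolding continuous_on_open_invariant openin_open by (metis inf_commute)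
qed

lemma continuous_on_Mt:
  fixes f :: "'b \<Rightarrow> 'd::topological_space"
  assumes "\<And>n \<psi>. (n, \<psi>) \<in> Kt \<Longrightarrow> continuous_on (topspace (disk n)) (\<lambda>d. f (\<psi> d))"
  shows "continuous_on Mt f"
  using continuous_on_skt[of dimK f] assms skt_dimK by simp

end

section \<open>Deck transformations of the universal cover\<close>

lemma join_ends: "(g +++ h) 0 = g 0" "(g +++ h) 1 = h 1"
  by (auto simp: joinpaths_def)

lemma join_path:
  assumes "path g" "path h" "g 1 = h 0"
  shows "path (g +++ h)"
  using assms by (intro path_join_imp) (auto simp: pathstart_def pathfinish_def)

lemma join_image: "path_image g \<subseteq> S \<Longrightarrow> path_image h \<subseteq> S \<Longrightarrow> path_image (g +++ h) \<subseteq> S"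
  using path_image_join_subset[of g h] by blast

lemma join_pointwise:
  assumes "\<And>t. t \<in> {0..1} \<Longrightarrow> P (g t) (g' t)" "\<And>t. t \<in> {0..1} \<Longrightarrow> P (h t) (h' t)" "t \<in> {0..1}"
  shows "P ((g +++ h) t) ((g' +++ h') t)"
  using assms(1)[of "2 * t"] assms(2)[of "2 * t - 1"] assms(3) by (auto simp: joinpaths_def)

lemma reverse_ends: "reversepath g 0 = g 1" "reversepath g 1 = g 0"
  by (auto simp: reversepath_def)

lemma reverse_apply: "t \<in> {0..1} \<Longrightarrow> \<exists>s\<in>{0..1}. reversepath g t = g s \<and> reversepath h t = h s"
  by (auto simp: reversepath_def intro!: bexI[of _ "1 - t"])

lemma homotopic_paths_imp_square:
  assumes "homotopic_paths S g g'"
  obtains h :: "real \<times> real \<Rightarrow> 'a::topological_space" where "continuous_on ({0..1} \<times> {0..1}) h"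
    "h \<in> {0..1} \<times> {0..1} \<rightarrow> S" "\<forall>x\<in>{0..1}. h (0, x) = g x" "\<forall>x\<in>{0..1}. h (1, x) = g' x"
    "\<forall>t\<in>{0..1}. h (t, 0) = g 0" "\<forall>t\<in>{0..1}. h (t, 1) = g 1"
proof -
  from assms[unfolded homotopic_paths] obtain h :: "real \<times> real \<Rightarrow> 'a"
    where h: "continuous_on ({0..1} \<times> {0..1}) h \<and> h \<in> {0..1} \<times> {0..1} \<rightarrow> S \<and>
    (\<forall>x\<in>{0..1}. h (0, x) = g x) \<and> (\<forall>x\<in>{0..1}. h (1, x) = g' x) \<and>
    (\<forall>t\<in>{0..1::real}. pathstart (h \<circ> Pair t) = pathstart g \<and> pathfinish (h \<circ> Pair t) = pathfinish g)"
    by (rule exE)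
  note h' = h[unfolded pathstart_def pathfinish_def comp_apply]
  show ?thesis
    by (rule that[of h]; use h' in blast)
qed

lemma class_reversepath:
  assumes "g \<in> loops_at S x"
  shows "path_class S (g +++ reversepath g) = \<one>\<^bsub>fundamental_group S x\<^esub>"
proof -
  have g: "path g" "path_image g \<subseteq> S" "g 0 = x" using assms by (auto simp: loops_at_def pathstart_def)
  let ?m = "\<lambda>t::real. min (2 * t) (2 - 2 * t)"
  have "homotopic_paths S (g \<circ> ?m) (g \<circ> (\<lambda>_. 0))"
  proof (rule homotopic_paths_reparam[OF g(1,2)])
    show "continuous_on {0..1} ?m" by (intro continuous_intros)
    show "?m ` {0..1} \<subseteq> {0..1}" by (auto simp: min_def)
  qed auto
  moreover have "g \<circ> ?m = g +++ reversepath g"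
    by (auto simp: fun_eq_iff joinpaths_def reversepath_def min_def algebra_simps)
  ultimately have "homotopic_paths S (g +++ reversepath g) (\<lambda>_. x)" using g(3) by (simp add: o_def)
  from path_class_eq[OF this] show ?thesis by (simp add: fundamental_group_def)
qed

context covered_complex
begin

abbreviation deck :: "('b \<Rightarrow> 'b) \<Rightarrow> bool" where "deck \<equiv> deck_transformation Mt p"

lemma deckD:
  assumes "deck f"
  shows "continuous_on Mt f" "x \<in> Mt \<Longrightarrow> f x \<in> Mt" "x \<in> Mt \<Longrightarrow> p (f x) = p x" "f \<in> Mt \<rightarrow> Mt"
  using assms by (auto simp: deck_transformation_def homeomorphism_def)

lemma deck_cell:
  assumes "deck f" "(n, \<psi>) \<in> Kt"
  shows "(n, restrict (f \<circ> \<psi>) (topspace (disk n))) \<in> Kt"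
proof -
  let ?D = "topspace (disk n)"
  have "continuous_on ?D (\<lambda>d. f (\<psi> d))"
    by (rule continuous_on_compose2[OF deckD(1)[OF assms(1)] Kt_cell(2)[OF assms(2)]])
      (use Kt_cell(3)[OF assms(2)] in auto)
  then have "continuous_on ?D (restrict (f \<circ> \<psi>) ?D)" by (rule continuous_on_eq) simp
  moreover have "restrict (p \<circ> restrict (f \<circ> \<psi>) ?D) ?D = restrict (p \<circ> \<psi>) ?D"
    using Kt_cell(3)[OF assms(2)] deckD(3)[OF assms(1)] by (intro restrict_ext) auto
  ultimately show ?thesis
    using Kt_cell[OF assms(2)] deckD(2)[OF assms(1)] by (auto simp: Kt_iff Pi_iff)
qed

text \<open>A null homotopy of the projection lifts. The lift is constant on three edges of the square, because its
  projection is constant there, and these edges join the two ends of \<open>k\<close>.\<close>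

lemma null_homotopic_lift_closed:
  assumes hom: "homotopic_paths M g (\<lambda>_. c)"
    and k: "continuous_on {0..1} k" "k \<in> {0..1} \<rightarrow> Mt" "\<And>t. t \<in> {0..1} \<Longrightarrow> p (k t) = g t"
  shows "k 1 = k 0"
proof -
  from homotopic_paths_imp_square[OF hom] obtain h :: "real \<times> real \<Rightarrow> 'a" where h: "continuous_on ({0..1} \<times> {0..1}) h"
    "h \<in> {0..1} \<times> {0..1} \<rightarrow> M" "\<forall>x\<in>{0..1}. h (0, x) = g x" "\<forall>x\<in>{0..1}. h (1, x) = c"
    "\<forall>t\<in>{0..1}. h (t, 0) = g 0" "\<forall>t\<in>{0..1}. h (t, 1) = g 1" .
  obtain l where l: "continuous_on ({0..1} \<times> {0..1}) l" "l \<in> {0..1} \<times> {0..1} \<rightarrow> Mt"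
    "\<And>z. z \<in> {0..1} \<Longrightarrow> l (0, z) = k z" "\<And>w. w \<in> {0..1} \<times> {0..1} \<Longrightarrow> p (l w) = h w"
    by (rule covering_lift_homotopy[OF cov h(1,2) k(1,2)]) (use h(3) k(3) in auto)
  have const: "l (f 1) = l (f 0)"
    if f: "continuous_on {0..1} f" "f \<in> {0..1} \<rightarrow> {0..1} \<times> {0..1}" and e: "\<And>t. t \<in> {0..1} \<Longrightarrow> h (f t) = h (f 0)"
    for f :: "real \<Rightarrow> real \<times> real"
  proof (rule covering_lift_unique[OF cov, of "{0..1::real}" "\<lambda>t. l (f t)" "\<lambda>_. l (f 0)" 0])
    show "continuous_on {0..1} (\<lambda>t. l (f t))"
      by (rule continuous_on_compose2[OF l(1) f(1)]) (use f(2) in blast)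
    have fr: "f t \<in> {0..1} \<times> {0..1}" if "t \<in> {0..1}" for t using f(2) that by blast
    have f0: "f 0 \<in> {0..1} \<times> {0..1}" by (rule fr) simp
    show "(\<lambda>t. l (f t)) \<in> {0..1} \<rightarrow> Mt" using l(2) fr by blast
    have "l (f 0) \<in> Mt" by (rule funcset_mem[OF l(2) f0])
    then show "(\<lambda>_. l (f 0)) \<in> {0..1::real} \<rightarrow> Mt" by simp
    show "p (l (f t)) = p (l (f 0))" if "t \<in> {0..1}" for t
      using l(4)[OF fr[OF that]] l(4)[OF f0] e[OF that] by simp
  qed auto
  have "l (1, 0) = l (0, 0)"
    using const[of "\<lambda>t. (t, 0)", OF continuous_on_Pair[OF continuous_on_id continuous_on_const]] h(5) by auto
  moreover have "l (1, 1) = l (0, 1)"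
    using const[of "\<lambda>t. (t, 1)", OF continuous_on_Pair[OF continuous_on_id continuous_on_const]] h(6) by auto
  moreover have "l (1, 1) = l (1, 0)"
    using const[of "\<lambda>t. (1, t)", OF continuous_on_Pair[OF continuous_on_const continuous_on_id]] h(4) by auto
  ultimately show ?thesis using l(3) by auto
qed

end

locale universal_cover = covered_complex +
  fixes b :: 'b
  assumes sc: "simply_connected Mt" and b: "b \<in> Mt"
begin

lemma pathconn: "path_connected Mt" using simply_connected_imp_path_connected_topological[OF sc] .

lemma conn: "connected Mt" using path_connected_imp_connected[OF pathconn] .

lemma p_cont: "continuous_on Mt p" using covering_space_imp_continuous[OF cov] .

lemma deck_unique:
  assumes "deck f" "deck f'" "x \<in> Mt" "f x = f' x" "y \<in> Mt"
  shows "f y = f' y"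
  using covering_lift_unique[of Mt p M Mt f f' x y] cov conn deckD(1,4)[OF assms(1)] deckD(1,4)[OF assms(2)]
    assms(3,4,5) deckD(3)[OF assms(1)] deckD(3)[OF assms(2)] by simp

lemma path_p:
  assumes "path g" "path_image g \<subseteq> Mt"
  shows "path (p \<circ> g)" "path_image (p \<circ> g) \<subseteq> M"
  using assms p_cont p_Mt by (auto simp: path_image_def intro!: path_continuous_image elim: continuous_on_subset)

lemma loop_image_null_homotopic:
  assumes "path g" "path_image g \<subseteq> Mt" "g 1 = g 0"
  shows "homotopic_paths M (p \<circ> g) (\<lambda>_. p (g 0))"
proof -
  have "homotopic_paths Mt g (\<lambda>_. g 0)"
    using simply_connected_imp_null_homotopic[OF sc assms(1,2)] assms(3) by (simp add: pathstart_def pathfinish_def)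
  then have "homotopic_paths M (p \<circ> g) (p \<circ> (\<lambda>_. g 0))"
    by (rule homotopic_paths_continuous_image) (use p_cont p_Mt in auto)
  then show ?thesis by (simp add: o_def)
qed

text \<open>The map sends the end of a path from \<open>x0\<close> to the end of the lift, starting at \<open>y0\<close>, of the projected path.
  This is well defined because loops in \<open>Mt\<close> project to null-homotopic loops. It is continuous by the
  weak topology, because its composite with a lift of a cell is again a lift of this cell.\<close>

lemma lift_map_exists:
  assumes x0: "x0 \<in> Mt" and y0: "y0 \<in> Mt" and xy: "p x0 = p y0"
  obtains f where "continuous_on Mt f" "f \<in> Mt \<rightarrow> Mt" "\<And>x. x \<in> Mt \<Longrightarrow> p (f x) = p x" "f x0 = y0"
proof -
  have "\<exists>g k. path g \<and> path_image g \<subseteq> Mt \<and> g 0 = x0 \<and> g 1 = x \<and> path k \<and> path_image k \<subseteq> Mt \<and> k 0 = y0 \<and>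
      (\<forall>t\<in>{0..1}. p (k t) = p (g t))" if x: "x \<in> Mt" for x
  proof -
    obtain g where g: "path g" "path_image g \<subseteq> Mt" "g 0 = x0" "g 1 = x"
      using pathconn x x0 unfolding path_connected_def pathstart_def pathfinish_def by blast
    have "continuous_on {0..1} (p \<circ> g)" "(p \<circ> g) ` {0..1} \<subseteq> M"
      using path_p[OF g(1,2)] by (auto simp: path_def path_image_def)
    from covering_lift_path_interval[OF cov zero_le_one this y0] obtain k where
      "continuous_on {0..1} k" "k ` {0..1} \<subseteq> Mt" "k 0 = y0" "\<And>r. r \<in> {0..1} \<Longrightarrow> p (k r) = (p \<circ> g) r"
      using g(3) xy by auto
    then show ?thesis using g by (intro exI[of _ g] exI[of _ k]) (auto simp: path_def path_image_def)
  qed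
  then obtain g k where gk: "\<And>x. x \<in> Mt \<Longrightarrow> path (g x) \<and> path_image (g x) \<subseteq> Mt \<and> g x 0 = x0 \<and> g x 1 = x \<and>
      path (k x) \<and> path_image (k x) \<subseteq> Mt \<and> k x 0 = y0 \<and> (\<forall>t\<in>{0..1}. p (k x t) = p (g x t))" by metis
  define f where "f x = k x 1" for x
  (* Two paths to x form a loop in Mt whose projection lifts to a closed path. *)
  have indep: "k' 1 = f x"
    if g': "path g'" "path_image g' \<subseteq> Mt" "g' 0 = x0" "g' 1 = x" and x: "x \<in> Mt"
      and k': "path k'" "path_image k' \<subseteq> Mt" "k' 0 = y0" "\<And>t. t \<in> {0..1} \<Longrightarrow> p (k' t) = p (g' t)"
    for g' k' x
  proof -
    let ?g = "reversepath g' +++ g x" and ?k = "reversepath k' +++ k x"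
    have "path ?g" "path_image ?g \<subseteq> Mt" "?g 1 = ?g 0" "?g 0 = x"
      using g' gk[OF x] join_image[of "reversepath g'" Mt "g x"] by (auto simp: join_ends reverse_ends intro!: join_path)
    then have hom: "homotopic_paths M (p \<circ> ?g) (\<lambda>_. p (?g 0))" by (intro loop_image_null_homotopic)
    have "path ?k" "path_image ?k \<subseteq> Mt"
      using k' gk[OF x] join_image[of "reversepath k'" Mt "k x"] by (auto simp: join_ends reverse_ends intro!: join_path)
    moreover have "p (?k t) = (p \<circ> ?g) t" if "t \<in> {0..1}" for t
      unfolding comp_apply
    proof (rule join_pointwise[where P = "\<lambda>x y. p x = p y", OF _ _ that])
      show "p (reversepath k' s) = p (reversepath g' s)" if "s \<in> {0..1}" for s
        using reverse_apply[OF that, of k' g'] k'(4) by auto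
    qed (use gk[OF x] in blast)
    ultimately have "?k 1 = ?k 0"
      by (intro null_homotopic_lift_closed[OF hom]) (auto simp: path_def path_image_def)
    then show ?thesis by (simp add: f_def join_ends reverse_ends)
  qed
  have fM: "f x \<in> Mt" and pf: "p (f x) = p x" if "x \<in> Mt" for x
    using gk[OF that] by (auto simp: f_def path_image_def)
  have fx0: "f x0 = y0"
    using indep[of "\<lambda>_. x0" x0 "\<lambda>_. y0"] x0 y0 xy by (simp add: path_image_def path_def)
  have "continuous_on Mt f"
  proof (rule continuous_on_Mt)
    fix n \<psi> assume \<psi>: "(n, \<psi>) \<in> Kt"
    let ?D = "topspace (disk n)"
    let ?o = "\<lambda>_. 0 :: real"
    have o: "?o \<in> ?D" using zero_in_open_disk open_diskD by blast
    then have xo: "\<psi> ?o \<in> Mt" using Kt_cell(3)[OF \<psi>] by auto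
    have "p (f (\<psi> ?o)) = restrict (p \<circ> \<psi>) ?D ?o" using pf[OF xo] o by simp
    from lift_through[OF Kt_cell(4)[OF \<psi>] o fM[OF xo] this] obtain \<psi>' where
      \<psi>': "(n, \<psi>') \<in> Kt" "restrict (p \<circ> \<psi>') ?D = restrict (p \<circ> \<psi>) ?D" "\<psi>' ?o = f (\<psi> ?o)" .
    have eq: "\<psi>' d = f (\<psi> d)" if d: "d \<in> ?D" for d
    proof -
      obtain s where s: "path s" "path_image s \<subseteq> ?D" "s 0 = ?o" "s 1 = d"
        using path_connected_disk o d unfolding path_connected_def
        by (metis pathstart_def pathfinish_def)
      have ps: "path (\<psi> \<circ> s)" "path (\<psi>' \<circ> s)"
        using s Kt_cell(2)[OF \<psi>] Kt_cell(2)[OF \<psi>'(1)] by (auto intro!: path_continuous_image elim: continuous_on_subset)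
      have sD: "s t \<in> ?D" if "t \<in> {0..1}" for t using s(2) that by (auto simp: path_image_def)
      have "\<psi> (s t) \<in> Mt" "\<psi>' (s t) \<in> Mt" "p (\<psi>' (s t)) = p (\<psi> (s t))" if "t \<in> {0..1}" for t
        using sD[OF that] Kt_cell(3)[OF \<psi>] Kt_cell(3)[OF \<psi>'(1)] fun_cong[OF \<psi>'(2), of "s t"] by auto
      note 1 = this gk[OF xo]
      have "((k (\<psi> ?o)) +++ (\<psi>' \<circ> s)) 1 = f (\<psi> d)"
      proof (rule indep[of "g (\<psi> ?o) +++ (\<psi> \<circ> s)"])
        show "\<psi> d \<in> Mt" using Kt_cell(3)[OF \<psi>] d by auto
        show "path (g (\<psi> ?o) +++ (\<psi> \<circ> s))" "path (k (\<psi> ?o) +++ (\<psi>' \<circ> s))"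
          using 1 ps s \<psi>'(3) by (auto simp: f_def intro!: join_path)
        have "path_image (\<psi> \<circ> s) \<subseteq> Mt" "path_image (\<psi>' \<circ> s) \<subseteq> Mt" using 1(1,2) by (auto simp: path_image_def)
        then show "path_image (g (\<psi> ?o) +++ (\<psi> \<circ> s)) \<subseteq> Mt" "path_image (k (\<psi> ?o) +++ (\<psi>' \<circ> s)) \<subseteq> Mt"
          using 1(4) join_image by blast+
        show "p ((k (\<psi> ?o) +++ (\<psi>' \<circ> s)) t) = p ((g (\<psi> ?o) +++ (\<psi> \<circ> s)) t)" if "t \<in> {0..1}" for t
          by (rule join_pointwise[where P = "\<lambda>x y. p x = p y", OF _ _ that]) (use 1(3,4) in auto)
      qed (use 1(4) s in \<open>auto simp: join_ends\<close>)
      then show ?thesis using s(4) by (simp add: join_ends)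
    qed
    show "continuous_on ?D (\<lambda>d. f (\<psi> d))"
      by (rule continuous_on_eq[OF Kt_cell(2)[OF \<psi>'(1)]]) (rule eq)
  qed
  then show ?thesis using that fM pf fx0 by blast
qed

lemma deck_exists:
  assumes "x \<in> Mt" "y \<in> Mt" "p x = p y"
  obtains f where "deck f" "f x = y"
proof -
  obtain f where f: "continuous_on Mt f" "f \<in> Mt \<rightarrow> Mt" "\<And>x. x \<in> Mt \<Longrightarrow> p (f x) = p x" "f x = y"
    using lift_map_exists[OF assms] by metis
  obtain f' where f': "continuous_on Mt f'" "f' \<in> Mt \<rightarrow> Mt" "\<And>x. x \<in> Mt \<Longrightarrow> p (f' x) = p x" "f' y = x"
    using lift_map_exists[OF assms(2,1) assms(3)[symmetric]] by metis
  have comp: "v (u z) = z"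
    if u: "continuous_on Mt u" "u \<in> Mt \<rightarrow> Mt" "\<And>x. x \<in> Mt \<Longrightarrow> p (u x) = p x"
      and v: "continuous_on Mt v" "v \<in> Mt \<rightarrow> Mt" "\<And>x. x \<in> Mt \<Longrightarrow> p (v x) = p x"
      and a: "a \<in> Mt" "v (u a) = a" and z: "z \<in> Mt" for u v a z
  proof (rule covering_lift_unique[of Mt p M Mt "\<lambda>z. v (u z)" "\<lambda>z. z" a])
    show "continuous_on Mt (\<lambda>z. v (u z))" by (rule continuous_on_compose2[OF v(1) u(1)]) (use u(2) in auto)
    show "p (v (u x)) = p x" if "x \<in> Mt" for x using u(2,3) v(3) that by (metis Pi_iff)
  qed (use u(2) v(2) a z cov conn in auto)
  have "homeomorphism Mt Mt f f'"
  proof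
    show "f' (f z) = z" if "z \<in> Mt" for z using comp[OF f(1-3) f'(1-3) assms(1) _ that] f(4) f'(4) by simp
    show "f (f' z) = z" if "z \<in> Mt" for z using comp[OF f'(1-3) f(1-3) assms(2) _ that] f(4) f'(4) by simp
  qed (use f f' in auto)
  then show ?thesis using that f(3,4) by (auto simp: deck_transformation_def)
qed

lemma deck_comp: "deck f \<Longrightarrow> deck f' \<Longrightarrow> deck (f \<circ> f')"
  unfolding deck_transformation_def
  by (metis (no_types, lifting) comp_apply homeomorphism_compose homeomorphism_image1 imageI)

lemma deck_id: "deck id"
  unfolding deck_transformation_def by (auto intro!: exI[of _ id] homeomorphismI)

lemma deck_inverse:
  assumes "deck f"
  obtains f' where "deck f'" "\<And>x. x \<in> Mt \<Longrightarrow> f' (f x) = x" "\<And>x. x \<in> Mt \<Longrightarrow> f (f' x) = x"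
proof -
  obtain f' where f': "homeomorphism Mt Mt f f'" using assms by (auto simp: deck_transformation_def)
  then have 1: "\<And>x. x \<in> Mt \<Longrightarrow> f' (f x) = x" "\<And>x. x \<in> Mt \<Longrightarrow> f (f' x) = x" "\<And>x. x \<in> Mt \<Longrightarrow> f' x \<in> Mt"
    by (auto simp: homeomorphism_def)
  have "deck f'"
    unfolding deck_transformation_def
    using homeomorphism_symD[OF f'] 1(2,3) deckD(3)[OF assms] by (metis)
  then show ?thesis using that 1 by blast
qed

abbreviation \<pi>1 where "\<pi>1 \<equiv> fundamental_group M (p b)"

abbreviation DS :: "(real \<Rightarrow> 'a) set set \<Rightarrow> ('b \<Rightarrow> 'b) set" where
  "DS N \<equiv> deck_subgroup Mt p M b N"

lemma group_pi1: "group \<pi>1" using group_fundamental_group p_Mt[OF b] .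

lemma loop_p:
  assumes "path g" "path_image g \<subseteq> Mt" "g 0 = b" "p (g 1) = p b"
  shows "p \<circ> g \<in> loops_at M (p b)"
  using path_p[OF assms(1,2)] assms(3,4) by (auto simp: loops_at_def pathstart_def pathfinish_def)

lemma class_mem: "g \<in> loops_at M (p b) \<Longrightarrow> path_class M g \<in> carrier \<pi>1"
  by (simp add: fundamental_group_def)

lemma class_one: "\<one>\<^bsub>\<pi>1\<^esub> = path_class M (\<lambda>_. p b)"
  by (simp add: fundamental_group_def)

lemma class_inv:
  assumes "g \<in> loops_at M (p b)"
  shows "path_class M (reversepath g) = inv\<^bsub>\<pi>1\<^esub> (path_class M g)"
proof -
  have r: "reversepath g \<in> loops_at M (p b)" using assms by (auto simp: loops_at_def)
  have "path_class M g \<otimes>\<^bsub>\<pi>1\<^esub> path_class M (reversepath g) = \<one>\<^bsub>\<pi>1\<^esub>"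
    using class_reversepath[OF assms] fundamental_group_mult_path_class[OF assms r] by simp
  then have "path_class M (reversepath g) \<otimes>\<^bsub>\<pi>1\<^esub> path_class M g = \<one>\<^bsub>\<pi>1\<^esub>"
    using group.inv_comm[OF group_pi1] class_mem[OF assms] class_mem[OF r] by blast
  then show ?thesis using group.inv_equality[OF group_pi1] class_mem[OF assms] class_mem[OF r] by metis
qed

text \<open>In a simply connected cover the class of a path depends only on where it ends.\<close>

lemma class_eq:
  assumes g: "path g" "path_image g \<subseteq> Mt" "g 0 = b" and g': "path g'" "path_image g' \<subseteq> Mt" "g' 0 = b"
    and e: "g 1 = g' 1" "p (g 1) = p b"
  shows "path_class M (p \<circ> g) = path_class M (p \<circ> g')"
proof -
  have l: "p \<circ> g \<in> loops_at M (p b)" "p \<circ> g' \<in> loops_at M (p b)"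
    using loop_p g g' e by auto
  then have r: "reversepath (p \<circ> g') \<in> loops_at M (p b)" by (auto simp: loops_at_def)
  have "homotopic_paths M (p \<circ> (g +++ reversepath g')) (\<lambda>_. p ((g +++ reversepath g') 0))"
    by (rule loop_image_null_homotopic)
      (use g g' e join_image[of g Mt "reversepath g'"] in \<open>auto simp: join_ends reverse_ends intro!: join_path\<close>)
  moreover have "(g +++ reversepath g') 0 = b" using g by (simp add: joinpaths_def)
  moreover have "p \<circ> (g +++ reversepath g') = (p \<circ> g) +++ reversepath (p \<circ> g')"
    by (auto simp: fun_eq_iff joinpaths_def reversepath_def)
  ultimately have "path_class M ((p \<circ> g) +++ reversepath (p \<circ> g')) = \<one>\<^bsub>\<pi>1\<^esub>"
    using path_class_eq by (simp add: class_one)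
  then have "path_class M (p \<circ> g) \<otimes>\<^bsub>\<pi>1\<^esub> inv\<^bsub>\<pi>1\<^esub> (path_class M (p \<circ> g')) = \<one>\<^bsub>\<pi>1\<^esub>"
    using fundamental_group_mult_path_class[OF l(1) r] class_inv[OF l(2)] by simp
  then show ?thesis
    using group.inv_equality[OF group_pi1] class_mem[OF l(1)] class_mem[OF l(2)]
    by (metis group.inv_closed group.inv_inv group_pi1)
qed

lemma DSD:
  assumes "f \<in> DS N"
  obtains g where "deck f" "path g" "path_image g \<subseteq> Mt" "g 0 = b" "g 1 = f b" "path_class M (p \<circ> g) \<in> N"
    "p \<circ> g \<in> loops_at M (p b)"
  using assms loop_p deckD(3)[OF _ b] unfolding deck_subgroup_def pathstart_def pathfinish_def
  by (auto 4 4)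

lemma DSI:
  assumes "deck f" "path g" "path_image g \<subseteq> Mt" "g 0 = b" "g 1 = f b" "path_class M (p \<circ> g) \<in> N"
  shows "f \<in> DS N"
  using assms by (auto simp: deck_subgroup_def pathstart_def pathfinish_def)

lemma DS_mono: "N \<subseteq> N' \<Longrightarrow> DS N \<subseteq> DS N'"
  by (auto simp: deck_subgroup_def)

lemma path_deck:
  assumes "deck f" "path g" "path_image g \<subseteq> Mt"
  shows "path (f \<circ> g)" "path_image (f \<circ> g) \<subseteq> Mt" "t \<in> {0..1} \<Longrightarrow> p (f (g t)) = p (g t)"
proof -
  show "path (f \<circ> g)"
    using assms deckD(1)[OF assms(1)] by (auto intro!: path_continuous_image elim: continuous_on_subset)
  have "g s \<in> Mt" if "s \<in> {0..1}" for s using assms(3) that by (auto simp: path_image_def)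
  then show "path_image (f \<circ> g) \<subseteq> Mt" "t \<in> {0..1} \<Longrightarrow> p (f (g t)) = p (g t)"
    using deckD(2,3)[OF assms(1)] by (auto simp: path_image_def)
qed

lemma path_class_cong:
  assumes "g \<in> loops_at M x" "\<And>t. t \<in> {0..1} \<Longrightarrow> h t = g t"
  shows "path_class M h = path_class M g"
proof -
  have "homotopic_paths M g h"
    by (rule homotopic_paths_eq) (use assms in \<open>auto simp: loops_at_def\<close>)
  then show ?thesis using path_class_eq by metis
qed

lemma DS_id: assumes "subgroup N \<pi>1" shows "id \<in> DS N"
  by (rule DSI[of _ "\<lambda>_. b"])
    (use b deck_id subgroup.one_closed[OF assms] class_one in \<open>auto simp: path_def path_image_def o_def\<close>)

lemma DS_comp:
  assumes N: "subgroup N \<pi>1" and f: "f \<in> DS N" and f': "f' \<in> DS N"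
  shows "f \<circ> f' \<in> DS N"
proof -
  obtain g where g: "deck f" "path g" "path_image g \<subseteq> Mt" "g 0 = b" "g 1 = f b" "path_class M (p \<circ> g) \<in> N"
    "p \<circ> g \<in> loops_at M (p b)" using DSD[OF f] .
  obtain g' where g': "deck f'" "path g'" "path_image g' \<subseteq> Mt" "g' 0 = b" "g' 1 = f' b" "path_class M (p \<circ> g') \<in> N"
    "p \<circ> g' \<in> loops_at M (p b)" using DSD[OF f'] .
  note fg = path_deck[OF g(1) g'(2,3)]
  show ?thesis
  proof (rule DSI[of _ "g +++ (f \<circ> g')"])
    show "deck (f \<circ> f')" using deck_comp g(1) g'(1) .
    show "path (g +++ (f \<circ> g'))"
      using g g' fg by (auto intro!: join_path)
    show "path_image (g +++ (f \<circ> g')) \<subseteq> Mt"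
      using g(3) fg(2) by (rule join_image)
    have "path_class M (p \<circ> (g +++ (f \<circ> g'))) = path_class M ((p \<circ> g) +++ (p \<circ> g'))"
    proof (rule path_class_cong)
      show "(p \<circ> g) +++ (p \<circ> g') \<in> loops_at M (p b)"
        using g(7) g'(7) by (auto simp: loops_at_def path_image_join)
      show "(p \<circ> (g +++ (f \<circ> g'))) t = ((p \<circ> g) +++ (p \<circ> g')) t" if "t \<in> {0..1}" for t
        unfolding comp_apply[of p "g +++ (f \<circ> g')"]
        by (rule join_pointwise[where P = "\<lambda>x y. p x = y", OF _ _ that]) (use fg(3) in auto)
    qed
    then show "path_class M (p \<circ> (g +++ (f \<circ> g'))) \<in> N"
      using fundamental_group_mult_path_class[OF g(7) g'(7)] subgroup.m_closed[OF N g(6) g'(6)] by simp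
  qed (use g g' in \<open>auto simp: join_ends\<close>)
qed

lemma DS_inv:
  assumes N: "subgroup N \<pi>1" and f: "f \<in> DS N" and f': "deck f'" "\<And>x. x \<in> Mt \<Longrightarrow> f' (f x) = x"
  shows "f' \<in> DS N"
proof -
  obtain g where g: "deck f" "path g" "path_image g \<subseteq> Mt" "g 0 = b" "g 1 = f b" "path_class M (p \<circ> g) \<in> N"
    "p \<circ> g \<in> loops_at M (p b)" using DSD[OF f] .
  have r: "path (reversepath g)" "path_image (reversepath g) \<subseteq> Mt" using g by auto
  note fg = path_deck[OF f'(1) r]
  show ?thesis
  proof (rule DSI[of _ "f' \<circ> reversepath g"])
    have "path_class M (p \<circ> (f' \<circ> reversepath g)) = path_class M (reversepath (p \<circ> g))"
    proof (rule path_class_cong)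
      show "reversepath (p \<circ> g) \<in> loops_at M (p b)" using g(7) by (auto simp: loops_at_def)
    qed (use fg(3) in \<open>auto simp: reversepath_def\<close>)
    then show "path_class M (p \<circ> (f' \<circ> reversepath g)) \<in> N"
      using class_inv[OF g(7)] subgroup.m_inv_closed[OF N g(6)] by simp
  qed (use f' b g fg in \<open>auto simp: reversepath_def\<close>)
qed

text \<open>Join \<open>b\<close> to \<open>t b\<close> by a path \<open>k\<close>. Running along \<open>k\<close>, along the translate by \<open>t\<close> of a path for \<open>f\<close>, and back along
  a translate of \<open>k\<close> leads from \<open>b\<close> to its image under the conjugate, and the class of this path is the
  conjugate by the class of \<open>k\<close>.\<close>

lemma DS_conj:
  assumes N: "N \<lhd> \<pi>1" and f: "f \<in> DS N" and t: "deck t" and t': "deck t'" "\<And>x. x \<in> Mt \<Longrightarrow> t' (t x) = x"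
  shows "t \<circ> f \<circ> t' \<in> DS N"
proof -
  obtain g where g: "deck f" "path g" "path_image g \<subseteq> Mt" "g 0 = b" "g 1 = f b" "path_class M (p \<circ> g) \<in> N"
    "p \<circ> g \<in> loops_at M (p b)" using DSD[OF f] .
  have tb: "t b \<in> Mt" using deckD(2)[OF t b] .
  obtain k where k: "path k" "path_image k \<subseteq> Mt" "k 0 = b" "k 1 = t b"
    using pathconn b tb unfolding path_connected_def by (metis pathstart_def pathfinish_def)
  have pk: "p \<circ> k \<in> loops_at M (p b)" by (rule loop_p[OF k(1-3)]) (use k(4) deckD(3)[OF t b] in simp)
  have r: "path (reversepath k)" "path_image (reversepath k) \<subseteq> Mt" using k by auto
  have rl: "reversepath (p \<circ> k) \<in> loops_at M (p b)" using pk by (auto simp: loops_at_def)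
  let ?u = "t \<circ> f \<circ> t'"
  have du: "deck ?u" using deck_comp t g(1) t'(1) by blast
  note tg = path_deck[OF t g(2,3)] and uk = path_deck[OF du r]
  let ?q = "k +++ ((t \<circ> g) +++ (?u \<circ> reversepath k))"
  let ?Q = "(p \<circ> k) +++ ((p \<circ> g) +++ reversepath (p \<circ> k))"
  have m: "(p \<circ> g) +++ reversepath (p \<circ> k) \<in> loops_at M (p b)" "?Q \<in> loops_at M (p b)"
    using g(7) rl pk by (auto simp: loops_at_def path_image_join)
  show ?thesis
  proof (rule DSI[OF du, of ?q])
    show "path ?q"
      using g k tg uk t'(2) b by (auto simp: join_ends reverse_ends intro!: join_path)
    show "path_image ?q \<subseteq> Mt"
      using k(2) tg(2) uk(2) by (intro join_image)
    have "(p \<circ> ?q) s = ?Q s" if s: "s \<in> {0..1}" for s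
      unfolding comp_apply[of p ?q]
    proof (rule join_pointwise[where P = "\<lambda>x y. p x = y", OF _ _ s])
      fix r :: real assume r: "r \<in> {0..1}"
      show "p (((t \<circ> g) +++ (?u \<circ> reversepath k)) r) = ((p \<circ> g) +++ reversepath (p \<circ> k)) r"
        by (rule join_pointwise[where P = "\<lambda>x y. p x = y", OF _ _ r]) (use tg(3) uk(3) in \<open>auto simp: reversepath_def\<close>)
    qed auto
    then have "path_class M (p \<circ> ?q) = path_class M ?Q"
      by (rule path_class_cong[OF m(2)])
    also have "\<dots> = path_class M (p \<circ> k) \<otimes>\<^bsub>\<pi>1\<^esub> (path_class M (p \<circ> g) \<otimes>\<^bsub>\<pi>1\<^esub> inv\<^bsub>\<pi>1\<^esub> path_class M (p \<circ> k))"
      using fundamental_group_mult_path_class[OF pk m(1)] fundamental_group_mult_path_class[OF g(7) rl]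
        class_inv[OF pk] by simp
    also have "\<dots> = path_class M (p \<circ> k) \<otimes>\<^bsub>\<pi>1\<^esub> path_class M (p \<circ> g) \<otimes>\<^bsub>\<pi>1\<^esub> inv\<^bsub>\<pi>1\<^esub> path_class M (p \<circ> k)"
      using group_pi1 class_mem[OF pk] class_mem[OF g(7)] by (simp add: group.is_monoid monoid.m_assoc)
    also have "\<dots> \<in> N" using normal.inv_op_closed2[OF N class_mem[OF pk] g(6)] .
    finally show "path_class M (p \<circ> ?q) \<in> N" .
  qed (use k g t'(2) b in \<open>auto simp: join_ends reverse_ends\<close>)
qed

text \<open>All deck transformations that take \<open>x\<close> to \<open>y\<close> are equal, so if such elements occur in infinitely many of the
  groups, then the class of one path from \<open>b\<close> belongs to all the \<open>N i\<close>. It is trivial, and the path closes up.\<close>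

lemma DS_separates:
  assumes "(\<Inter>i. N i) = {\<one>\<^bsub>\<pi>1\<^esub>}" "\<And>i. N (Suc i) \<subseteq> N i" "x \<in> Mt" "x \<noteq> y"
  shows "\<exists>i. \<forall>j\<ge>i. \<forall>h\<in>DS (N j). h x \<noteq> y"
proof (rule ccontr)
  assume c: "\<not> ?thesis"
  have anti: "DS (N j) \<subseteq> DS (N i)" if "i \<le> j" for i j
    by (rule DS_mono) (rule lift_Suc_antimono_le[of N, OF assms(2) that])
  have "\<exists>h\<in>DS (N i). h x = y" for i using c anti by blast
  then obtain h where h: "\<And>i. h i \<in> DS (N i)" "\<And>i. h i x = y" by metis
  obtain g where g: "deck (h 0)" "path g" "path_image g \<subseteq> Mt" "g 0 = b" "g 1 = h 0 b" "p \<circ> g \<in> loops_at M (p b)"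
    using DSD[OF h(1)] by metis
  have "path_class M (p \<circ> g) \<in> N i" for i
  proof -
    obtain g' where g': "deck (h i)" "path g'" "path_image g' \<subseteq> Mt" "g' 0 = b" "g' 1 = h i b"
      "path_class M (p \<circ> g') \<in> N i" using DSD[OF h(1)] by metis
    have "h 0 b = h i b" using deck_unique[OF g(1) g'(1) assms(3) _ b] h(2) by simp
    then have "path_class M (p \<circ> g) = path_class M (p \<circ> g')"
      using g g' deckD(3)[OF g(1) b] by (intro class_eq) auto
    then show ?thesis using g'(6) by simp
  qed
  then have "path_class M (p \<circ> g) = \<one>\<^bsub>\<pi>1\<^esub>" using assms(1) by blast
  moreover have "p \<circ> g \<in> path_class M (p \<circ> g)"
    using g(6) by (simp add: path_class_def loops_at_def)
  ultimately have "homotopic_paths M (\<lambda>_. p b) (p \<circ> g)" by (simp add: class_one path_class_def)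
  then have "homotopic_paths M (p \<circ> g) (\<lambda>_. p b)" by (rule homotopic_paths_sym)
  then have "g 1 = g 0" by (rule null_homotopic_lift_closed) (use g in \<open>auto simp: path_def path_image_def\<close>)
  then have "h 0 b = id b" using g by simp
  then have "h 0 x = x" using deck_unique[OF g(1) deck_id b _ assms(3)] by simp
  then show False using h(2) assms(4) by simp
qed

text \<open>A subgroup of finite index in an infinite group contains a nontrivial class. Its lift does not close up,
  since a closed lift would be null-homotopic.\<close>

lemma DS_nontrivial:
  assumes N: "subgroup N \<pi>1" and fi: "finite (rcosets\<^bsub>\<pi>1\<^esub> N)" and inf: "infinite (carrier \<pi>1)"
  shows "\<exists>f\<in>DS N. f b \<noteq> b"
proof -
  interpret group \<pi>1 by (rule group_pi1)
  have "N \<noteq> {\<one>\<^bsub>\<pi>1\<^esub>}"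
  proof
    assume N1: "N = {\<one>\<^bsub>\<pi>1\<^esub>}"
    have "rcosets\<^bsub>\<pi>1\<^esub> N = (\<lambda>a. {a}) ` carrier \<pi>1"
      by (auto simp: RCOSETS_def r_coset_def N1)
    then show False using fi inf by (simp add: finite_image_iff)
  qed
  then obtain c where cN: "c \<in> N" "c \<noteq> \<one>\<^bsub>\<pi>1\<^esub>" using subgroup.one_closed[OF N] by blast
  then have "c \<in> carrier \<pi>1" using cN subgroup.subset[OF N] by blast
  then obtain \<gamma> where \<gamma>: "\<gamma> \<in> loops_at M (p b)" "c = path_class M \<gamma>" by (auto simp: fundamental_group_def)
  have "continuous_on {0..1} \<gamma>" "\<gamma> ` {0..1} \<subseteq> M" "p b = \<gamma> 0"
    using \<gamma>(1) by (auto simp: loops_at_def path_def path_image_def pathstart_def)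
  note c = this
  have "\<exists>g. continuous_on {0..1} g \<and> g ` {0..1} \<subseteq> Mt \<and> g 0 = b \<and> (\<forall>r\<in>{0..1}. p (g r) = \<gamma> r)"
    by (rule covering_lift_path_interval[OF cov zero_le_one c(1,2) b c(3)]) blast
  then obtain g where
    g: "continuous_on {0..1} g" "g ` {0..1} \<subseteq> Mt" "g 0 = b" "\<And>r. r \<in> {0..1} \<Longrightarrow> p (g r) = \<gamma> r"
    by blast
  then have g': "path g" "path_image g \<subseteq> Mt" by (auto simp: path_def path_image_def)
  have cg: "path_class M (p \<circ> g) = c" unfolding \<gamma>(2) by (rule path_class_cong[OF \<gamma>(1)]) (simp add: g(4))
  have gb: "g 1 \<noteq> b"
  proof
    assume "g 1 = b"
    then have "homotopic_paths M (p \<circ> g) (\<lambda>_. p b)" using loop_image_null_homotopic[OF g'] g(3) by simp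
    from path_class_eq[OF this] show False using cN(2) cg by (simp add: class_one)
  qed
  have pb: "p b = p (g 1)" using g(4)[of 1] \<gamma>(1) by (simp add: loops_at_def pathfinish_def)
  have g1: "g 1 \<in> Mt" using g(2) by auto
  from deck_exists[OF b g1 pb] obtain f where f: "deck f" "f b = g 1" .
  have "f \<in> DS N" by (rule DSI[OF f(1) g' g(3)]) (use f(2) cg cN(1) in auto)
  then show ?thesis using f(2) gb by (intro bexI[of _ f]) auto
qed

end

section \<open>The graph of the universal cover\<close>

definition src :: "'v cell \<Rightarrow> 'v" where "src e = snd e (point1 (-1))"
definition tgt :: "'v cell \<Rightarrow> 'v" where "tgt e = snd e (point1 1)"

definition adj :: "'v cell set \<Rightarrow> ('v \<times> 'v) set" where
  "adj L = {(x, y). \<exists>e\<in>cells_of_dim L 1. (x = src e \<and> y = tgt e) \<or> (x = tgt e \<and> y = src e)}"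

lemma sym_adj: "(x, y) \<in> adj L \<Longrightarrow> (y, x) \<in> adj L"
  by (auto simp: adj_def)

lemma point1_in_disk: "c \<in> {-1..1} \<Longrightarrow> point1 c \<in> topspace (disk 1)"
  unfolding disk_one(1) by (rule imageI)

text \<open>The sphere is the union of two hemispheres. These are graphs over a disk of one dimension less, and they
  meet along the equator, which is nonempty in the given dimensions.\<close>

lemma connected_disk_boundary:
  assumes "n \<ge> 2"
  shows "connected (disk_boundary n)"
proof -
  obtain m where m: "n = Suc m" "m \<ge> 1" using assms by (cases n) auto
  define F where "F c x i = (if i = m then c * sqrt (1 - (\<Sum>j<m. (x j)\<^sup>2)) else x i)" for c :: real and x :: "nat \<Rightarrow> real" and i
  let ?D = "topspace (disk m)"
  have conn: "connected (F c ` ?D)" for c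
  proof (rule connected_continuous_image[OF _ connected_disk])
    show "continuous_on ?D (F c)"
    proof (rule continuous_on_coordinatewise_then_product)
      show "continuous_on ?D (\<lambda>x. F c x i)" for i
        unfolding F_def by (cases "i = m") (auto intro!: continuous_intros continuous_on_component[OF continuous_on_id])
    qed
  qed
  have sub: "F c ` ?D \<subseteq> disk_boundary n" if "c\<^sup>2 = 1" for c
  proof
    fix y assume "y \<in> F c ` ?D"
    then obtain x where x: "y = F c x" "\<forall>i\<ge>m. x i = 0" "(\<Sum>j<m. (x j)\<^sup>2) \<le> 1" by (auto simp: topspace_disk)
    have "(\<Sum>i<n. (y i)\<^sup>2) = (\<Sum>j<m. (x j)\<^sup>2) + c\<^sup>2 * (1 - (\<Sum>j<m. (x j)\<^sup>2))"
      using x by (simp add: m F_def power_mult_distrib)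
    then have "(\<Sum>i<n. (y i)\<^sup>2) = 1" using that by simp
    moreover have "\<forall>i\<ge>n. y i = 0" using x by (auto simp: F_def m)
    ultimately show "y \<in> disk_boundary n" by (simp add: disk_boundary_def topspace_disk)
  qed
  have cov: "disk_boundary n \<subseteq> F 1 ` ?D \<union> F (-1) ` ?D"
  proof
    fix y assume "y \<in> disk_boundary n"
    then have y: "\<forall>i\<ge>n. y i = 0" "(\<Sum>i<m. (y i)\<^sup>2) + (y m)\<^sup>2 = 1"
      by (auto simp: disk_boundary_def topspace_disk m)
    define x where "x = y(m := 0)"
    have s: "(\<Sum>j<m. (x j)\<^sup>2) = (\<Sum>j<m. (y j)\<^sup>2)" by (simp add: x_def)
    have "(\<Sum>j<m. (y j)\<^sup>2) \<le> 1" using y(2) zero_le_power2[of "y m"] by linarith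
    then have x: "x \<in> ?D" using y(1) s by (auto simp: topspace_disk x_def m)
    have "sqrt (1 - (\<Sum>j<m. (x j)\<^sup>2)) = \<bar>y m\<bar>"
      using y(2) s by (metis add_diff_cancel_left' real_sqrt_abs)
    then have "F 1 x = y \<or> F (-1) x = y"
      by (cases "y m \<ge> 0") (auto simp: F_def x_def fun_eq_iff)
    then show "y \<in> F 1 ` ?D \<union> F (-1) ` ?D" using x by blast
  qed
  have "point1 1 \<in> ?D" "F 1 (point1 1) = F (-1) (point1 1)"
  proof -
    have s: "(\<Sum>j<m. (point1 1 j)\<^sup>2) = 1"
    proof -
      have "(\<Sum>j<m. (point1 1 j)\<^sup>2) = (\<Sum>j\<in>{0}. (point1 1 j)\<^sup>2)"
        using m by (intro sum.mono_neutral_right) (auto simp: point1_def)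
      then show ?thesis by simp
    qed
    then show "point1 1 \<in> ?D" using m by (auto simp: topspace_disk point1_def)
    show "F 1 (point1 1) = F (-1) (point1 1)" using s by (auto simp: F_def fun_eq_iff)
  qed
  then have "F 1 ` ?D \<inter> F (-1) ` ?D \<noteq> {}" by (metis IntI empty_iff imageI)
  then have "connected (F 1 ` ?D \<union> F (-1) ` ?D)" using conn by (intro connected_Un)
  moreover have "F 1 ` ?D \<union> F (-1) ` ?D = disk_boundary n" using sub[of 1] sub[of "-1"] cov by auto
  ultimately show ?thesis by simp
qed

context covered_complex
begin

lemma edge_iff: "e \<in> cells_of_dim Kt 1 \<longleftrightarrow> (\<exists>\<psi>. e = (1, \<psi>) \<and> (1, \<psi>) \<in> Kt)"
  by (cases e) (auto simp: cells_of_dim_def)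

lemma edge_ends:
  assumes "(1, \<psi>) \<in> Kt"
  shows "\<psi> (point1 (-1)) \<in> skt 0" "\<psi> (point1 1) \<in> skt 0"
  using lift_boundary_in_skt[of 0 \<psi>] assms disk_one(3) by auto

lemma adj_skt: "adj Kt \<subseteq> skt 0 \<times> skt 0"
  unfolding adj_def using edge_iff edge_ends by (auto simp: src_def tgt_def)

lemma deck_adj:
  assumes "deck f" "(x, y) \<in> adj Kt"
  shows "(f x, f y) \<in> adj Kt"
proof -
  obtain \<psi> where \<psi>: "(1, \<psi>) \<in> Kt" "(x = src (1, \<psi>) \<and> y = tgt (1, \<psi>)) \<or> (x = tgt (1, \<psi>) \<and> y = src (1, \<psi>))"
    using assms(2) edge_iff by (auto simp: adj_def)
  let ?e = "(1, restrict (f \<circ> \<psi>) (topspace (disk 1)))"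
  have "?e \<in> cells_of_dim Kt 1" using deck_cell[OF assms(1) \<psi>(1)] by (simp add: cells_of_dim_def)
  moreover have "src ?e = f (src (1, \<psi>))" "tgt ?e = f (tgt (1, \<psi>))"
    using point1_in_disk[of 1] point1_in_disk[of "-1"] by (simp_all add: src_def tgt_def)
  ultimately show ?thesis using \<psi>(2) unfolding adj_def by (auto intro!: bexI[of _ ?e])
qed

lemma deck_adj_pow: "deck f \<Longrightarrow> (x, y) \<in> adj Kt ^^ n \<Longrightarrow> (f x, f y) \<in> adj Kt ^^ n"
proof (induction n arbitrary: y)
  case (Suc n)
  then obtain z where "(x, z) \<in> adj Kt ^^ n" "(z, y) \<in> adj Kt" by auto
  then show ?case using Suc.IH[OF Suc.prems(1)] deck_adj[OF Suc.prems(1)] by (meson relpow_Suc_I)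
qed auto

text \<open>Every adjacency-closed set of vertices extends to a clopen set, one skeleton after the other:
  the boundary sphere of a cell of dimension at least two is connected, so it lies on one side.\<close>

lemma clopen_extension:
  assumes W0: "W0 \<subseteq> skt 0" and closed: "\<And>x y. (x, y) \<in> adj Kt \<Longrightarrow> x \<in> W0 \<Longrightarrow> y \<in> W0"
  shows "\<exists>W\<subseteq>skt k. openin (top_of_set (skt k)) W \<and> openin (top_of_set (skt k)) (skt k - W) \<and> W \<inter> skt 0 = W0"
proof (induction k)
  case 0
  have "openin (top_of_set (skt 0)) A" if "A \<subseteq> skt 0" for A
  proof (rule openin_skt[OF that])
    fix n \<psi> assume "(n, \<psi>) \<in> Kt" "n \<le> 0"
    then have n: "n = 0" by simp
    have "topspace (disk n) \<inter> \<psi> -` A = {} \<or> topspace (disk n) \<inter> \<psi> -` A = topspace (disk n)"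
      unfolding n disk_zero(1) by blast
    then show "openin (top_of_set (topspace (disk n))) (topspace (disk n) \<inter> \<psi> -` A)" by auto
  qed
  then show ?case using W0 by (intro exI[of _ W0]) auto
next
  case (Suc k)
  then obtain W where W: "W \<subseteq> skt k" "openin (top_of_set (skt k)) W" "openin (top_of_set (skt k)) (skt k - W)"
    "W \<inter> skt 0 = W0" by blast
  define C where "C = {\<psi>. (Suc k, \<psi>) \<in> Kt \<and> \<psi> ` disk_boundary (Suc k) \<subseteq> W}"
  define W' where "W' = W \<union> (\<Union>\<psi>\<in>C. \<psi> ` open_disk (Suc k))"
  (* for k = 0 the boundary consists of the two ends of an edge *)
  have bd: "\<psi> ` disk_boundary (Suc k) \<subseteq> W \<or> \<psi> ` disk_boundary (Suc k) \<inter> W = {}" if \<psi>: "(Suc k, \<psi>) \<in> Kt" for \<psi>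
  proof (cases "k = 0")
    case True
    have e: "(1, \<psi>) \<in> Kt" using \<psi> True by simp
    then have "(src (1, \<psi>), tgt (1, \<psi>)) \<in> adj Kt" unfolding adj_def using edge_iff by blast
    then have a: "(\<psi> (point1 (-1)), \<psi> (point1 1)) \<in> adj Kt" by (simp add: src_def tgt_def)
    have "\<psi> (point1 (-1)) \<in> W \<longleftrightarrow> \<psi> (point1 1) \<in> W"
      using closed[OF a] closed[OF sym_adj[OF a]] edge_ends[OF e] W(4) by blast
    then show ?thesis unfolding True using disk_one(3) by auto
  next
    case False
    have img: "\<psi> ` disk_boundary (Suc k) \<subseteq> skt k" using lift_boundary_in_skt[OF \<psi>] by auto
    have "connected (\<psi> ` disk_boundary (Suc k))"
    proof (rule connected_continuous_image[OF _ connected_disk_boundary])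
      show "continuous_on (disk_boundary (Suc k)) \<psi>"
        using continuous_on_subset[OF Kt_cell(2)[OF \<psi>]] boundaryD by blast
    qed (use False in simp)
    moreover obtain A B where "open A" "open B" "W = skt k \<inter> A" "skt k - W = skt k \<inter> B"
      using W(2,3) by (auto simp: openin_open)
    moreover have "\<psi> ` disk_boundary (Suc k) \<subseteq> A \<union> B" "A \<inter> B \<inter> \<psi> ` disk_boundary (Suc k) = {}"
      using img calculation(4,5) by auto
    ultimately have "A \<inter> \<psi> ` disk_boundary (Suc k) = {} \<or> B \<inter> \<psi> ` disk_boundary (Suc k) = {}"
      by (intro connectedD) auto
    then show ?thesis using img \<open>W = skt k \<inter> A\<close> \<open>skt k - W = skt k \<inter> B\<close> by blast
  qed
  have low: "x \<in> W' \<longleftrightarrow> x \<in> W" if "x \<in> skt k" for x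
  proof -
    have "x \<noteq> \<psi>' d'" if "\<psi>' \<in> C" "d' \<in> open_disk (Suc k)" for \<psi>' d'
      using lift_open_disk_in_skt[of "Suc k" \<psi>' d' k] that \<open>x \<in> skt k\<close> by (auto simp: C_def)
    then show ?thesis by (auto simp: W'_def)
  qed
  have top: "\<psi> d \<in> W' \<longleftrightarrow> \<psi> \<in> C" if \<psi>: "(Suc k, \<psi>) \<in> Kt" and d: "d \<in> topspace (disk (Suc k))" for \<psi> d
  proof (cases "d \<in> open_disk (Suc k)")
    case True
    have "\<psi> d \<notin> W" using lift_open_disk_in_skt[OF \<psi> True, of k] W(1) by auto
    then show ?thesis unfolding W'_def using True cell_point_unique(2)[OF \<psi> _ True] by (auto simp: C_def)
  next
    case False
    then have db: "d \<in> disk_boundary (Suc k)" using d disk_split by blast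
    have "\<psi> d \<in> W' \<longleftrightarrow> \<psi> d \<in> W" by (rule low) (rule lift_boundary_in_skt[OF \<psi> db])
    then show ?thesis using bd[OF \<psi>] db \<psi> by (auto simp: C_def)
  qed
  have W's: "W' \<subseteq> skt (Suc k)"
    using W(1) skt_mono[of k "Suc k"] lift_open_disk_in_skt by (auto simp: W'_def C_def)
  have gen: "openin (top_of_set (topspace (disk n))) (topspace (disk n) \<inter> \<psi> -` A)"
    if \<psi>: "(n, \<psi>) \<in> Kt" "n \<le> Suc k" and A: "A = W' \<or> A = skt (Suc k) - W'" for n \<psi> A
  proof (cases "n \<le> k")
    case True
    have sk: "\<psi> d \<in> skt k" if "d \<in> topspace (disk n)" for d using lift_disk_in_skt[OF \<psi>(1) that True] .
    define A' where "A' = (if A = W' then W else skt k - W)"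
    have "\<psi> d \<in> A \<longleftrightarrow> \<psi> d \<in> A'" if "d \<in> topspace (disk n)" for d
      using A sk[OF that] low[OF sk[OF that]] skt_mono[of k "Suc k"] by (cases "A = W'") (auto simp: A'_def)
    then have "topspace (disk n) \<inter> \<psi> -` A = topspace (disk n) \<inter> \<psi> -` A'" by blast
    moreover have "openin (top_of_set (topspace (disk n))) (topspace (disk n) \<inter> \<psi> -` A')"
      by (rule openin_preimage[OF Kt_cell(2)[OF \<psi>(1)], of "skt k"]) (use sk W(2,3) in \<open>auto simp: A'_def\<close>)
    ultimately show ?thesis by simp
  next
    case False
    then have n: "n = Suc k" using \<psi>(2) by simp
    have sk: "\<psi> d \<in> skt (Suc k)" if "d \<in> topspace (disk n)" for d using lift_disk_in_skt[OF \<psi>(1) that \<psi>(2)] .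
    have "topspace (disk n) \<inter> \<psi> -` A = {} \<or> topspace (disk n) \<inter> \<psi> -` A = topspace (disk n)"
      using A top \<psi>(1) sk unfolding n by (cases "\<psi> \<in> C") auto
    then show ?thesis by auto
  qed
  show ?case
  proof (intro exI[of _ W'] conjI)
    show "openin (top_of_set (skt (Suc k))) W'" by (rule openin_skt[OF W's]) (use gen in blast)
    show "openin (top_of_set (skt (Suc k))) (skt (Suc k) - W')" by (rule openin_skt) (use gen in auto)
    show "W' \<inter> skt 0 = W0"
    proof -
      have "x \<in> W' \<longleftrightarrow> x \<in> W" if "x \<in> skt 0" for x using low[of x] that skt_mono[of 0 k] by auto
      then show ?thesis using W(4) by blast
    qed
  qed (use W's in auto)
qed

lemma finite_skel0: "finite (skel 0)"
proof -
  have "skel 0 = (\<Union>e\<in>{e\<in>K. fst e = 0}. snd e ` {\<lambda>_. 0})"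
    by (auto simp: skel_def open_cell_def disk_zero)
  then show ?thesis using finite_K by simp
qed

text \<open>An edge at \<open>x\<close> is determined by its projection and by the end that is \<open>x\<close>.\<close>

lemma finite_adj: "finite (adj Kt `` {x})"
proof -
  have fin: "finite {e \<in> cells_of_dim Kt 1. snd e (point1 c) = x}" if c: "c \<in> {-1..1}" for c
  proof (rule finite_imageD)
    let ?r = "\<lambda>e. (1::nat, restrict (p \<circ> snd e) (topspace (disk 1)))"
    show "finite (?r ` {e \<in> cells_of_dim Kt 1. snd e (point1 c) = x})"
    proof (rule finite_subset[OF _ finite_K], intro image_subsetI)
      fix e assume "e \<in> {e \<in> cells_of_dim Kt 1. snd e (point1 c) = x}"
      then obtain \<psi> where "e = (1, \<psi>)" "(1, \<psi>) \<in> Kt" using edge_iff by blast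
      then show "?r e \<in> K" using Kt_cell(4) by simp
    qed
    show "inj_on ?r {e \<in> cells_of_dim Kt 1. snd e (point1 c) = x}"
    proof (rule inj_onI)
      fix e e' assume *: "e \<in> {e \<in> cells_of_dim Kt 1. snd e (point1 c) = x}"
        "e' \<in> {e \<in> cells_of_dim Kt 1. snd e (point1 c) = x}" and r: "?r e = ?r e'"
      obtain \<psi> \<psi>' where e: "e = (1, \<psi>)" "(1, \<psi>) \<in> Kt" "e' = (1, \<psi>')" "(1, \<psi>') \<in> Kt"
        using * edge_iff by blast
      have "\<psi> = \<psi>'"
      proof (rule lift_unique[OF e(2,4)])
        show "point1 c \<in> topspace (disk 1)" using c disk_one(1) by blast
        show "p (\<psi> y) = p (\<psi>' y)" if "y \<in> topspace (disk 1)" for y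
          using fun_cong[OF r[THEN arg_cong[of _ _ snd], simplified], of y] that e by simp
      qed (use * e in auto)
      then show "e = e'" using e by simp
    qed
  qed
  have "adj Kt `` {x} \<subseteq> tgt ` {e \<in> cells_of_dim Kt 1. snd e (point1 (-1)) = x} \<union>
      src ` {e \<in> cells_of_dim Kt 1. snd e (point1 1) = x}"
    by (auto simp: adj_def src_def tgt_def)
  moreover have "finite \<dots>" using fin[of "-1"] fin[of 1] by simp
  ultimately show ?thesis by (rule finite_subset)
qed

lemma finite_ball: "finite {y. (x, y) \<in> adj Kt ^^ n}"
proof (induction n)
  case (Suc n)
  have "{y. (x, y) \<in> adj Kt ^^ Suc n} = (\<Union>z\<in>{z. (x, z) \<in> adj Kt ^^ n}. adj Kt `` {z})" by auto
  then show ?case using Suc finite_adj by simp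
qed simp

end

context universal_cover
begin

text \<open>The clopen extension of the set of vertices that can be reached from \<open>x\<close> is the whole connected cover.\<close>

lemma graph_connected:
  assumes "x \<in> skt 0" "y \<in> skt 0"
  shows "(x, y) \<in> (adj Kt)\<^sup>*"
proof -
  have adj0: "z \<in> skt 0" if "(x, z) \<in> (adj Kt)\<^sup>*" for z
    using that assms(1) adj_skt by (induction rule: rtrancl_induct) auto
  obtain W where W: "W \<subseteq> skt dimK" "openin (top_of_set (skt dimK)) W"
    "openin (top_of_set (skt dimK)) (skt dimK - W)" "W \<inter> skt 0 = {z. (x, z) \<in> (adj Kt)\<^sup>*}"
    using clopen_extension[of "{z. (x, z) \<in> (adj Kt)\<^sup>*}" dimK] adj0 by (auto intro: rtrancl_into_rtrancl)
  have sk: "skt dimK = Mt" using skt_dimK by simp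
  have "x \<in> W" using W(4) assms(1) by auto
  moreover have "closedin (top_of_set Mt) W" using W(1,3) sk by (simp add: closedin_def)
  ultimately have "W = Mt" using conn W(2) sk unfolding connected_clopen by auto
  then show ?thesis using W(4) assms(2) skt_subset by auto
qed

text \<open>A cell of least dimension has an empty boundary.\<close>

lemma vertex_exists: "\<exists>x. x \<in> skt 0"
proof -
  have "p b \<in> (\<Union>e\<in>K. open_cell e)" using cells_cover p_Mt[OF b] by simp
  then have "\<exists>n \<phi>. (n, \<phi>) \<in> K" by force
  define n where "n = (LEAST n. \<exists>\<phi>. (n, \<phi>) \<in> K)"
  have "\<exists>\<phi>. (n, \<phi>) \<in> K" unfolding n_def by (rule LeastI_ex) fact
  then obtain \<phi> where \<phi>: "(n, \<phi>) \<in> K" by blast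
  have least: "n \<le> n'" if "(n', \<phi>') \<in> K" for n' \<phi>' unfolding n_def using that by (intro Least_le) blast
  have "n = 0"
  proof (rule ccontr)
    assume n0: "n \<noteq> 0"
    have "(\<Sum>i<n. (point1 1 i)\<^sup>2) = (\<Sum>i\<in>{0}. (point1 1 i)\<^sup>2)"
      using n0 by (intro sum.mono_neutral_right) (auto simp: point1_def)
    then have "point1 1 \<in> disk_boundary n" using n0
      by (auto simp: disk_boundary_def topspace_disk) (auto simp: point1_def)
    then obtain e where "e \<in> K" "fst e < n" using cell(5)[OF \<phi>] by blast
    then show False using least[of "fst e" "snd e"] by simp
  qed
  then have "\<phi> (\<lambda>_. 0) \<in> skel 0" using open_disk_in_skel[OF \<phi> zero_in_open_disk] by simp
  then show ?thesis using covering_space_imp_surjective[OF cov] skel_subset[of 0] by (force simp: skt_def)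
qed

text \<open>By normality, an element that moves \<open>x\<close> a distance \<open>n\<close> has a conjugate in the same group which moves the
  chosen vertex over \<open>p x\<close> by \<open>n\<close>. There are finitely many chosen vertices and finitely many vertices within
  distance \<open>L\<close> of them, so it suffices to separate finitely many pairs of vertices.\<close>

lemma long_displacement:
  assumes norm: "\<And>i. N i \<lhd> \<pi>1" and dec: "\<And>i. N (Suc i) \<subseteq> N i" and int: "(\<Inter>i. N i) = {\<one>\<^bsub>\<pi>1\<^esub>}"
  shows "\<exists>i. \<forall>h\<in>DS (N i). \<forall>x\<in>skt 0. \<forall>n\<le>L. (x, h x) \<in> adj Kt ^^ n \<longrightarrow> h x = x"
proof -
  have "\<exists>x. x \<in> Mt \<and> p x = v" if "v \<in> skel 0" for v
    using covering_space_imp_surjective[OF cov] skel_subset[of 0] that by blast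
  then obtain r where r: "\<And>v. v \<in> skel 0 \<Longrightarrow> r v \<in> Mt \<and> p (r v) = v" by metis
  define S where "S = (SIGMA v:skel 0. {y \<in> (\<Union>n\<in>{..L}. {y. (r v, y) \<in> adj Kt ^^ n}). y \<noteq> r v})"
  have finS: "finite S" unfolding S_def using finite_skel0 finite_ball by auto
  have "\<exists>i. \<forall>j\<ge>i. \<forall>h\<in>DS (N j). h (r (fst s)) \<noteq> snd s" if "s \<in> S" for s
    using that r by (intro DS_separates[OF int dec]) (auto simp: S_def)
  then obtain I where I: "\<And>s. s \<in> S \<Longrightarrow> \<forall>j\<ge>I s. \<forall>h\<in>DS (N j). h (r (fst s)) \<noteq> snd s" by metis
  define i where "i = Max (insert 0 (I ` S))"
  have iI: "I s \<le> i" if "s \<in> S" for s unfolding i_def using finS that by auto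
  show ?thesis
  proof (intro exI[of _ i] ballI allI impI)
    fix h x n assume h: "h \<in> DS (N i)" and x: "x \<in> skt 0" and n: "n \<le> L" "(x, h x) \<in> adj Kt ^^ n"
    have dh: "deck h" using h by (auto simp: deck_subgroup_def)
    have xM: "x \<in> Mt" "p x \<in> skel 0" using x by (auto simp: skt_def)
    obtain t where t: "deck t" "t x = r (p x)" using deck_exists[OF xM(1)] r[OF xM(2)] by metis
    obtain t' where t': "deck t'" "\<And>x. x \<in> Mt \<Longrightarrow> t' (t x) = x" "\<And>x. x \<in> Mt \<Longrightarrow> t (t' x) = x"
      by (rule deck_inverse[OF t(1)]) blast
    have u: "t \<circ> h \<circ> t' \<in> DS (N i)" using DS_conj[OF norm h t(1) t'(1,2)] .
    have ux: "(t \<circ> h \<circ> t') (r (p x)) = t (h x)" using t'(2)[OF xM(1)] t(2) by simp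
    have "(r (p x), t (h x)) \<in> adj Kt ^^ n" using deck_adj_pow[OF t(1) n(2)] t(2) by simp
    then have S: "(p x, t (h x)) \<in> S" if "t (h x) \<noteq> r (p x)"
      using that n(1) xM(2) by (auto simp: S_def)
    have "t (h x) = r (p x)"
    proof (rule ccontr)
      assume "t (h x) \<noteq> r (p x)"
      note s = S[OF this]
      have "(t \<circ> h \<circ> t') (r (fst (p x, t (h x)))) \<noteq> snd (p x, t (h x))"
        using I[OF s] iI[OF s] u by blast
      then show False using ux by simp
    qed
    then have "t' (t (h x)) = t' (t x)" using t(2) by simp
    then show "h x = x" using t'(2) xM(1) deckD(2)[OF dh xM(1)] by simp
  qed
qed

end

section \<open>Paths in the 1-skeleton\<close>

context covered_complex
begin

text \<open>The nearest vertex, where a midpoint is assigned to the final end of its edge. Following this vertex along a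
  path in the 1-skeleton turns the path into an edge walk.\<close>

definition vert :: "'b \<Rightarrow> 'b" where
  "vert x = (SOME v. (x \<in> skt 0 \<and> v = x) \<or> (\<exists>\<psi> u. (1, \<psi>) \<in> Kt \<and> u \<in> {-1<..<1} \<and> x = \<psi> (point1 u) \<and>
     v = (if u < 0 then \<psi> (point1 (-1)) else \<psi> (point1 1))))"

definition mids :: "'b set" where
  "mids = {\<psi> (point1 0) | \<psi>. (1, \<psi>) \<in> Kt}"

lemma open_edge_notin_skt0:
  assumes "(1, \<psi>) \<in> Kt" "u \<in> {-1<..<1}"
  shows "\<psi> (point1 u) \<notin> skt 0"
proof -
  have "point1 u \<in> open_disk 1" unfolding disk_one using assms(2) by (rule imageI)
  from lift_open_disk_in_skt[OF assms(1) this, of 0] show ?thesis by simp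
qed

lemma open_edge_unique:
  assumes "(1, \<psi>) \<in> Kt" "u \<in> {-1<..<1}" "(1, \<psi>') \<in> Kt" "u' \<in> {-1<..<1}" "\<psi> (point1 u) = \<psi>' (point1 u')"
  shows "\<psi> = \<psi>'" "u = u'"
proof -
  have "point1 u \<in> open_disk 1" "point1 u' \<in> open_disk 1" unfolding disk_one using assms(2,4) by blast+
  from cell_point_unique(2,3)[OF assms(1,3) this assms(5)] show "\<psi> = \<psi>'" "u = u'" by auto
qed

lemma vert_vertex: "x \<in> skt 0 \<Longrightarrow> vert x = x"
  unfolding vert_def using open_edge_notin_skt0 by (intro some_equality) auto

lemma vert_open_edge:
  assumes "(1, \<psi>) \<in> Kt" "u \<in> {-1<..<1}"
  shows "vert (\<psi> (point1 u)) = (if u < 0 then \<psi> (point1 (-1)) else \<psi> (point1 1))"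
  unfolding vert_def
proof (rule some_equality)
  fix v assume v: "\<psi> (point1 u) \<in> skt 0 \<and> v = \<psi> (point1 u) \<or> (\<exists>\<psi>' u'. (1, \<psi>') \<in> Kt \<and> u' \<in> {-1<..<1} \<and>
      \<psi> (point1 u) = \<psi>' (point1 u') \<and> v = (if u' < 0 then \<psi>' (point1 (-1)) else \<psi>' (point1 1)))"
  then obtain \<psi>' u' where *: "(1, \<psi>') \<in> Kt" "u' \<in> {-1<..<1}" "\<psi> (point1 u) = \<psi>' (point1 u')"
    "v = (if u' < 0 then \<psi>' (point1 (-1)) else \<psi>' (point1 1))"
    using open_edge_notin_skt0[OF assms] by blast
  then show "v = (if u < 0 then \<psi> (point1 (-1)) else \<psi> (point1 1))"
    using open_edge_unique[OF assms *(1-3)] by simp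
qed (use assms in blast)

lemma vert_edge:
  assumes "(1, \<psi>) \<in> Kt" "u \<in> {-1..1}"
  shows "vert (\<psi> (point1 u)) = (if u < 0 then \<psi> (point1 (-1)) else \<psi> (point1 1))"
proof -
  consider "u = -1" | "u = 1" | "u \<in> {-1<..<1}" using assms(2) by fastforce
  then show ?thesis
    using vert_vertex edge_ends[OF assms(1)] vert_open_edge[OF assms(1)] by cases auto
qed

lemma mids_edge:
  assumes "(1, \<psi>) \<in> Kt" "u \<in> {-1..1}"
  shows "\<psi> (point1 u) \<in> mids \<longleftrightarrow> u = 0"
proof
  assume "\<psi> (point1 u) \<in> mids"
  then obtain \<psi>' where \<psi>': "(1, \<psi>') \<in> Kt" "\<psi> (point1 u) = \<psi>' (point1 0)" by (auto simp: mids_def)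
  then have "\<psi> (point1 u) \<notin> skt 0" using open_edge_notin_skt0[of \<psi>' 0] by auto
  then have "u \<noteq> -1" "u \<noteq> 1" using edge_ends[OF assms(1)] by auto
  then have "u \<in> {-1<..<1}" using assms(2) by auto
  then show "u = 0" using open_edge_unique(2)[OF assms(1) _ \<psi>'(1) _ \<psi>'(2)] by simp
qed (use assms in \<open>auto simp: mids_def\<close>)

lemma continuous_coord: "continuous_on A (\<lambda>d::nat \<Rightarrow> real. d 0)"
  by (rule continuous_on_component[OF continuous_on_id])

text \<open>Without the midpoints of its edges the graph falls apart into the open stars of its vertices.\<close>

lemma openin_star: "openin (top_of_set (skt 1)) {x \<in> skt 1. x \<notin> mids \<and> vert x = v}"
proof (rule openin_skt)
  fix n \<psi> assume \<psi>: "(n, \<psi>) \<in> Kt" "n \<le> 1"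
  let ?S = "{x \<in> skt 1. x \<notin> mids \<and> vert x = v}"
  let ?D = "topspace (disk n)"
  show "openin (top_of_set ?D) (?D \<inter> \<psi> -` ?S)"
  proof (cases "n = 0")
    case True
    then have "?D \<inter> \<psi> -` ?S = {} \<or> ?D \<inter> \<psi> -` ?S = ?D" unfolding True disk_zero(1) by blast
    then show ?thesis by auto
  next
    case False
    then have n: "n = 1" using \<psi>(2) by simp
    have e: "(1, \<psi>) \<in> Kt" using \<psi>(1) n by simp
    define L where "L = (if \<psi> (point1 (-1)) = v then {d::nat \<Rightarrow> real. d 0 < 0} else {})"
    define R where "R = (if \<psi> (point1 1) = v then {d::nat \<Rightarrow> real. d 0 > 0} else {})"
    have "open {d::nat \<Rightarrow> real. d 0 < 0}" "open {d::nat \<Rightarrow> real. d 0 > 0}"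
      by (intro open_Collect_less continuous_coord continuous_on_const)+
    then have "open (L \<union> R)" by (auto simp: L_def R_def)
    moreover have "?D \<inter> \<psi> -` ?S = ?D \<inter> (L \<union> R)"
    proof -
      have "\<psi> d \<in> ?S \<longleftrightarrow> d \<in> L \<union> R" if d: "d \<in> topspace (disk 1)" for d
      proof -
        obtain u where u: "u \<in> {-1..1}" "d = point1 u" using d disk_one(1) by blast
        have "\<psi> d \<in> skt 1" using lift_disk_in_skt[OF e d] by simp
        then show ?thesis unfolding u(2)
          using mids_edge[OF e u(1)] vert_edge[OF e u(1)] by (auto simp: L_def R_def)
      qed
      then show ?thesis unfolding n by blast
    qed
    ultimately show ?thesis by (simp add: openin_open_Int)
  qed
qed auto

definition halves :: "'a set" where
  "halves = skel 1 - {\<phi> (point1 0) | \<phi>. (1, \<phi>) \<in> K}"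

lemma zero_point1: "point1 0 \<in> open_disk 1" unfolding disk_one by auto

lemma openin_halves: "openin (top_of_set (skel 1)) halves"
proof (rule openin_skel)
  fix n \<phi> assume \<phi>: "(n, \<phi>) \<in> K" "n \<le> 1"
  let ?D = "topspace (disk n)"
  show "openin (top_of_set ?D) (?D \<inter> \<phi> -` halves)"
  proof (cases "n = 0")
    case True
    then have "?D \<inter> \<phi> -` halves = {} \<or> ?D \<inter> \<phi> -` halves = ?D" unfolding True disk_zero(1) by blast
    then show ?thesis by auto
  next
    case False
    then have n: "n = 1" using \<phi>(2) by simp
    have "\<phi> d \<in> halves \<longleftrightarrow> d 0 \<noteq> 0" if d: "d \<in> topspace (disk 1)" for d
    proof
      assume "\<phi> d \<in> halves"
      then have "d \<noteq> point1 0" using \<phi>(1) n by (auto simp: halves_def)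
      moreover obtain u where "d = point1 u" using d disk_one(1) by blast
      ultimately show "d 0 \<noteq> 0" by auto
    next
      assume d0: "d 0 \<noteq> 0"
      have "\<phi> d \<noteq> \<phi>' (point1 0)" if \<phi>': "(1, \<phi>') \<in> K" for \<phi>'
      proof
        assume eq: "\<phi> d = \<phi>' (point1 0)"
        have "\<phi> d \<notin> skel 0" unfolding eq using open_disk_in_skel[OF \<phi>' zero_point1, of 0] by simp
        then have "d \<notin> disk_boundary 1" using boundary_in_skel[of 0 \<phi> d] \<phi>(1) n by auto
        then have "d \<in> open_disk 1" using d disk_split by blast
        then have "d = point1 0" using cell_eqI(3)[of 1 \<phi> 1 \<phi>' d "point1 0"] \<phi>' zero_point1 eq \<phi>(1) n by blast
        then show False using d0 by simp
      qed
      then show "\<phi> d \<in> halves" using disk_in_skel[OF \<phi>(1), of d 1] d n by (auto simp: halves_def)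
    qed
    then have "?D \<inter> \<phi> -` halves = ?D \<inter> {d. d 0 \<noteq> 0}" unfolding n by blast
    moreover have "open {d::nat \<Rightarrow> real. d 0 \<noteq> 0}"
      by (intro open_Collect_neq continuous_coord continuous_on_const)
    ultimately show ?thesis by (simp add: openin_open_Int)
  qed
qed (auto simp: halves_def)

lemma openin_open_cell:
  assumes e: "(1, \<phi>) \<in> K"
  shows "openin (top_of_set (skel 1)) (open_cell (1, \<phi>))"
proof (rule openin_skel)
  show "open_cell (1, \<phi>) \<subseteq> skel 1" using e by (auto simp: skel_def)
  fix n \<phi>' assume \<phi>: "(n, \<phi>') \<in> K" "n \<le> 1"
  let ?D = "topspace (disk n)"
  have D: "\<phi>' d \<in> open_cell (1, \<phi>) \<longleftrightarrow> n = 1 \<and> \<phi>' = \<phi> \<and> d \<in> open_disk 1" if d: "d \<in> ?D" for d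
  proof
    assume "\<phi>' d \<in> open_cell (1, \<phi>)"
    then obtain d' where d': "d' \<in> open_disk 1" "\<phi>' d = \<phi> d'" by (auto simp: open_cell_def)
    then have not0: "\<phi>' d \<notin> skel 0" using open_disk_in_skel[OF e d'(1), of 0] by simp
    then have n: "n = 1" using disk_in_skel[OF \<phi>(1) d, of 0] \<phi>(2) by (cases "n = 0") auto
    have "d \<notin> disk_boundary 1" using boundary_in_skel[of 0 \<phi>' d] \<phi>(1) n not0 by auto
    then have "d \<in> open_disk 1" using d n disk_split by blast
    then show "n = 1 \<and> \<phi>' = \<phi> \<and> d \<in> open_disk 1" using cell_eqI(2)[of 1 \<phi>' 1 \<phi> d d'] e d' \<phi>(1) n by blast
  qed (auto simp: open_cell_def)
  have "?D \<inter> \<phi>' -` open_cell (1, \<phi>) = {} \<or> (n = 1 \<and> ?D \<inter> \<phi>' -` open_cell (1, \<phi>) = ?D \<inter> {d. -1 < d 0 \<and> d 0 < 1})"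
  proof (cases "n = 1 \<and> \<phi>' = \<phi>")
    case True
    have "open_disk 1 = topspace (disk 1) \<inter> {d. -1 < d 0 \<and> d 0 < 1}" unfolding disk_one by auto
    then show ?thesis using D True open_diskD by blast
  next
    case False
    then show ?thesis using D by blast
  qed
  moreover have "open {d::nat \<Rightarrow> real. -1 < d 0 \<and> d 0 < 1}"
    by (intro open_Collect_conj open_Collect_less continuous_coord continuous_on_const)
  ultimately show "openin (top_of_set ?D) (?D \<inter> \<phi>' -` open_cell (1, \<phi>))"
    by (elim disjE conjE) (simp_all only: openin_empty openin_open_Int)
qed

text \<open>A path in the 1-skeleton is cut into finitely many pieces each of which avoids all midpoints of edges
  or stays inside one open edge.\<close>

inductive pieces :: "(real \<Rightarrow> 'a) \<Rightarrow> nat \<Rightarrow> real \<Rightarrow> real \<Rightarrow> bool" for \<alpha> where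
  half: "s \<le> t \<Longrightarrow> \<alpha> ` {s..t} \<subseteq> halves \<Longrightarrow> pieces \<alpha> 1 s t"
| edge: "s \<le> t \<Longrightarrow> (1, \<phi>) \<in> K \<Longrightarrow> \<alpha> ` {s..t} \<subseteq> open_cell (1, \<phi>) \<Longrightarrow> pieces \<alpha> 1 s t"
| join: "pieces \<alpha> m s r \<Longrightarrow> pieces \<alpha> n r t \<Longrightarrow> pieces \<alpha> (m + n) s t"

lemma pieces_le: "pieces \<alpha> n s t \<Longrightarrow> s \<le> t"
  by (induction rule: pieces.induct) auto

lemma pieces_exist:
  assumes \<alpha>: "continuous_on {0..1} \<alpha>" "\<alpha> ` {0..1} \<subseteq> skel 1"
  shows "\<exists>n. pieces \<alpha> n 0 1"
proof -
  define Q where "Q s t \<longleftrightarrow> (0 \<le> s \<and> s \<le> t \<and> t \<le> 1 \<longrightarrow> (\<exists>n. pieces \<alpha> n s t))" for s t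
  have "Q 0 1"
    using zero_le_one
  proof (induction rule: Bolzano)
    case (trans a b c)
    then show ?case unfolding Q_def using pieces.join by (meson order_trans)
  next
    case (local x)
    then have x: "x \<in> {0..1}" by simp
    then have "\<alpha> x \<in> skel 1" using \<alpha>(2) by blast
    have "\<exists>U. openin (top_of_set (skel 1)) U \<and> \<alpha> x \<in> U \<and> (U = halves \<or> (\<exists>\<phi>. (1, \<phi>) \<in> K \<and> U = open_cell (1, \<phi>)))"
    proof (cases "\<alpha> x \<in> halves")
      case True
      then show ?thesis using openin_halves by blast
    next
      case False
      then obtain \<phi> where \<phi>: "(1, \<phi>) \<in> K" "\<alpha> x = \<phi> (point1 0)"
        using \<open>\<alpha> x \<in> skel 1\<close> by (auto simp: halves_def)
      then have "\<alpha> x \<in> open_cell (1, \<phi>)" using zero_point1 by (auto simp: open_cell_def)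
      then show ?thesis using openin_open_cell[OF \<phi>(1)] \<phi>(1) by blast
    qed
    then obtain U where U: "openin (top_of_set (skel 1)) U" "\<alpha> x \<in> U"
      "U = halves \<or> (\<exists>\<phi>. (1, \<phi>) \<in> K \<and> U = open_cell (1, \<phi>))" by blast
    have "openin (top_of_set {0..1}) ({0..1} \<inter> \<alpha> -` U)"
      by (rule openin_preimage[OF \<alpha>(1) _ U(1)]) (use \<alpha>(2) in auto)
    then obtain d where d: "d > 0" "\<And>r. r \<in> {0..1} \<Longrightarrow> dist r x < d \<Longrightarrow> \<alpha> r \<in> U"
      using x U(2) unfolding openin_euclidean_subtopology_iff
      by (metis (no_types, lifting) IntD2 IntI vimageE vimageI)
    have "Q a c" if "a \<le> x" "x \<le> c" "c - a < d" for a c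
      unfolding Q_def
    proof
      assume ac: "0 \<le> a \<and> a \<le> c \<and> c \<le> 1"
      have img: "\<alpha> ` {a..c} \<subseteq> U"
      proof (intro image_subsetI)
        fix r assume r: "r \<in> {a..c}"
        then have "dist r x < d" using that by (auto simp: dist_real_def)
        then show "\<alpha> r \<in> U" using r ac by (intro d(2)) auto
      qed
      have ac': "a \<le> c" using ac by simp
      show "\<exists>n. pieces \<alpha> n a c"
        using U(3)
      proof (elim disjE exE conjE)
        assume "U = halves"
        then have "pieces \<alpha> 1 a c" using pieces.half[OF ac'] img by blast
        then show ?thesis ..
      next
        fix \<phi> assume "(1, \<phi>) \<in> K" "U = open_cell (1, \<phi>)"
        then have "pieces \<alpha> 1 a c" using pieces.edge[OF ac'] img by blast
        then show ?thesis ..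
      qed
    qed
    then show ?case using d(1) by blast
  qed
  then show ?thesis by (simp add: Q_def)
qed

lemma p_halves:
  assumes "x \<in> Mt" "p x \<in> halves" shows "x \<in> skt 1" "x \<notin> mids"
proof -
  show "x \<in> skt 1" using assms by (auto simp: halves_def skt_def)
  show "x \<notin> mids"
  proof
    assume "x \<in> mids"
    then obtain \<psi> where \<psi>: "(1, \<psi>) \<in> Kt" "x = \<psi> (point1 0)" by (auto simp: mids_def)
    let ?\<phi> = "restrict (p \<circ> \<psi>) (topspace (disk 1))"
    have "p x = ?\<phi> (point1 0)" using \<psi>(2) point1_in_disk[of 0] by simp
    then show False using assms(2) Kt_cell(4)[OF \<psi>(1)] by (auto simp: halves_def)
  qed
qed

lemma vert_constant:
  fixes s t :: real
  assumes c: "continuous_on {s..t} \<beta>" "\<beta> ` {s..t} \<subseteq> Mt" and h: "(p \<circ> \<beta>) ` {s..t} \<subseteq> halves" and st: "s \<le> t"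
  shows "vert (\<beta> s) = vert (\<beta> t)"
proof (rule connected_induction_simple[of "{s..t}" s t "\<lambda>r. vert (\<beta> s) = vert (\<beta> r)"])
  fix a assume a: "a \<in> {s..t}"
  have b: "\<beta> r \<in> skt 1 \<and> \<beta> r \<notin> mids" if "r \<in> {s..t}" for r
    using p_halves[of "\<beta> r"] c(2) h that unfolding image_subset_iff comp_apply by blast
  let ?S = "{x \<in> skt 1. x \<notin> mids \<and> vert x = vert (\<beta> a)}"
  show "\<exists>T. openin (top_of_set {s..t}) T \<and> a \<in> T \<and> (\<forall>x\<in>T. \<forall>y\<in>T. vert (\<beta> s) = vert (\<beta> x) \<longrightarrow> vert (\<beta> s) = vert (\<beta> y))"
  proof (intro exI[of _ "{s..t} \<inter> \<beta> -` ?S"] conjI)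
    show "openin (top_of_set {s..t}) ({s..t} \<inter> \<beta> -` ?S)"
      by (rule openin_preimage[OF c(1) _ openin_star]) (use b in blast)
  qed (use a b in auto)
qed (use st in auto)

text \<open>The coordinate on an open edge is continuous because the characteristic map sends open sets of coordinates
  to open sets of the 1-skeleton.\<close>

lemma edge_coordinate:
  assumes e: "(1, \<phi>) \<in> K" and c: "continuous_on A \<alpha>" "\<alpha> ` A \<subseteq> open_cell (1, \<phi>)"
  obtains u where "continuous_on A u" "u ` A \<subseteq> {-1<..<1}" "\<forall>r\<in>A. \<alpha> r = \<phi> (point1 (u r))"
proof -
  have cs: "open_cell (1, \<phi>) \<subseteq> skel 1" using openin_imp_subset[OF openin_open_cell[OF e]] .
  define u where "u r = inv_into (open_disk 1) \<phi> (\<alpha> r) 0" for r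
  have inv: "inv_into (open_disk 1) \<phi> (\<alpha> r) \<in> open_disk 1" "\<phi> (inv_into (open_disk 1) \<phi> (\<alpha> r)) = \<alpha> r"
    if "r \<in> A" for r
  proof -
    have "\<alpha> r \<in> \<phi> ` open_disk 1" using c(2) that by (auto simp: open_cell_def)
    then show "inv_into (open_disk 1) \<phi> (\<alpha> r) \<in> open_disk 1" "\<phi> (inv_into (open_disk 1) \<phi> (\<alpha> r)) = \<alpha> r"
      by (rule inv_into_into, rule f_inv_into_f)
  qed
  have u: "u r \<in> {-1<..<1}" "\<alpha> r = \<phi> (point1 (u r))" if r: "r \<in> A" for r
  proof -
    obtain v where v: "v \<in> {-1<..<1}" "inv_into (open_disk 1) \<phi> (\<alpha> r) = point1 v"
      using inv(1)[OF r] disk_one(2) by blast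
    then have "u r = v" by (simp add: u_def)
    then show "u r \<in> {-1<..<1}" "\<alpha> r = \<phi> (point1 (u r))" using v inv(2)[OF r] by auto
  qed
  have "openin (top_of_set A) (A \<inter> u -` B)" if B: "open B" for B
  proof -
    have sub: "\<phi> ` point1 ` ({-1<..<1} \<inter> B) \<subseteq> open_cell (1, \<phi>)"
      unfolding open_cell_def prod.sel disk_one by blast
    have "openin (top_of_set (skel 1)) (\<phi> ` point1 ` ({-1<..<1} \<inter> B))"
    proof (rule openin_skel)
      show "\<phi> ` point1 ` ({-1<..<1} \<inter> B) \<subseteq> skel 1" using sub cs by (rule order_trans)
      fix n \<phi>' assume \<phi>: "(n, \<phi>') \<in> K" "n \<le> 1"
      let ?D = "topspace (disk n)"
      have pre: "?D \<inter> \<phi>' -` (\<phi> ` point1 ` ({-1<..<1} \<inter> B)) =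
          (?D \<inter> \<phi>' -` open_cell (1, \<phi>)) \<inter> {d. n = 1 \<and> \<phi>' = \<phi> \<and> d 0 \<in> B}"
      proof (intro equalityI subsetI)
        fix d assume d: "d \<in> ?D \<inter> \<phi>' -` (\<phi> ` point1 ` ({-1<..<1} \<inter> B))"
        then obtain v where v: "v \<in> {-1<..<1}" "v \<in> B" "\<phi>' d = \<phi> (point1 v)" by auto
        have vo: "point1 v \<in> open_disk 1" using v(1) disk_one by auto
        then have not0: "\<phi>' d \<notin> skel 0" using open_disk_in_skel[OF e vo, of 0] v(3) by simp
        then have n: "n = 1" using disk_in_skel[OF \<phi>(1), of d 0] d \<phi>(2) by (cases "n = 0") auto
        have "d \<notin> disk_boundary 1" using boundary_in_skel[of 0 \<phi>' d] \<phi>(1) n not0 by auto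
        then have "d \<in> open_disk 1" using d n disk_split by blast
        then have "\<phi>' = \<phi>" "d = point1 v" using cell_eqI(2,3)[of 1 \<phi>' 1 \<phi> d "point1 v"] e vo v(3) \<phi>(1) n by blast+
        then show "d \<in> (?D \<inter> \<phi>' -` open_cell (1, \<phi>)) \<inter> {d. n = 1 \<and> \<phi>' = \<phi> \<and> d 0 \<in> B}"
          using d v vo n by (auto simp: open_cell_def)
      next
        fix d assume d: "d \<in> (?D \<inter> \<phi>' -` open_cell (1, \<phi>)) \<inter> {d. n = 1 \<and> \<phi>' = \<phi> \<and> d 0 \<in> B}"
        then obtain d' where d': "d' \<in> open_disk 1" "\<phi> d = \<phi> d'" by (auto simp: open_cell_def)
        have "\<phi> d \<notin> skel 0" using open_disk_in_skel[OF e d'(1), of 0] d'(2) by simp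
        then have "d \<notin> disk_boundary 1" using boundary_in_skel[of 0 \<phi> d] e by auto
        moreover have "d \<in> topspace (disk 1)" using d by auto
        ultimately have "d \<in> open_disk 1" using disk_split by blast
        then obtain v where "v \<in> {-1<..<1}" "d = point1 v" using disk_one(2) by blast
        then show "d \<in> ?D \<inter> \<phi>' -` (\<phi> ` point1 ` ({-1<..<1} \<inter> B))" using d by auto
      qed
      have o1: "openin (top_of_set ?D) (?D \<inter> \<phi>' -` open_cell (1, \<phi>))"
        by (rule openin_preimage[OF cell(2)[OF \<phi>(1)] _ openin_open_cell[OF e]]) (use disk_in_skel[OF \<phi>(1)] \<phi>(2) in blast)
      have o2: "open {d::nat \<Rightarrow> real. n = 1 \<and> \<phi>' = \<phi> \<and> d 0 \<in> B}"
      proof (cases "n = 1 \<and> \<phi>' = \<phi>")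
        case True
        then have "{d::nat \<Rightarrow> real. n = 1 \<and> \<phi>' = \<phi> \<and> d 0 \<in> B} = (\<lambda>d. d 0) -` B" by auto
        then show ?thesis using open_vimage[OF B continuous_coord] by simp
      qed auto
      show "openin (top_of_set ?D) (?D \<inter> \<phi>' -` (\<phi> ` point1 ` ({-1<..<1} \<inter> B)))"
        unfolding pre using o1 o2 by (rule openin_Int_open)
    qed
    then have "openin (top_of_set A) (A \<inter> \<alpha> -` (\<phi> ` point1 ` ({-1<..<1} \<inter> B)))"
      by (rule openin_preimage[OF c(1), rotated]) (use c(2) cs in blast)
    moreover have "A \<inter> \<alpha> -` (\<phi> ` point1 ` ({-1<..<1} \<inter> B)) = A \<inter> u -` B"
    proof (intro equalityI subsetI)
      fix r assume r: "r \<in> A \<inter> \<alpha> -` (\<phi> ` point1 ` ({-1<..<1} \<inter> B))"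
      then obtain v where v: "v \<in> {-1<..<1}" "v \<in> B" "\<alpha> r = \<phi> (point1 v)" by auto
      have "point1 v \<in> open_disk 1" "point1 (u r) \<in> open_disk 1" unfolding disk_one using v u r by auto
      then have "point1 (u r) = point1 v" using cell_eqI(3)[of 1 \<phi> 1 \<phi> "point1 (u r)" "point1 v"] e u(2)[of r] v(3) r by auto
      then show "r \<in> A \<inter> u -` B" using v r by simp
    qed (use u in auto)
    ultimately show ?thesis by simp
  qed
  then have "continuous_on A u" unfolding continuous_on_open_invariant openin_open by (metis inf_commute)
  then show ?thesis using that u by blast
qed

end

section \<open>Cells of a quotient by deck transformations\<close>

text \<open>The law for inverses is stated on \<open>T\<close> only, because a deck transformation is arbitrary off \<open>T\<close>.\<close>

definition deck_group_on :: "'b::topological_space set \<Rightarrow> ('b \<Rightarrow> 'a) \<Rightarrow> ('b \<Rightarrow> 'b) set \<Rightarrow> bool" where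
  "deck_group_on T p H \<longleftrightarrow> (\<forall>f\<in>H. deck_transformation T p f) \<and> id \<in> H \<and>
     (\<forall>f\<in>H. \<forall>f'\<in>H. f \<circ> f' \<in> H) \<and> (\<forall>f\<in>H. \<exists>f'\<in>H. \<forall>x\<in>T. f' (f x) = x)"

locale deck_quotient = universal_cover +
  fixes H :: "('b \<Rightarrow> 'b) set"
  assumes H: "deck_group_on Mt p H"
begin

abbreviation Y where "Y \<equiv> orbit_space Mt H"
abbreviation q where "q \<equiv> orbit_of H"
abbreviation P where "P \<equiv> orbit_projection p :: 'b set \<Rightarrow> 'a"
abbreviation Ki where "Ki \<equiv> pullback_cells K Y P"

lemma H_deck: "f \<in> H \<Longrightarrow> deck f" and H_id: "id \<in> H" and H_comp: "f \<in> H \<Longrightarrow> f' \<in> H \<Longrightarrow> f \<circ> f' \<in> H"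
  using H by (auto simp: deck_group_on_def)

lemma H_inv:
  assumes "f \<in> H" shows "\<exists>f'\<in>H. \<forall>x\<in>Mt. f' (f x) = x"
  using H assms by (auto simp: deck_group_on_def)

lemma q_deck: assumes "h \<in> H" "x \<in> Mt" shows "q (h x) = q x"
proof
  have "f (h x) \<in> q x" if "f \<in> H" for f
    unfolding orbit_of_def by (rule image_eqI[OF _ H_comp[OF that assms(1)]]) simp
  then show "q (h x) \<subseteq> q x" unfolding orbit_of_def[of H "h x"] by blast
  obtain h' where h': "h' \<in> H" "h' (h x) = x" using H_inv[OF assms(1)] assms(2) by blast
  have "f x \<in> q (h x)" if "f \<in> H" for f
    unfolding orbit_of_def by (rule image_eqI[OF _ H_comp[OF that h'(1)]]) (simp add: h'(2))
  then show "q x \<subseteq> q (h x)" by (auto simp: orbit_of_def)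
qed

lemma q_eq:
  assumes "x \<in> Mt" shows "q x = q y \<longleftrightarrow> (\<exists>h\<in>H. h x = y)"
proof
  assume eq: "q x = q y"
  have "y \<in> q y" unfolding orbit_of_def using H_id by (metis id_apply image_eqI)
  then show "\<exists>h\<in>H. h x = y" unfolding eq[symmetric] by (auto simp: orbit_of_def)
qed (use q_deck[OF _ assms] in auto)

lemma P_q: assumes "x \<in> Mt" shows "P (q x) = p x"
proof -
  have "p ` q x = {p x}"
    using H_id deckD(3)[OF H_deck assms] by (auto simp: orbit_of_def image_iff intro!: bexI[of _ id])
  then show ?thesis by (simp add: orbit_projection_def)
qed

lemma quot: "quotient_map (top_of_set Mt) Y q"
  unfolding orbit_space_def by (rule quotient_map_quotient_topology)

lemma topspace_Y: "topspace Y = q ` Mt"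
  using quotient_imp_surjective_map[OF quot] by simp

lemma q_open: assumes V: "openin (top_of_set Mt) V" shows "openin Y (q ` V)"
proof -
  have VM: "V \<subseteq> Mt" using V openin_imp_subset by auto
  have "{x \<in> Mt. q x \<in> q ` V} = (\<Union>h\<in>H. Mt \<inter> h -` V)"
  proof (intro equalityI subsetI)
    fix x assume "x \<in> {x \<in> Mt. q x \<in> q ` V}"
    then show "x \<in> (\<Union>h\<in>H. Mt \<inter> h -` V)" using q_eq by auto
  next
    fix x assume "x \<in> (\<Union>h\<in>H. Mt \<inter> h -` V)"
    then obtain h where h: "h \<in> H" "x \<in> Mt" "h x \<in> V" by blast
    then have "q x \<in> q ` V" using q_deck[OF h(1,2)] by (metis imageI)
    then show "x \<in> {x \<in> Mt. q x \<in> q ` V}" using h by simp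
  qed
  moreover have "openin (top_of_set Mt) (Mt \<inter> h -` V)" if "h \<in> H" for h
    using openin_preimage[OF deckD(1,4)[OF H_deck[OF that]] V] .
  ultimately have "openin (top_of_set Mt) {x \<in> Mt. q x \<in> q ` V}" by (simp only:) blast
  then show ?thesis
    unfolding orbit_space_def openin_quotient_topology using VM by auto
qed

lemma Ki_iff: "(n, \<xi>) \<in> Ki \<longleftrightarrow> \<xi> \<in> extensional (topspace (disk n)) \<and> continuous_map (disk n) Y \<xi> \<and>
   (n, restrict (P \<circ> \<xi>) (topspace (disk n))) \<in> K"
  by (auto simp: pullback_cells_def)

lemma cell_range:
  assumes "(n, \<xi>) \<in> Ki" "d \<in> topspace (disk n)"
  shows "\<xi> d \<in> q ` Mt"
proof -
  have "continuous_map (disk n) Y \<xi>" using assms(1) by (simp add: Ki_iff)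
  from continuous_map_image_subset_topspace[OF this] show ?thesis using assms(2) topspace_Y by blast
qed

definition push :: "nat \<Rightarrow> ((nat \<Rightarrow> real) \<Rightarrow> 'b) \<Rightarrow> (nat \<Rightarrow> real) \<Rightarrow> 'b set" where
  "push n \<psi> = restrict (q \<circ> \<psi>) (topspace (disk n))"

lemma push_apply: "d \<in> topspace (disk n) \<Longrightarrow> push n \<psi> d = q (\<psi> d)" by (simp add: push_def)

lemma cell_push:
  assumes \<psi>: "(n, \<psi>) \<in> Kt"
  shows "(n, push n \<psi>) \<in> Ki"
proof -
  let ?D = "topspace (disk n)"
  have "continuous_map (disk n) (top_of_set Mt) \<psi>" using Kt_cell[OF \<psi>] continuous_map_disk_iff by blast
  then have "continuous_map (disk n) Y (q \<circ> \<psi>)"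
    using continuous_map_compose quotient_imp_continuous_map[OF quot] by blast
  then have "continuous_map (disk n) Y (push n \<psi>)"
    by (rule continuous_map_eq) (simp add: push_apply)
  moreover have "restrict (P \<circ> push n \<psi>) ?D = restrict (p \<circ> \<psi>) ?D"
  proof (rule restrict_ext)
    fix d assume d: "d \<in> ?D"
    then have "\<psi> d \<in> Mt" using Kt_cell(3)[OF \<psi>] by auto
    then show "(P \<circ> push n \<psi>) d = (p \<circ> \<psi>) d" using d by (simp add: push_apply P_q)
  qed
  ultimately show ?thesis using Kt_cell(4)[OF \<psi>] by (simp add: Ki_iff push_def)
qed

text \<open>A sheet maps to an open subset of the quotient on which \<open>P\<close> is injective, so near \<open>d\<close> both sides are
  determined by their projection to \<open>M\<close>.\<close>

lemma lift_agrees_near: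
  assumes \<xi>: "(n, \<xi>) \<in> Ki" and \<psi>: "(n, \<psi>) \<in> Kt" and eq: "\<And>y. y \<in> topspace (disk n) \<Longrightarrow> p (\<psi> y) = P (\<xi> y)"
    and d: "d \<in> topspace (disk n)" "\<xi> d = q (\<psi> d)"
  shows "\<exists>T. openin (top_of_set (topspace (disk n))) T \<and> d \<in> T \<and> (\<forall>y\<in>T. \<xi> y = q (\<psi> y))"
proof -
  let ?D = "topspace (disk n)"
  have xM: "\<psi> d \<in> Mt" using Kt_cell(3)[OF \<psi>] d by auto
  from covering_sheets[OF cov p_Mt[OF xM]] obtain U v where U: "p (\<psi> d) \<in> U" "openin (top_of_set M) U" "\<Union>v = Mt \<inter> p -` U"
    "\<forall>V\<in>v. openin (top_of_set Mt) V" "\<forall>V\<in>v. \<forall>W\<in>v. V \<inter> W \<noteq> {} \<longrightarrow> V = W"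
    "\<forall>V\<in>v. \<exists>s. homeomorphism V U p s" .
  obtain V where V: "V \<in> v" "\<psi> d \<in> V" using U(1,3) xM by blast
  then obtain s where s: "homeomorphism V U p s" using U(6) by blast
  have Vo: "openin (top_of_set Mt) V" using U(4) V by blast
  then have VM: "V \<subseteq> Mt" using openin_imp_subset by auto
  have "openin (disk n) {y \<in> topspace (disk n). \<xi> y \<in> q ` V}"
    by (rule openin_continuous_map_preimage[OF _ q_open[OF Vo]]) (use \<xi> in \<open>simp add: Ki_iff\<close>)
  then have 1: "openin (top_of_set ?D) {y \<in> ?D. \<xi> y \<in> q ` V}" by (subst (asm) disk_eq) simp
  have 2: "openin (top_of_set ?D) (?D \<inter> \<psi> -` V)" using openin_preimage[OF Kt_cell(2,3)[OF \<psi>] Vo] .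
  have "\<xi> y = q (\<psi> y)" if y: "y \<in> ?D" "\<xi> y \<in> q ` V" "\<psi> y \<in> V" for y
  proof -
    obtain w where w: "w \<in> V" "\<xi> y = q w" using y by blast
    then have "p w = p (\<psi> y)" using eq[OF y(1)] P_q VM by auto
    then have "w = \<psi> y" using s w y(3) by (metis homeomorphism_apply1)
    then show ?thesis using w by simp
  qed
  note agree = this
  let ?T = "{y \<in> ?D. \<xi> y \<in> q ` V} \<inter> (?D \<inter> \<psi> -` V)"
  have "d \<in> ?T" using d V(2) by simp
  moreover have "\<forall>y\<in>?T. \<xi> y = q (\<psi> y)" using agree by blast
  ultimately show ?thesis using openin_Int[OF 1 2] by blast
qed

text \<open>Lift the projection of \<open>\<xi>\<close> to the cover through \<open>x\<close>. The image of the lift agrees with \<open>\<xi>\<close> on an open set.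
  This set is also closed: near any other point \<open>a\<close>, the cell \<open>\<xi>\<close> is the image of some lift \<open>\<psi>\<^sub>a\<close>, and if the images of
  the two lifts agree at one point, then the lifts differ by an element of the group and their images
  agree everywhere.\<close>

lemma cell_lift:
  assumes \<xi>: "(n, \<xi>) \<in> Ki" and x: "x \<in> Mt" and d: "d \<in> topspace (disk n)" "q x = \<xi> d"
  obtains \<psi> where "(n, \<psi>) \<in> Kt" "\<xi> = push n \<psi>" "\<psi> d = x"
proof -
  let ?D = "topspace (disk n)"
  let ?\<phi> = "restrict (P \<circ> \<xi>) ?D"
  have \<phi>: "(n, ?\<phi>) \<in> K" using \<xi> by (simp add: Ki_iff)
  have lift: "\<exists>\<psi>. (n, \<psi>) \<in> Kt \<and> \<psi> a = y \<and> (\<forall>z\<in>?D. p (\<psi> z) = P (\<xi> z))"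
    if a: "a \<in> ?D" "y \<in> Mt" "q y = \<xi> a" for a y
  proof -
    have "p y = ?\<phi> a" using a P_q[OF a(2)] by simp
    from lift_through[OF \<phi> a(1,2) this] obtain \<psi> where \<psi>: "(n, \<psi>) \<in> Kt" "restrict (p \<circ> \<psi>) ?D = ?\<phi>" "\<psi> a = y" .
    have "p (\<psi> z) = P (\<xi> z)" if "z \<in> ?D" for z using fun_cong[OF \<psi>(2), of z] that by simp
    then show ?thesis using \<psi> by blast
  qed
  obtain \<psi> where \<psi>: "(n, \<psi>) \<in> Kt" "\<psi> d = x" "\<And>z. z \<in> ?D \<Longrightarrow> p (\<psi> z) = P (\<xi> z)" using lift[OF d(1) x d(2)] by blast
  have "\<xi> y = q (\<psi> y)" if y: "y \<in> ?D" for y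
  proof (rule connected_induction_simple[OF connected_disk d(1) y, of "\<lambda>y. \<xi> y = q (\<psi> y)"])
    show "\<xi> d = q (\<psi> d)" using d(2) \<psi>(2) by simp
    fix a assume a: "a \<in> ?D"
    have "\<xi> a \<in> q ` Mt" using cell_range[OF \<xi> a] .
    then obtain a0 where a0: "a0 \<in> Mt" "q a0 = \<xi> a" by auto
    obtain \<psi>' where \<psi>': "(n, \<psi>') \<in> Kt" "\<psi>' a = a0" "\<And>z. z \<in> ?D \<Longrightarrow> p (\<psi>' z) = P (\<xi> z)" using lift[OF a a0] by blast
    obtain T where T: "openin (top_of_set ?D) T" "a \<in> T" "\<forall>y\<in>T. \<xi> y = q (\<psi>' y)"
      using lift_agrees_near[OF \<xi> \<psi>'(1,3) a] \<psi>'(2) a0(2) by auto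
    have TD: "T \<subseteq> ?D" using T(1) openin_imp_subset by auto
    have "\<xi> z = q (\<psi> z)" if y: "y \<in> T" "\<xi> y = q (\<psi> y)" and z: "z \<in> T" for y z
    proof -
      have yD: "y \<in> ?D" "z \<in> ?D" using y z TD by auto
      have M: "\<psi> y \<in> Mt" "\<psi> z \<in> Mt" using Kt_cell(3)[OF \<psi>(1)] yD by auto
      have "q (\<psi> y) = q (\<psi>' y)" using y T(3) by simp
      then obtain h where h: "h \<in> H" "h (\<psi> y) = \<psi>' y" using q_eq[OF M(1)] by blast
      have "restrict (h \<circ> \<psi>) ?D = \<psi>'"
      proof (rule lift_unique[OF deck_cell[OF H_deck[OF h(1)] \<psi>(1)] \<psi>'(1) yD(1)])
        show "p (restrict (h \<circ> \<psi>) ?D w) = p (\<psi>' w)" if "w \<in> ?D" for w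
        proof -
          have "\<psi> w \<in> Mt" using Kt_cell(3)[OF \<psi>(1)] that by auto
          then show ?thesis using that \<psi>(3)[OF that] \<psi>'(3)[OF that] deckD(3)[OF H_deck[OF h(1)]] by simp
        qed
      qed (use yD h in simp)
      from fun_cong[OF this, of z] have "\<psi>' z = h (\<psi> z)" using yD(2) by simp
      then show ?thesis using T(3) z q_deck[OF h(1) M(2)] by simp
    qed
    then show "\<exists>T. openin (top_of_set ?D) T \<and> a \<in> T \<and> (\<forall>x\<in>T. \<forall>y\<in>T. \<xi> x = q (\<psi> x) \<longrightarrow> \<xi> y = q (\<psi> y))"
      using T(1,2) by blast
  qed
  then have "\<xi> = push n \<psi>"
    by (intro extensionalityI[of _ ?D]) (use \<xi> in \<open>auto simp: Ki_iff push_def\<close>)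
  then show ?thesis using that \<psi> by blast
qed

lemma cell_lift_ex:
  assumes "(n, \<xi>) \<in> Ki"
  obtains \<psi> where "(n, \<psi>) \<in> Kt" "\<xi> = push n \<psi>"
proof -
  let ?o = "\<lambda>_. 0 :: real"
  have o: "?o \<in> topspace (disk n)" using zero_in_open_disk open_diskD by blast
  have "\<xi> ?o \<in> q ` Mt" using cell_range[OF assms o] .
  then obtain x where "x \<in> Mt" "q x = \<xi> ?o" by auto
  from cell_lift[OF assms this(1) o this(2)] show ?thesis using that by blast
qed

lemma Ki_edge_iff: "e \<in> cells_of_dim Ki 1 \<longleftrightarrow> (\<exists>\<psi>. e = (1, push 1 \<psi>) \<and> (1, \<psi>) \<in> Kt)"
proof
  assume "e \<in> cells_of_dim Ki 1"
  then obtain \<xi> where \<xi>: "e = (1, \<xi>)" "(1, \<xi>) \<in> Ki" by (cases e) (auto simp: cells_of_dim_def)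
  then show "\<exists>\<psi>. e = (1, push 1 \<psi>) \<and> (1, \<psi>) \<in> Kt" using cell_lift_ex[OF \<xi>(2)] by metis
qed (use cell_push in \<open>auto simp: cells_of_dim_def\<close>)

lemma push_ends: "src (1, push 1 \<psi>) = q (\<psi> (point1 (-1)))" "tgt (1, push 1 \<psi>) = q (\<psi> (point1 1))"
  using point1_in_disk[of "-1"] point1_in_disk[of 1] unfolding src_def tgt_def by (simp_all add: push_apply)

lemma adj_push: assumes "(x, y) \<in> adj Kt" shows "(q x, q y) \<in> adj Ki"
proof -
  obtain e where e: "e \<in> cells_of_dim Kt 1" "(x = src e \<and> y = tgt e) \<or> (x = tgt e \<and> y = src e)"
    using assms by (auto simp: adj_def)
  obtain \<psi> where "e = (1, \<psi>)" "(1, \<psi>) \<in> Kt" using e(1) edge_iff[of e] by blast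
  with e(2) have \<psi>: "(1, \<psi>) \<in> Kt" "(x = src (1, \<psi>) \<and> y = tgt (1, \<psi>)) \<or> (x = tgt (1, \<psi>) \<and> y = src (1, \<psi>))"
    by simp_all
  have "(1, push 1 \<psi>) \<in> cells_of_dim Ki 1" using Ki_edge_iff[of "(1, push 1 \<psi>)"] \<psi>(1) by blast
  moreover have "q (src (1, \<psi>)) = src (1, push 1 \<psi>)" "q (tgt (1, \<psi>)) = tgt (1, push 1 \<psi>)"
    unfolding push_ends by (simp_all add: src_def tgt_def)
  ultimately show ?thesis using \<psi>(2) unfolding adj_def mem_Collect_eq prod.case by metis
qed

lemma adj_lift:
  assumes x: "x \<in> Mt" and e: "(q x, w) \<in> adj Ki"
  shows "\<exists>y. (x, y) \<in> adj Kt \<and> w = q y"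
proof -
  obtain e where e: "e \<in> cells_of_dim Ki 1" "(q x = src e \<and> w = tgt e) \<or> (q x = tgt e \<and> w = src e)"
    using e by (auto simp: adj_def)
  obtain \<psi> where \<psi>1: "e = (1, push 1 \<psi>)" "(1, \<psi>) \<in> Kt" using e(1) Ki_edge_iff[of e] by blast
  have "\<exists>c\<in>{-1, 1}. q x = q (\<psi> (point1 c)) \<and> w = q (\<psi> (point1 (-c)))"
    using e(2) unfolding \<psi>1(1) push_ends by auto
  then obtain c where \<psi>: "(1, \<psi>) \<in> Kt" "c \<in> {-1, 1}" "q x = q (\<psi> (point1 c))" "w = q (\<psi> (point1 (-c)))"
    using \<psi>1(2) by blast
  let ?D = "topspace (disk 1)"
  have c: "point1 c \<in> ?D" "point1 (-c) \<in> ?D" using \<psi>(2) point1_in_disk[of c] point1_in_disk[of "-c"] by auto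
  have M: "\<psi> (point1 c) \<in> Mt" "\<psi> (point1 (-c)) \<in> Mt" using Kt_cell(3)[OF \<psi>(1)] c by blast+
  obtain h where h: "h \<in> H" "h (\<psi> (point1 c)) = x" using q_eq[OF M(1), of x] \<psi>(3) by auto
  have "(\<psi> (point1 c), \<psi> (point1 (-c))) \<in> adj Kt"
  proof -
    have "(1, \<psi>) \<in> cells_of_dim Kt 1" using edge_iff[of "(1, \<psi>)"] \<psi>(1) by blast
    moreover have "(\<psi> (point1 c) = src (1, \<psi>) \<and> \<psi> (point1 (-c)) = tgt (1, \<psi>)) \<or>
        (\<psi> (point1 c) = tgt (1, \<psi>) \<and> \<psi> (point1 (-c)) = src (1, \<psi>))"
      using \<psi>(2) by (auto simp: src_def tgt_def)
    ultimately show ?thesis unfolding adj_def mem_Collect_eq prod.case by blast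
  qed
  then have "(x, h (\<psi> (point1 (-c)))) \<in> adj Kt" using deck_adj[OF H_deck[OF h(1)]] h(2) by metis
  then show ?thesis using \<psi>(4) q_deck[OF h(1) M(2)] by auto
qed

lemma adj_pow_lift: "x \<in> Mt \<Longrightarrow> (q x, w) \<in> adj Ki ^^ n \<Longrightarrow> \<exists>y. (x, y) \<in> adj Kt ^^ n \<and> w = q y"
proof (induction n arbitrary: w)
  case (Suc n)
  then obtain z where z: "(q x, z) \<in> adj Ki ^^ n" "(z, w) \<in> adj Ki" by auto
  then obtain y where y: "(x, y) \<in> adj Kt ^^ n" "z = q y" using Suc by blast
  have "y \<in> Mt"
  proof (cases n)
    case 0 then show ?thesis using y Suc.prems by simp
  next
    case (Suc m)
    then obtain y' where "(y', y) \<in> adj Kt" using y by auto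
    then show ?thesis using adj_skt skt_subset by blast
  qed
  then obtain y2 where y2: "(y, y2) \<in> adj Kt" "w = q y2" using adj_lift z(2) y(2) by blast
  show ?case using relpow_Suc_I[OF y(1) y2(1)] y2(2) by blast
qed auto

text \<open>A point of the cover is mapped into an open edge of the quotient only if the cell that contains it is mapped
  to this edge, for the edge can be lifted through the point.\<close>

lemma collapse_push:
  assumes \<xi>: "(1, \<xi>) \<in> Ki" and \<psi>: "(n, \<psi>) \<in> Kt" and d: "d \<in> open_disk n"
  shows "collapse (1, \<xi>) (q (\<psi> d)) = (if n = 1 \<and> push 1 \<psi> = \<xi> then cis (pi * (1 + d 0)) else 1)"
proof (cases "n = 1 \<and> push 1 \<psi> = \<xi>")
  case True
  have inj: "inj_on \<xi> (open_disk 1)"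
  proof (rule inj_onI)
    fix a a' assume a: "a \<in> open_disk 1" "a' \<in> open_disk 1" "\<xi> a = \<xi> a'"
    have "restrict (P \<circ> \<xi>) (topspace (disk 1)) a = restrict (P \<circ> \<xi>) (topspace (disk 1)) a'"
      using a open_diskD by auto
    moreover have "inj_on (restrict (P \<circ> \<xi>) (topspace (disk 1))) (open_disk 1)"
      using cell(4) \<xi> unfolding Ki_iff by blast
    ultimately show "a = a'" using a by (meson inj_onD)
  qed
  have d1: "d \<in> open_disk 1" using d True by simp
  have "q (\<psi> d) = \<xi> d" using True push_apply[OF open_diskD[OF d1]] by metis
  moreover have "inv_into (open_disk 1) \<xi> (\<xi> d) = d" using inj d1 by simp
  moreover have "\<xi> d \<in> open_cell (1, \<xi>)" using d1 by (simp add: open_cell_def)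
  ultimately show ?thesis using True by (simp add: collapse_def)
next
  case False
  have "q (\<psi> d) \<notin> open_cell (1, \<xi>)"
  proof
    assume "q (\<psi> d) \<in> open_cell (1, \<xi>)"
    then obtain d' where d': "d' \<in> open_disk 1" "q (\<psi> d) = \<xi> d'" by (auto simp: open_cell_def)
    have "\<psi> d \<in> Mt" using Kt_cell(3)[OF \<psi>] open_diskD[OF d] by auto
    from cell_lift[OF \<xi> this open_diskD[OF d'(1)] d'(2)] obtain \<psi>' where
      \<psi>': "(1, \<psi>') \<in> Kt" "\<xi> = push 1 \<psi>'" "\<psi>' d' = \<psi> d" .
    have "n = 1 \<and> \<psi> = \<psi>'" using cell_point_unique(1,2)[OF \<psi> \<psi>'(1) d d'(1)] \<psi>'(3) by metis
    then show False using False \<psi>'(2) by simp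
  qed
  then have "collapse (1, \<xi>) (q (\<psi> d)) = 1" by (simp add: collapse_def)
  then show ?thesis by (simp only: False if_False)
qed

lemma collapse_edge:
  assumes \<xi>: "(1, \<xi>) \<in> Ki" and \<psi>: "(1, \<psi>) \<in> Kt" and u: "u \<in> {-1..1}"
  shows "collapse (1, \<xi>) (q (\<psi> (point1 u))) = (if push 1 \<psi> = \<xi> then cis (pi * (1 + u)) else 1)"
proof (cases "u \<in> {-1<..<1}")
  case True
  then have "point1 u \<in> open_disk 1" unfolding disk_one by blast
  from collapse_push[OF \<xi> \<psi> this] show ?thesis by simp
next
  case False
  then have u: "u = -1 \<or> u = 1" using u by auto
  then have "\<psi> (point1 u) \<in> skt 0" using edge_ends[OF \<psi>] by auto
  then obtain n \<psi>' d where x: "(n, \<psi>') \<in> Kt" "n \<le> 0" "d \<in> open_disk n" "\<psi> (point1 u) = \<psi>' d"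
    using cell_point by metis
  have "collapse (1, \<xi>) (q (\<psi> (point1 u))) = 1" using collapse_push[OF \<xi> x(1,3)] x(2,4) by simp
  moreover have "cis (pi * (1 + u)) = 1" using u by (auto simp: complex_eq_iff)
  ultimately show ?thesis by simp
qed

lemma continuous_collapse:
  assumes \<xi>: "(1, \<xi>) \<in> Ki"
  shows "continuous_on (skt 1) (\<lambda>x. collapse (1, \<xi>) (q x))"
proof (rule continuous_on_skt)
  fix n \<psi> assume \<psi>: "(n, \<psi>) \<in> Kt" "n \<le> 1"
  show "continuous_on (topspace (disk n)) (\<lambda>d. collapse (1, \<xi>) (q (\<psi> d)))"
  proof (cases "n = 0")
    case True
    then show ?thesis by (simp add: disk_zero)
  next
    case False
    then have n: "n = 1" using \<psi> by simp
    have "continuous_on (topspace (disk 1)) (\<lambda>d. if push 1 \<psi> = \<xi> then cis (pi * (1 + d 0)) else 1)"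
      by (cases "push 1 \<psi> = \<xi>") (auto intro!: continuous_intros continuous_coord)
    then show ?thesis unfolding n
    proof (rule continuous_on_eq)
      fix d assume "d \<in> topspace (disk 1)"
      then obtain u where u: "u \<in> {-1..1}" "d = point1 u" using disk_one(1) by blast
      show "(if push 1 \<psi> = \<xi> then cis (pi * (1 + d 0)) else 1) = collapse (1, \<xi>) (q (\<psi> d))"
        using collapse_edge[OF \<xi> _ u(1), of \<psi>] \<psi>(1) n u(2) by simp
    qed
  qed
qed

end

section \<open>Boundaries of 2-cells as edge walks\<close>

text \<open>The flag of a step tells whether the edge is run through from its source to its target.\<close>

fun walk :: "'v cell set \<Rightarrow> 'v \<Rightarrow> (bool \<times> 'v cell) list \<Rightarrow> 'v \<Rightarrow> bool" where
  "walk L x [] y \<longleftrightarrow> x = y"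
| "walk L x ((s, e) # es) y \<longleftrightarrow> e \<in> cells_of_dim L 1 \<and> x = (if s then src e else tgt e) \<and>
     walk L (if s then tgt e else src e) es y"

fun chain_of :: "(bool \<times> 'v cell) list \<Rightarrow> ('v cell \<Rightarrow>\<^sub>0 int)" where
  "chain_of [] = 0"
| "chain_of ((s, e) # es) = (if s then frag_of e else - frag_of e) + chain_of es"

lemma walk_append: "walk L x es y \<Longrightarrow> walk L y fs z \<Longrightarrow> walk L x (es @ fs) z"
  by (induction L x es y rule: walk.induct) auto

lemma chain_of_append: "chain_of (es @ fs) = chain_of es + chain_of fs"
  by (induction es rule: chain_of.induct) (auto simp: algebra_simps)

lemma keys_chain_of: "walk L x es y \<Longrightarrow> Poly_Mapping.keys (chain_of es) \<subseteq> cells_of_dim L 1"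
proof (induction L x es y rule: walk.induct)
  case (2 L x s e es y)
  have "Poly_Mapping.keys (if s then frag_of e else - frag_of e) \<subseteq> {e}" by auto
  then show ?case using 2 keys_add[of "if s then frag_of e else - frag_of e" "chain_of es"] by fastforce
qed auto

text \<open>The angle in \<open>[-\<pi>, \<pi>)\<close>; the closed end is at \<open>-\<pi>\<close> because a midpoint of an edge is assigned to
  the final vertex of the edge.\<close>

definition ang :: "complex \<Rightarrow> real" where "ang z = (if z = -1 then -pi else Arg z)"

lemma ang_cis:
  assumes "u \<in> {-1<..<1}"
  shows "ang (cis (pi * (1 + u))) = pi * (1 + u) - (if u < 0 then 0 else 2 * pi)"
proof -
  consider "u < 0" | "u = 0" | "u > 0" by linarith
  then show ?thesis
  proof cases
    case 1
    have r: "0 < pi * (1 + u)" "pi * (1 + u) < pi" using assms 1 by auto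
    moreover have "- pi < pi * (1 + u)" using r(1) pi_gt_zero by linarith
    ultimately have A: "Arg (cis (pi * (1 + u))) = pi * (1 + u)" by (intro Arg_cis) auto
    have "Arg (-1) = pi" using Arg_of_real[of "-1"] by simp
    then have "cis (pi * (1 + u)) \<noteq> -1" using A r by auto
    then show ?thesis using A 1 by (simp add: ang_def)
  next
    case 2
    then show ?thesis by (simp add: ang_def)
  next
    case 3
    have r: "-pi < pi * (1 + u) - 2 * pi" "pi * (1 + u) - 2 * pi < 0"
      using assms 3 by (auto simp: algebra_simps)
    have "cis (pi * (1 + u)) = cis (pi * (1 + u) - 2 * pi)"
      by (simp add: cis_conv_exp exp_eq of_real_def[symmetric]) (rule exI[of _ 1], simp add: algebra_simps)
    then have A: "Arg (cis (pi * (1 + u))) = pi * (1 + u) - 2 * pi" using r by (simp add: Arg_cis)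
    have "Arg (-1) = pi" using Arg_of_real[of "-1"] by simp
    then have "cis (pi * (1 + u)) \<noteq> -1" using A r by auto
    then show ?thesis using A 3 by (simp add: ang_def)
  qed
qed

lemma ang_1 [simp]: "ang 1 = 0" by (simp add: ang_def)

text \<open>Two continuous logarithms of the same function differ by a constant.\<close>

lemma exp_lift_increment:
  fixes g :: "real \<Rightarrow> complex" and \<theta> :: "real \<Rightarrow> real"
  assumes "s \<le> t" "continuous_on {s..t} g" "continuous_on {s..t} \<theta>"
    and eq: "\<And>r. r \<in> {s..t} \<Longrightarrow> exp (g r) = cis (\<theta> r)"
  shows "g t - g s = \<i> * of_real (\<theta> t - \<theta> s)"
proof -
  let ?f = "\<lambda>r. g r - \<i> * of_real (\<theta> r)"
  have ex: "\<exists>n::int. ?f r = (of_int (2 * n) * pi) * \<i>" if "r \<in> {s..t}" for r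
  proof -
    have "exp (g r) = exp (\<i> * of_real (\<theta> r))" using eq[OF that] by (simp add: cis_conv_exp)
    then show ?thesis unfolding exp_eq by (auto simp: algebra_simps)
  qed
  have "?f constant_on {s..t}"
  proof (rule continuous_discrete_range_constant)
    show "continuous_on {s..t} ?f" using assms by (intro continuous_intros)
    fix r assume r: "r \<in> {s..t}"
    show "\<exists>e>0. \<forall>y. y \<in> {s..t} \<and> ?f y \<noteq> ?f r \<longrightarrow> e \<le> cmod (?f y - ?f r)"
    proof (intro exI[of _ "2 * pi"] conjI allI impI)
      fix y assume y: "y \<in> {s..t} \<and> ?f y \<noteq> ?f r"
      obtain m n :: int where mn: "?f y = (of_int (2 * m) * pi) * \<i>" "?f r = (of_int (2 * n) * pi) * \<i>"
        using ex r y by meson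
      have "m \<noteq> n" using y mn by auto
      then have "1 \<le> \<bar>real_of_int (m - n)\<bar>" by linarith
      moreover have "?f y - ?f r = (of_real (2 * pi * real_of_int (m - n))) * \<i>"
        unfolding mn by (simp add: algebra_simps)
      then have "cmod (?f y - ?f r) = 2 * pi * \<bar>real_of_int (m - n)\<bar>"
        by (simp add: norm_mult abs_mult del: of_int_diff)
      ultimately show "2 * pi \<le> cmod (?f y - ?f r)" by simp
    qed simp
  qed simp
  then have "?f t = ?f s" using assms(1) by (auto simp: constant_on_def)
  then show ?thesis by (simp add: algebra_simps)
qed

context deck_quotient
begin

text \<open>The walk \<open>es\<close> leads from the vertex nearest to \<open>\<beta> s\<close> to the vertex nearest to \<open>\<beta> t\<close>, and the coefficients of
  its chain account for full turns: for every edge, a continuous logarithm of the collapsed path changes by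
  the change of the angle and \<open>2\<pi>\<i>\<close> times the coefficient. On a loop the angles cancel and the winding
  number remains.\<close>

definition tracks :: "(real \<Rightarrow> 'b) \<Rightarrow> real \<Rightarrow> real \<Rightarrow> (bool \<times> 'b set cell) list \<Rightarrow> bool" where
  "tracks \<beta> s t es \<longleftrightarrow> walk Ki (q (vert (\<beta> s))) es (q (vert (\<beta> t))) \<and>
     (\<forall>\<xi> g. (1, \<xi>) \<in> Ki \<longrightarrow> continuous_on {s..t} g \<longrightarrow>
        (\<forall>r\<in>{s..t}. collapse (1, \<xi>) (q (\<beta> r)) = exp (g r)) \<longrightarrow>
        g t - g s = \<i> * of_real (ang (collapse (1, \<xi>) (q (\<beta> t))) - ang (collapse (1, \<xi>) (q (\<beta> s)))) +
          2 * of_real pi * \<i> * of_int (Poly_Mapping.lookup (chain_of es) (1, \<xi>)))"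

lemma tracks_join:
  assumes "tracks \<beta> s r es" "tracks \<beta> r t fs" "s \<le> r" "r \<le> t"
  shows "tracks \<beta> s t (es @ fs)"
  unfolding tracks_def
proof (intro conjI allI impI)
  show "walk Ki (q (vert (\<beta> s))) (es @ fs) (q (vert (\<beta> t)))"
    by (rule walk_append[OF conjunct1[OF assms(1)[unfolded tracks_def]] conjunct1[OF assms(2)[unfolded tracks_def]]])
  fix \<xi> g assume *: "(1, \<xi>) \<in> Ki" "continuous_on {s..t} g" "\<forall>r\<in>{s..t}. collapse (1, \<xi>) (q (\<beta> r)) = exp (g r)"
  let ?a = "\<lambda>r. ang (collapse (1, \<xi>) (q (\<beta> r)))"
  note t1 = assms(1)[unfolded tracks_def, THEN conjunct2, rule_format]
  note t2 = assms(2)[unfolded tracks_def, THEN conjunct2, rule_format]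
  have 1: "g r - g s = \<i> * of_real (?a r - ?a s) + 2 * of_real pi * \<i> * of_int (Poly_Mapping.lookup (chain_of es) (1, \<xi>))"
    by (rule t1[OF *(1) continuous_on_subset[OF *(2)]]) (use *(3) assms(3,4) in auto)
  have 2: "g t - g r = \<i> * of_real (?a t - ?a r) + 2 * of_real pi * \<i> * of_int (Poly_Mapping.lookup (chain_of fs) (1, \<xi>))"
    by (rule t2[OF *(1) continuous_on_subset[OF *(2)]]) (use *(3) assms(3,4) in auto)
  have "g t - g s = (g t - g r) + (g r - g s)" by simp
  then show "g t - g s = \<i> * of_real (?a t - ?a s) + 2 * of_real pi * \<i> * of_int (Poly_Mapping.lookup (chain_of (es @ fs)) (1, \<xi>))"
    unfolding 1 2 chain_of_append lookup_add by (simp add: algebra_simps)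
qed

text \<open>Away from midpoints the nearest vertex does not change, and the collapsed path avoids the negative real
  axis, so the principal angle is continuous along it.\<close>

lemma tracks_half:
  assumes \<beta>: "continuous_on {s..t} \<beta>" "\<beta> ` {s..t} \<subseteq> Mt" and h: "(p \<circ> \<beta>) ` {s..t} \<subseteq> halves" and st: "s \<le> t"
  shows "tracks \<beta> s t []"
  unfolding tracks_def
proof (intro conjI allI impI)
  show "walk Ki (q (vert (\<beta> s))) [] (q (vert (\<beta> t)))" using vert_constant[OF \<beta> h st] by simp
  fix \<xi> g assume *: "(1, \<xi>) \<in> Ki" "continuous_on {s..t} g" "\<forall>r\<in>{s..t}. collapse (1, \<xi>) (q (\<beta> r)) = exp (g r)"
  let ?c = "\<lambda>r. collapse (1, \<xi>) (q (\<beta> r))"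
  have b: "\<beta> r \<in> skt 1" "\<beta> r \<notin> mids" if "r \<in> {s..t}" for r
    using p_halves[of "\<beta> r"] \<beta>(2) h that unfolding image_subset_iff comp_apply by blast+
  have c: "?c r \<notin> \<real>\<^sub>\<le>\<^sub>0 \<and> cmod (?c r) = 1" if r: "r \<in> {s..t}" for r
  proof -
    obtain n \<psi> d where x: "(n, \<psi>) \<in> Kt" "n \<le> 1" "d \<in> open_disk n" "\<beta> r = \<psi> d"
      using cell_point[OF b(1)[OF r]] by metis
    show ?thesis
    proof (cases "n = 1 \<and> push 1 \<psi> = \<xi>")
      case False
      have "?c r = 1" by (simp only: x(4) collapse_push[OF *(1) x(1,3)] False if_False)
      then show ?thesis by simp
    next
      case True
      then have \<psi>: "(1, \<psi>) \<in> Kt" using x(1) by simp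
      obtain u where u: "u \<in> {-1<..<1}" "d = point1 u" using x(3) True disk_one(2) by blast
      have "u \<noteq> 0" using b(2)[OF r] x(4) u mids_edge[OF \<psi>, of u] by auto
      then have "sin (pi * u) \<noteq> 0"
      proof (cases "u > 0")
        case True
        then have "0 < pi * u" "pi * u < pi" using u(1) by auto
        then show ?thesis using sin_gt_zero by fastforce
      next
        case False
        then have "0 < - (pi * u)" "- (pi * u) < pi"
          using u(1) \<open>u \<noteq> 0\<close> mult_strict_left_mono[of "-u" 1 pi] by (auto simp: mult_less_0_iff zero_less_mult_iff)
        then have "0 < sin (- (pi * u))" using sin_gt_zero by blast
        then show ?thesis by simp
      qed
      then have "Im (cis (pi * (1 + u))) \<noteq> 0" by (simp add: distrib_left sin_add)
      then have "cis (pi * (1 + u)) \<notin> \<real>\<^sub>\<le>\<^sub>0" by (auto simp: complex_nonpos_Reals_iff)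
      moreover have "?c r = cis (pi * (1 + u))" using collapse_push[OF *(1) x(1,3)] x(4) True u(2) by simp
      ultimately show ?thesis by simp
    qed
  qed
  have cc: "continuous_on {s..t} ?c"
    by (rule continuous_on_compose2[OF continuous_collapse[OF *(1)] \<beta>(1)]) (use b in auto)
  have "g t - g s = \<i> * of_real (Arg (?c t) - Arg (?c s))"
  proof (rule exp_lift_increment[OF st *(2)])
    show "continuous_on {s..t} (\<lambda>r. Arg (?c r))"
      by (rule continuous_on_compose2[OF continuous_on_Arg cc]) (use c in auto)
    show "exp (g r) = cis (Arg (?c r))" if "r \<in> {s..t}" for r
    proof -
      have "?c r \<noteq> 0" "sgn (?c r) = ?c r" using c[OF that] by (auto simp: sgn_eq)
      then show ?thesis using cis_Arg[of "?c r"] *(3) that by simp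
    qed
  qed
  moreover have "ang (?c r) = Arg (?c r)" if "r \<in> {s..t}" for r
    using c[OF that] unfolding ang_def by (auto simp: complex_nonpos_Reals_iff)
  ultimately show "g t - g s = \<i> * of_real (ang (?c t) - ang (?c s)) +
      2 * of_real pi * \<i> * of_int (Poly_Mapping.lookup (chain_of []) (1, \<xi>))" using st by simp
qed

text \<open>On an open edge the collapsed path has the angle \<open>\<pi>(1 + u)\<close> for a continuous coordinate \<open>u\<close>. The nearest vertex and
  the normalised angle jump together when \<open>u\<close> changes its sign between the two ends.\<close>

lemma tracks_edge:
  assumes \<beta>: "continuous_on {s..t} \<beta>" "\<beta> ` {s..t} \<subseteq> Mt" and \<phi>: "(1, \<phi>) \<in> K"
    and h: "(p \<circ> \<beta>) ` {s..t} \<subseteq> open_cell (1, \<phi>)" and st: "s \<le> t"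
  shows "\<exists>es. length es \<le> 1 \<and> tracks \<beta> s t es"
proof -
  have "continuous_on {s..t} (p \<circ> \<beta>)"
    using \<beta> by (intro continuous_on_compose continuous_on_subset[OF p_cont])
  from edge_coordinate[OF \<phi> this h] obtain u where
    u: "continuous_on {s..t} u" "u ` {s..t} \<subseteq> {-1<..<1}" "\<forall>r\<in>{s..t}. (p \<circ> \<beta>) r = \<phi> (point1 (u r))" .
  have uI: "u r \<in> {-1<..<1}" if "r \<in> {s..t}" for r using u(2) that by blast
  have ud: "point1 (u r) \<in> topspace (disk 1)" if "r \<in> {s..t}" for r
    using uI[OF that] by (intro point1_in_disk) auto
  have sI: "s \<in> {s..t}" "t \<in> {s..t}" using st by auto
  have "\<beta> s \<in> Mt" "p (\<beta> s) = \<phi> (point1 (u s))" using \<beta>(2) u(3) sI by auto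
  from lift_through[OF \<phi> ud[OF sI(1)] this] obtain \<psi> where
    \<psi>: "(1, \<psi>) \<in> Kt" "restrict (p \<circ> \<psi>) (topspace (disk 1)) = \<phi>" "\<psi> (point1 (u s)) = \<beta> s" .
  have \<beta>u: "\<beta> r = \<psi> (point1 (u r))" if r: "r \<in> {s..t}" for r
  proof (rule covering_lift_unique[of Mt p M "{s..t}" \<beta> "\<lambda>r. \<psi> (point1 (u r))" s])
    show "continuous_on {s..t} (\<lambda>r. \<psi> (point1 (u r)))"
      by (rule continuous_on_compose2[OF Kt_cell(2)[OF \<psi>(1)] continuous_on_point1[OF u(1)]]) (use ud in blast)
    show "(\<lambda>r. \<psi> (point1 (u r))) \<in> {s..t} \<rightarrow> Mt" using Kt_cell(3)[OF \<psi>(1)] ud by blast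
    show "p (\<beta> x) = p (\<psi> (point1 (u x)))" if "x \<in> {s..t}" for x
      using fun_cong[OF \<psi>(2), of "point1 (u x)"] ud[OF that] u(3) that by simp
  qed (use \<beta> cov r sI \<psi>(3) in auto)
  define e where "e = (1::nat, push 1 \<psi>)"
  have ends: "src e = q (\<psi> (point1 (-1)))" "tgt e = q (\<psi> (point1 1))"
    unfolding e_def by (rule push_ends)+
  define es where "es = (if u s < 0 \<and> 0 \<le> u t then [(True, e)] else if u t < 0 \<and> 0 \<le> u s then [(False, e)] else [])"
  have e: "e \<in> cells_of_dim Ki 1" using Ki_edge_iff \<psi>(1) e_def by blast
  have v: "vert (\<beta> r) = (if u r < 0 then \<psi> (point1 (-1)) else \<psi> (point1 1))" if "r \<in> {s..t}" for r
    using vert_open_edge[OF \<psi>(1) uI[OF that]] \<beta>u[OF that] by simp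
  have "tracks \<beta> s t es"
    unfolding tracks_def
  proof (intro conjI allI impI)
    show "walk Ki (q (vert (\<beta> s))) es (q (vert (\<beta> t)))"
      unfolding v[OF sI(1)] v[OF sI(2)] es_def using e by (simp add: ends)
    fix \<xi> g assume *: "(1, \<xi>) \<in> Ki" "continuous_on {s..t} g" "\<forall>r\<in>{s..t}. collapse (1, \<xi>) (q (\<beta> r)) = exp (g r)"
    let ?c = "\<lambda>r. collapse (1, \<xi>) (q (\<beta> r))"
    have c: "?c r = (if push 1 \<psi> = \<xi> then cis (pi * (1 + u r)) else 1)" if "r \<in> {s..t}" for r
      using collapse_edge[OF *(1) \<psi>(1), of "u r"] \<beta>u[OF that] uI[OF that] by auto
    show "g t - g s = \<i> * of_real (ang (?c t) - ang (?c s)) +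
        2 * of_real pi * \<i> * of_int (Poly_Mapping.lookup (chain_of es) (1, \<xi>))"
    proof (cases "push 1 \<psi> = \<xi>")
      case True
      have gl: "g t - g s = \<i> * of_real (pi * (1 + u t) - pi * (1 + u s))"
        by (rule exp_lift_increment[OF st *(2)]) (use u(1) c True *(3) in \<open>auto intro!: continuous_intros\<close>)
      have a: "ang (?c r) = pi * (1 + u r) - (if u r < 0 then 0 else 2 * pi)" if "r \<in> {s..t}" for r
        using c[OF that] ang_cis[OF uI[OF that]] True by simp
      have lk: "Poly_Mapping.lookup (chain_of es) (1, \<xi>) =
          (if u s < 0 \<and> 0 \<le> u t then 1 else if u t < 0 \<and> 0 \<le> u s then -1 else 0)"
        using True by (simp add: es_def e_def lookup_single)
      show ?thesis unfolding gl lk a[OF sI(1)] a[OF sI(2)] by (auto simp: algebra_simps)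
    next
      case False
      have "g t - g s = \<i> * of_real (0 - 0)"
        by (rule exp_lift_increment[OF st *(2)]) (use c False *(3) in auto)
      moreover have "Poly_Mapping.lookup (chain_of es) (1, \<xi>) = 0"
        using False by (simp add: es_def e_def lookup_single)
      ultimately show ?thesis using c[OF sI(1)] c[OF sI(2)] False by simp
    qed
  qed
  moreover have "length es \<le> 1" by (simp add: es_def)
  ultimately show ?thesis by blast
qed

lemma pieces_track:
  assumes "pieces \<alpha> n s t" "continuous_on {s..t} \<beta>" "\<beta> ` {s..t} \<subseteq> Mt" "\<And>r. r \<in> {s..t} \<Longrightarrow> p (\<beta> r) = \<alpha> r"
  shows "\<exists>es. length es \<le> n \<and> tracks \<beta> s t es"
  using assms
proof (induction rule: pieces.induct)
  case (half s t)
  have "(p \<circ> \<beta>) ` {s..t} \<subseteq> halves" using half.hyps(2) half.prems(3) by auto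
  then have "tracks \<beta> s t []" using half by (intro tracks_half)
  then show ?case by (intro exI[of _ "[]"]) simp
next
  case (edge s t \<phi>)
  have "(p \<circ> \<beta>) ` {s..t} \<subseteq> open_cell (1, \<phi>)" using edge.hyps(3) edge.prems(3) by auto
  then show ?case using edge by (intro tracks_edge[of s t \<beta> \<phi>])
next
  case (join m s r n t)
  have le: "s \<le> r" "r \<le> t" using join.hyps pieces_le by auto
  have sub: "{s..r} \<subseteq> {s..t}" "{r..t} \<subseteq> {s..t}" using le by auto
  have "\<exists>es. length es \<le> m \<and> tracks \<beta> s r es"
    by (rule join.IH(1)[OF continuous_on_subset[OF join.prems(1) sub(1)]
          order_trans[OF image_mono[OF sub(1)] join.prems(2)] join.prems(3)]) (use sub in blast)
  moreover have "\<exists>es. length es \<le> n \<and> tracks \<beta> r t es"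
    by (rule join.IH(2)[OF continuous_on_subset[OF join.prems(1) sub(2)]
          order_trans[OF image_mono[OF sub(2)] join.prems(2)] join.prems(3)]) (use sub in blast)
  ultimately obtain es fs where "length es \<le> m" "tracks \<beta> s r es" "length fs \<le> n" "tracks \<beta> r t fs" by blast
  note e = this
  have "tracks \<beta> s t (es @ fs)" using tracks_join[OF e(2,4) le] .
  moreover have "length (es @ fs) \<le> m + n" using e(1,3) by simp
  ultimately show ?case by blast
qed

lemma collapse_nonzero: "collapse e x \<noteq> 0"
  by (auto simp: collapse_def)

end

lemma circle_point:
  "point2 (cos (2 * pi * s)) (sin (2 * pi * s)) \<in> disk_boundary 2"
proof -
  have "(\<Sum>i<2. (point2 a c i)\<^sup>2) = a\<^sup>2 + c\<^sup>2" for a c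
    by (simp add: numeral_2_eq_2 point2_def)
  moreover have "point2 a c i = 0" if "i \<ge> 2" for a c i
    using that by (auto simp: point2_def)
  ultimately show ?thesis by (simp add: disk_boundary_def topspace_disk)
qed

lemma continuous_circle: "continuous_on A (\<lambda>s. point2 (cos (2 * pi * s)) (sin (2 * pi * s)))"
proof (rule continuous_on_coordinatewise_then_product)
  show "continuous_on A (\<lambda>s. point2 (cos (2 * pi * s)) (sin (2 * pi * s)) i)" for i
    unfolding point2_def by (cases "i = 0"; cases "i = 1") (auto intro!: continuous_intros)
qed

context deck_quotient
begin

text \<open>The incidence numbers are winding numbers of the collapsed attaching loop, and these are the coefficients
  of the chain of the walk that tracks the loop.\<close>

lemma boundary_walk:
  assumes \<psi>: "(2, \<psi>) \<in> Kt"
    and pc: "pieces (attaching_loop (2, restrict (p \<circ> \<psi>) (topspace (disk 2)))) n 0 1"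
  shows "\<exists>x es. walk Ki x es x \<and> length es \<le> n \<and> boundary2 Ki (frag_of (2, push 2 \<psi>)) = chain_of es"
proof -
  let ?circ = "\<lambda>s. point2 (cos (2 * pi * s)) (sin (2 * pi * s))"
  let ?f = "(2, push 2 \<psi>)"
  define \<beta> where "\<beta> s = \<psi> (?circ s)" for s
  have cd: "?circ s \<in> topspace (disk 2)" for s using boundaryD[OF circle_point] .
  have \<beta>: "continuous_on A \<beta>" for A
    unfolding \<beta>_def by (rule continuous_on_compose2[OF Kt_cell(2)[OF \<psi>] continuous_circle]) (use cd in blast)
  have \<beta>1: "\<beta> s \<in> skt 1" for s
    unfolding \<beta>_def using lift_boundary_in_skt[of 1 \<psi>] \<psi> circle_point by (simp add: numeral_2_eq_2)
  have \<beta>M: "\<beta> ` A \<subseteq> Mt" for A using \<beta>1 skt_subset by blast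
  have loop: "\<beta> 1 = \<beta> 0" by (simp add: \<beta>_def)
  have att: "attaching_loop ?f s = q (\<beta> s)" for s
    using push_apply[OF cd] by (simp add: attaching_loop_def \<beta>_def)
  have p\<beta>: "p (\<beta> s) = attaching_loop (2, restrict (p \<circ> \<psi>) (topspace (disk 2))) s" for s
    using cd by (simp add: attaching_loop_def \<beta>_def)
  obtain es where es: "length es \<le> n" "tracks \<beta> 0 1 es" using pieces_track[OF pc \<beta> \<beta>M p\<beta>] by blast
  have w: "walk Ki (q (vert (\<beta> 0))) es (q (vert (\<beta> 0)))" using es(2) loop by (simp add: tracks_def)
  have inc: "incidence ?f e = Poly_Mapping.lookup (chain_of es) e" if e: "e \<in> cells_of_dim Ki 1" for e
  proof -
    obtain \<xi> where \<xi>: "e = (1, \<xi>)" "(1, \<xi>) \<in> Ki" using e by (cases e) (auto simp: cells_of_dim_def)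
    let ?c = "collapse e \<circ> attaching_loop ?f"
    have cc: "?c s = collapse (1, \<xi>) (q (\<beta> s))" for s using att \<xi>(1) by simp
    have "continuous_on {0..1} (\<lambda>s. collapse (1, \<xi>) (q (\<beta> s)))"
      by (rule continuous_on_compose2[OF continuous_collapse[OF \<xi>(2)] \<beta>]) (use \<beta>1 in auto)
    then have "path ?c" unfolding path_def by (rule continuous_on_eq) (simp only: cc)
    moreover have "0 \<notin> path_image ?c"
    proof
      assume "0 \<in> path_image ?c"
      then obtain s where "0 = collapse e (attaching_loop ?f s)" unfolding path_image_def comp_apply by (rule imageE)
      then show False using collapse_nonzero[of e "attaching_loop ?f s"] by (simp only: not_True_eq_False)
    qed
    ultimately obtain g where g: "path g" "pathfinish g - pathstart g = 2 * of_real pi * \<i> * winding_number ?c 0"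
      "\<And>t. t \<in> {0..1} \<Longrightarrow> ?c t = 0 + exp (g t)"
      by (rule winding_number_as_continuous_log) blast
    have "g 1 - g 0 = \<i> * of_real (ang (collapse (1, \<xi>) (q (\<beta> 1))) - ang (collapse (1, \<xi>) (q (\<beta> 0)))) +
          2 * of_real pi * \<i> * of_int (Poly_Mapping.lookup (chain_of es) (1, \<xi>))"
    proof (rule es(2)[unfolded tracks_def, THEN conjunct2, rule_format, OF \<xi>(2)])
      show "continuous_on {0..1} g" using g(1) by (simp add: path_def)
      show "collapse (1, \<xi>) (q (\<beta> r)) = exp (g r)" if "r \<in> {0..1}" for r using g(3)[OF that] cc[of r] by simp
    qed
    then have "2 * of_real pi * \<i> * winding_number ?c 0 = 2 * of_real pi * \<i> * of_int (Poly_Mapping.lookup (chain_of es) e)"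
      using g(2) loop \<xi>(1) by (simp add: pathstart_def pathfinish_def)
    then have "winding_number ?c 0 = of_int (Poly_Mapping.lookup (chain_of es) e)" by simp
    then show ?thesis unfolding incidence_def by (intro the_equality) auto
  qed
  have keys: "{e \<in> cells_of_dim Ki 1. incidence ?f e \<noteq> 0} = Poly_Mapping.keys (chain_of es)"
    using inc keys_chain_of[OF w] by (auto simp: in_keys_iff)
  have "boundary2 Ki (frag_of ?f) = (\<Sum>e\<in>Poly_Mapping.keys (chain_of es). frag_cmul (incidence ?f e) (frag_of e))"
    unfolding boundary2_def frag_extend_of keys ..
  also have "\<dots> = (\<Sum>e\<in>Poly_Mapping.keys (chain_of es). frag_cmul (Poly_Mapping.lookup (chain_of es) e) (frag_of e))"
    using inc keys_chain_of[OF w] by (intro sum.cong) auto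
  also have "\<dots> = chain_of es" using frag_expansion[of "chain_of es"] unfolding frag_extend_def by simp
  finally show ?thesis using w es(1) by blast
qed

end

context universal_cover
begin

text \<open>The pieces of an attaching loop are counted in \<open>M\<close>, so their number bounds the boundary walks in all
  quotients at once.\<close>

lemma boundary_walk_bound:
  "\<exists>N. \<forall>H. deck_group_on Mt p H \<longrightarrow> (\<forall>f\<in>cells_of_dim (pullback_cells K (orbit_space Mt H) (orbit_projection p)) 2.
     \<exists>x es. walk (pullback_cells K (orbit_space Mt H) (orbit_projection p)) x es x \<and> length es \<le> N \<and>
       boundary2 (pullback_cells K (orbit_space Mt H) (orbit_projection p)) (frag_of f) = chain_of es)"
proof -
  have "\<exists>n. pieces (attaching_loop e) n 0 1" if e: "e \<in> cells_of_dim K 2" for e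
  proof -
    obtain \<phi> where \<phi>: "e = (2, \<phi>)" "(2, \<phi>) \<in> K" using e by (cases e) (auto simp: cells_of_dim_def)
    have b: "point2 (cos (2 * pi * s)) (sin (2 * pi * s)) \<in> disk_boundary (Suc 1)" for s
      using circle_point by (simp add: numeral_2_eq_2)
    show ?thesis
    proof (rule pieces_exist)
      show "attaching_loop e ` {0..1} \<subseteq> skel 1"
        unfolding attaching_loop_def \<phi>(1) using boundary_in_skel[of 1 \<phi>] \<phi>(2) b by (auto simp: numeral_2_eq_2)
      have "continuous_on {0..1} (\<lambda>s. \<phi> (point2 (cos (2 * pi * s)) (sin (2 * pi * s))))"
        by (rule continuous_on_compose2[OF cell(2)[OF \<phi>(2)] continuous_circle]) (use boundaryD[OF circle_point] in blast)
      then show "continuous_on {0..1} (attaching_loop e)" unfolding attaching_loop_def \<phi>(1) by simp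
    qed
  qed
  then obtain n where n: "\<And>e. e \<in> cells_of_dim K 2 \<Longrightarrow> pieces (attaching_loop e) (n e) 0 1" by metis
  have fin: "finite (n ` cells_of_dim K 2)" using finite_K by (simp add: cells_of_dim_def)
  define N where "N = Max (insert 0 (n ` cells_of_dim K 2))"
  have N: "n e \<le> N" if "e \<in> cells_of_dim K 2" for e unfolding N_def using fin that by auto
  show ?thesis
  proof (intro exI[of _ N] allI impI ballI)
    fix H f assume H: "deck_group_on Mt p H"
      and f: "f \<in> cells_of_dim (pullback_cells K (orbit_space Mt H) (orbit_projection p)) 2"
    interpret deck_quotient M K Mt p b H by unfold_locales (rule H)
    obtain \<xi> where \<xi>: "f = (2, \<xi>)" "(2, \<xi>) \<in> Ki" using f by (cases f) (auto simp: cells_of_dim_def)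
    obtain \<psi> where \<psi>: "(2, \<psi>) \<in> Kt" "\<xi> = push 2 \<psi>" using cell_lift_ex[OF \<xi>(2)] by metis
    let ?e = "(2, restrict (p \<circ> \<psi>) (topspace (disk 2)))"
    have e: "?e \<in> cells_of_dim K 2" using Kt_cell(4)[OF \<psi>(1)] by (simp add: cells_of_dim_def)
    show "\<exists>x es. walk Ki x es x \<and> length es \<le> N \<and> boundary2 Ki (frag_of f) = chain_of es"
      using boundary_walk[OF \<psi>(1) n[OF e]] N[OF e] \<xi>(1) \<psi>(2) by (meson order_trans)
  qed
qed

end

section \<open>Torsion in the first homology\<close>

text \<open>The cosets of the boundaries multiply as the cycles add. If the rank is zero, then the class of \<open>c\<close> is not
  independent, that is, it has finite order.\<close>

lemma betti1_zero_imp_torsion: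
  assumes L: "betti1 L = 0"
    and c: "Poly_Mapping.keys c \<subseteq> cells_of_dim L 1" "boundary1 c = 0"
  shows "\<exists>k::int. k \<noteq> 0 \<and> frag_cmul k c \<in> boundary2 L ` carrier (chain_group L 2)"
proof -
  define B where "B = boundary2 L ` carrier (chain_group L 2)"
  define Z where "Z = kernel (chain_group L 1) (chain_group L 0) boundary1"
  let ?C = "chain_group L 1"
  let ?A = "homology1 L"
  define cl where "cl a = (\<lambda>h. h + a) ` B" for a
  have B0: "0 \<in> B" unfolding B_def
    by (rule image_eqI[of _ _ 0]) (auto simp: boundary2_def chain_group_def)
  have Badd: "x + y \<in> B" if xy: "x \<in> B" "y \<in> B" for x y
  proof -
    obtain u v where "x = boundary2 L u" "u \<in> carrier (chain_group L 2)" "y = boundary2 L v" "v \<in> carrier (chain_group L 2)"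
      using xy unfolding B_def by blast
    then show ?thesis unfolding B_def
      by (intro image_eqI[of _ _ "u + v"]) (use keys_add[of u v] in \<open>auto simp: boundary2_def chain_group_def frag_extend_add\<close>)
  qed
  have Zadd: "x + y \<in> Z" if "x \<in> Z" "y \<in> Z" for x y
    using that keys_add[of x y] by (auto simp: Z_def kernel_def chain_group_def boundary1_def frag_extend_add)
  have Zneg: "- x \<in> Z" if "x \<in> Z" for x
    using that by (auto simp: Z_def kernel_def chain_group_def boundary1_def frag_extend_minus)
  have Z0: "0 \<in> Z" by (auto simp: Z_def kernel_def chain_group_def boundary1_def)
  have carr: "carrier ?A = cl ` Z"
    by (auto simp: homology1_def FactGroup_def RCOSETS_def r_coset_def cl_def Z_def B_def chain_group_def)
  have one: "\<one>\<^bsub>?A\<^esub> = cl 0"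
    by (simp add: homology1_def FactGroup_def cl_def B_def)
  have mult: "cl x \<otimes>\<^bsub>?A\<^esub> cl y = cl (x + y)" for x y
  proof -
    have "cl x \<otimes>\<^bsub>?A\<^esub> cl y = (\<Union>h\<in>cl x. \<Union>k\<in>cl y. {h + k})"
      by (simp add: homology1_def FactGroup_def set_mult_def chain_group_def)
    also have "\<dots> = cl (x + y)"
    proof (intro equalityI subsetI)
      fix w assume "w \<in> (\<Union>h\<in>cl x. \<Union>k\<in>cl y. {h + k})"
      then obtain h k where "h \<in> B" "k \<in> B" "w = (h + x) + (k + y)" by (auto simp: cl_def)
      then show "w \<in> cl (x + y)" unfolding cl_def by (intro image_eqI[of _ _ "h + k"] Badd) (auto simp: algebra_simps)
    next
      fix w assume "w \<in> cl (x + y)"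
      then obtain h where "h \<in> B" "w = (h + x) + (0 + y)" by (auto simp: cl_def algebra_simps)
      then show "w \<in> (\<Union>h\<in>cl x. \<Union>k\<in>cl y. {h + k})" using B0 unfolding cl_def by blast
    qed
    finally show ?thesis .
  qed
  have grp: "comm_group ?A"
  proof (rule comm_groupI)
    show "\<And>x. x \<in> carrier ?A \<Longrightarrow> \<exists>y\<in>carrier ?A. y \<otimes>\<^bsub>?A\<^esub> x = \<one>\<^bsub>?A\<^esub>"
      unfolding carr one
    proof -
      fix x assume "x \<in> cl ` Z"
      then obtain a where a: "a \<in> Z" "x = cl a" by blast
      show "\<exists>y\<in>cl ` Z. y \<otimes>\<^bsub>?A\<^esub> x = cl 0"
        by (rule bexI[of _ "cl (- a)"]) (use a Zneg in \<open>auto simp: mult\<close>)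
    qed
  qed (unfold carr one, (use Zadd Z0 in \<open>auto simp: mult algebra_simps\<close>))
  interpret A: comm_group ?A by (rule grp)
  have cZ: "c \<in> Z" using c by (simp add: Z_def kernel_def chain_group_def)
  have cA: "cl c \<in> carrier ?A" using cZ carr by blast
  have npow: "cl c [^]\<^bsub>?A\<^esub> (n::nat) = cl (frag_cmul (int n) c)" for n
  proof (induction n)
    case 0
    then show ?case using one by simp
  next
    case (Suc n)
    have "frag_cmul (int n) c + c = frag_cmul (int (Suc n)) c"
      by (simp add: frag_cmul_distrib add.commute)
    then show ?case using Suc by (simp add: mult)
  qed
  have ZnZ: "frag_cmul (int n) c \<in> Z" for n
  proof -
    have "Poly_Mapping.keys (frag_cmul (int n) c) \<subseteq> cells_of_dim L 1" using keys_cmul[of "int n" c] c(1) by blast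
    moreover have "boundary1 (frag_cmul (int n) c) = 0" using c(2) by (simp add: boundary1_def frag_extend_cmul)
    ultimately show ?thesis by (simp add: Z_def kernel_def chain_group_def)
  qed
  have ipow: "cl c [^]\<^bsub>?A\<^esub> (k::int) = cl (frag_cmul k c)" for k
  proof (cases "k < 0")
    case False
    then have "cl c [^]\<^bsub>?A\<^esub> k = cl c [^]\<^bsub>?A\<^esub> nat k" by (simp only: int_pow_def2 if_False)
    moreover have "int (nat k) = k" using False by simp
    ultimately show ?thesis using npow[of "nat k"] by (simp only:)
  next
    case True
    have inv: "inv\<^bsub>?A\<^esub> (cl (frag_cmul (int (nat (-k))) c)) = cl (- frag_cmul (int (nat (-k))) c)"
    proof (rule A.inv_equality)
      show "cl (- frag_cmul (int (nat (-k))) c) \<otimes>\<^bsub>?A\<^esub> cl (frag_cmul (int (nat (-k))) c) = \<one>\<^bsub>?A\<^esub>"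
        unfolding mult one by (simp only: left_minus)
      show "cl (frag_cmul (int (nat (-k))) c) \<in> carrier ?A" unfolding carr by (rule imageI[OF ZnZ])
      show "cl (- frag_cmul (int (nat (-k))) c) \<in> carrier ?A" unfolding carr by (rule imageI[OF Zneg[OF ZnZ]])
    qed
    have "cl c [^]\<^bsub>?A\<^esub> k = inv\<^bsub>?A\<^esub> (cl c [^]\<^bsub>?A\<^esub> nat (-k))" using True by (simp only: int_pow_def2 if_True)
    also have "\<dots> = cl (- frag_cmul (int (nat (-k))) c)" unfolding npow by (rule inv)
    also have "- frag_cmul (int (nat (-k))) c = frag_cmul k c" using True by simp
    finally show ?thesis .
  qed
  have "\<not> int_independent ?A {cl c}"
  proof
    assume "int_independent ?A {cl c}"
    then have "enat (card {cl c}) \<le> abelian_rank ?A"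
      unfolding abelian_rank_def by (intro SUP_upper) simp
    then show False using L by (simp add: betti1_def zero_enat_def)
  qed
  then obtain k :: "(_ \<Rightarrow> int)" where k: "(\<Otimes>\<^bsub>?A\<^esub>x\<in>{cl c}. x [^]\<^bsub>?A\<^esub> k x) = \<one>\<^bsub>?A\<^esub>" "k (cl c) \<noteq> 0"
    using cA by (auto simp: int_independent_def)
  have "cl c [^]\<^bsub>?A\<^esub> k (cl c) = \<one>\<^bsub>?A\<^esub>"
  proof -
    have "cl c [^]\<^bsub>?A\<^esub> k (cl c) \<in> carrier ?A" using cA by (rule A.int_pow_closed)
    then show ?thesis using k(1) by (simp add: A.finprod_insert del: int_pow_def2)
  qed
  then have "cl (frag_cmul (k (cl c)) c) = cl 0" using ipow one by simp
  moreover have "frag_cmul (k (cl c)) c \<in> cl (frag_cmul (k (cl c)) c)"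
    unfolding cl_def using B0 by (intro image_eqI[of _ _ 0]) auto
  ultimately have "frag_cmul (k (cl c)) c \<in> B" by (simp add: cl_def)
  then show ?thesis using k(2) B_def by blast
qed

section \<open>Cochains on isometric loops\<close>

definition ev :: "('e \<Rightarrow> real) \<Rightarrow> ('e \<Rightarrow>\<^sub>0 int) \<Rightarrow> real" where
  "ev \<phi> c = (\<Sum>e\<in>Poly_Mapping.keys c. of_int (Poly_Mapping.lookup c e) * \<phi> e)"

lemma ev_superset:
  assumes "finite S" "Poly_Mapping.keys c \<subseteq> S"
  shows "ev \<phi> c = (\<Sum>e\<in>S. of_int (Poly_Mapping.lookup c e) * \<phi> e)"
  unfolding ev_def using assms by (intro sum.mono_neutral_left) (auto simp: in_keys_iff)

lemma ev_add: "ev \<phi> (c + d) = ev \<phi> c + ev \<phi> d"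
proof -
  let ?S = "Poly_Mapping.keys c \<union> Poly_Mapping.keys d"
  show ?thesis
    using ev_superset[of ?S c] ev_superset[of ?S d] ev_superset[of ?S "c + d"] keys_add[of c d]
    by (simp add: lookup_add distrib_right sum.distrib)
qed

lemma ev_cmul: "ev \<phi> (frag_cmul k c) = of_int k * ev \<phi> c"
  using ev_superset[of "Poly_Mapping.keys c" "frag_cmul k c" \<phi>] keys_cmul[of k c]
  by (simp add: ev_def sum_distrib_left mult.assoc)

lemma ev_0 [simp]: "ev \<phi> 0 = 0" by (simp add: ev_def)

lemma ev_minus: "ev \<phi> (- c) = - ev \<phi> c"
  using ev_add[of \<phi> c "- c"] by simp

lemma ev_frag_of [simp]: "ev \<phi> (frag_of e) = \<phi> e"
  by (simp add: ev_def)

lemma ev_sum: "finite I \<Longrightarrow> ev \<phi> (\<Sum>i\<in>I. g i) = (\<Sum>i\<in>I. ev \<phi> (g i))"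
  by (induction I rule: finite_induct) (simp_all add: ev_add)

lemma ev_frag_extend_bound:
  assumes "\<And>f. f \<in> Poly_Mapping.keys A \<Longrightarrow> \<bar>ev \<phi> (d f)\<bar> \<le> C"
  shows "\<bar>ev \<phi> (frag_extend d A)\<bar> \<le> C * chain_norm A"
proof -
  have "ev \<phi> (frag_extend d A) = (\<Sum>f\<in>Poly_Mapping.keys A. of_int (Poly_Mapping.lookup A f) * ev \<phi> (d f))"
    by (simp add: frag_extend_def ev_sum ev_cmul)
  also have "\<bar>\<dots>\<bar> \<le> (\<Sum>f\<in>Poly_Mapping.keys A. of_int \<bar>Poly_Mapping.lookup A f\<bar> * C)"
    by (intro order_trans[OF sum_abs] sum_mono) (use assms in \<open>auto simp: abs_mult intro: mult_left_mono\<close>)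
  also have "\<dots> = C * chain_norm A" by (simp add: chain_norm_def sum_distrib_left mult.commute)
  finally show ?thesis .
qed

lemma chain_norm_superset:
  assumes "finite S" "Poly_Mapping.keys c \<subseteq> S"
  shows "chain_norm c = (\<Sum>e\<in>S. of_int \<bar>Poly_Mapping.lookup c e\<bar>)"
  unfolding chain_norm_def using assms by (intro sum.mono_neutral_left) (auto simp: in_keys_iff)

lemma chain_norm_add: "chain_norm (c + d) \<le> chain_norm c + chain_norm d"
proof -
  let ?S = "Poly_Mapping.keys c \<union> Poly_Mapping.keys d"
  have "chain_norm (c + d) = (\<Sum>e\<in>?S. of_int \<bar>Poly_Mapping.lookup (c + d) e\<bar>)"
    using keys_add[of c d] by (intro chain_norm_superset) auto
  also have "\<dots> \<le> (\<Sum>e\<in>?S. of_int \<bar>Poly_Mapping.lookup c e\<bar> + of_int \<bar>Poly_Mapping.lookup d e\<bar>)"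
    by (intro sum_mono) (simp add: lookup_add)
  also have "\<dots> = chain_norm c + chain_norm d"
    using chain_norm_superset[of ?S c] chain_norm_superset[of ?S d] by (simp add: sum.distrib)
  finally show ?thesis .
qed

lemma chain_norm_cmul: "chain_norm (frag_cmul k c) = \<bar>of_int k\<bar> * chain_norm c"
  using chain_norm_superset[of "Poly_Mapping.keys c" "frag_cmul k c"] keys_cmul[of k c]
  by (simp add: chain_norm_def sum_distrib_left abs_mult)

lemma chain_norm_chain_of: "chain_norm (chain_of es) \<le> length es"
proof (induction es rule: chain_of.induct)
  case (2 s e es)
  have "chain_norm (if s then frag_of e else - frag_of e) = 1"
    by (auto simp: chain_norm_def)
  then show ?case using 2 chain_norm_add[of "if s then frag_of e else - frag_of e" "chain_of es"] by simp
qed (simp add: chain_norm_def)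

lemma boundary1_add: "boundary1 (c + d) = boundary1 c + boundary1 d"
  and boundary1_diff: "boundary1 (c - d) = boundary1 c - boundary1 d"
  by (simp_all add: boundary1_def frag_extend_add frag_extend_diff)

lemma boundary1_walk:
  "walk L x es y \<Longrightarrow> boundary1 (chain_of es) = frag_of (vertex_cell y) - frag_of (vertex_cell x)"
proof (induction L x es y rule: walk.induct)
  case (2 L x s e es y)
  have "boundary1 (frag_of e) = frag_of (vertex_cell (tgt e)) - frag_of (vertex_cell (src e))"
    by (simp add: boundary1_def src_def tgt_def)
  then show ?case using 2 by (cases s) (auto simp: boundary1_add boundary1_diff)
qed (simp add: boundary1_def)

text \<open>The cochain \<open>X \<cdot> dF\<close>, with \<open>X\<close> averaged over the two ends of an edge and scaled by two.\<close>

definition coch :: "('v \<Rightarrow> real) \<Rightarrow> ('v \<Rightarrow> real) \<Rightarrow> 'v cell \<Rightarrow> real" where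
  "coch F X e = (X (src e) + X (tgt e)) * (F (tgt e) - F (src e))"

text \<open>If \<open>X\<close> were the constant \<open>c\<close>, the cochain would be \<open>2c \<cdot> dF\<close>. Along the walk \<open>X\<close> differs from \<open>c\<close> by at most its
  difference at the beginning and the number of steps.\<close>

lemma walk_coch_bound:
  fixes F X :: "'v \<Rightarrow> real" and c :: real
  assumes "walk L x es y" and lip: "\<And>u w. (u, w) \<in> adj L \<Longrightarrow> \<bar>F w - F u\<bar> \<le> 1 \<and> \<bar>X w - X u\<bar> \<le> 1"
  shows "\<bar>ev (coch F X) (chain_of es) - 2 * c * (F y - F x)\<bar> \<le>
    2 * real (length es) * (\<bar>X x - c\<bar> + real (length es))"
  using assms(1)
proof (induction es arbitrary: x)
  case (Cons a es)
  obtain s e where a: "a = (s, e)" by (rule prod.exhaust)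
  define w where "w = (if s then tgt e else src e)"
  have x: "x = (if s then src e else tgt e)" and e: "e \<in> cells_of_dim L 1" and wes: "walk L w es y"
    using Cons.prems by (auto simp: a w_def)
  have adj: "(x, w) \<in> adj L" using e unfolding adj_def x w_def by (auto intro!: bexI[of _ e])
  have l: "\<bar>F w - F x\<bar> \<le> 1" "\<bar>X w - X x\<bar> \<le> 1" using lip[OF adj] by auto
  let ?a = "\<bar>X x - c\<bar>" and ?l = "real (length es)"
  have first: "ev (coch F X) (if s then frag_of e else - frag_of e) = (X x + X w) * (F w - F x)"
    unfolding x w_def by (auto simp: ev_minus coch_def algebra_simps)
  have "X x + X w - 2 * c = 2 * (X x - c) + (X w - X x)" by simp
  also have "\<bar>\<dots>\<bar> \<le> \<bar>2 * (X x - c)\<bar> + \<bar>X w - X x\<bar>" by (rule abs_triangle_ineq)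
  also have "\<bar>2 * (X x - c)\<bar> = 2 * ?a" unfolding abs_mult by simp
  finally have "\<bar>X x + X w - 2 * c\<bar> \<le> 2 * ?a + 1" using l(2) by linarith
  then have 1: "\<bar>(X x + X w - 2 * c) * (F w - F x)\<bar> \<le> (2 * ?a + 1) * 1"
    unfolding abs_mult using l(1) by (intro mult_mono) auto
  have 2: "\<bar>ev (coch F X) (chain_of es) - 2 * c * (F y - F w)\<bar> \<le> 2 * ?l * (\<bar>X w - c\<bar> + ?l)"
    using Cons.IH[OF wes] .
  have 3: "2 * ?l * (\<bar>X w - c\<bar> + ?l) \<le> 2 * ?l * ((?a + 1) + ?l)"
    by (intro mult_left_mono) (use l in auto)
  have "ev (coch F X) (chain_of (a # es)) - 2 * c * (F y - F x) =
     (X x + X w - 2 * c) * (F w - F x) + (ev (coch F X) (chain_of es) - 2 * c * (F y - F w))"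
    by (simp add: a ev_add first algebra_simps)
  also have "\<bar>\<dots>\<bar> \<le> (2 * ?a + 1) * 1 + 2 * ?l * ((?a + 1) + ?l)"
    by (rule order_trans[OF abs_triangle_ineq add_mono[OF 1 order_trans[OF 2 3]]])
  also have "\<dots> \<le> 2 * (?l + 1) * (?a + (?l + 1))" by (simp add: algebra_simps)
  finally show ?case by (simp add: add.commute)
qed simp

lemma walk_of_path:
  assumes "\<And>k. k < l \<Longrightarrow> (v k, v (Suc k)) \<in> adj L"
  shows "\<exists>es. walk L (v 0) es (v l) \<and> length es = l \<and> (\<forall>F X. ev (coch F X) (chain_of es) =
     (\<Sum>k<l. (X (v k) + X (v (Suc k))) * (F (v (Suc k)) - F (v k))))"
  using assms
proof (induction l)
  case 0
  show ?case by (intro exI[of _ "[]"]) simp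
next
  case (Suc l)
  then obtain es where es: "walk L (v 0) es (v l)" "length es = l"
    "\<And>F X. ev (coch F X) (chain_of es) = (\<Sum>k<l. (X (v k) + X (v (Suc k))) * (F (v (Suc k)) - F (v k)))" by auto
  obtain e where e: "e \<in> cells_of_dim L 1" "(v l = src e \<and> v (Suc l) = tgt e) \<or> (v l = tgt e \<and> v (Suc l) = src e)"
    using Suc.prems[of l] by (auto simp: adj_def)
  obtain s where s: "v l = (if s then src e else tgt e)" "v (Suc l) = (if s then tgt e else src e)"
    using e(2) by (metis (full_types))
  have "walk L (v 0) (es @ [(s, e)]) (v (Suc l))"
    by (rule walk_append[OF es(1)]) (use e(1) s in auto)
  moreover have "ev (coch F X) (chain_of (es @ [(s, e)])) =
      (\<Sum>k<Suc l. (X (v k) + X (v (Suc k))) * (F (v (Suc k)) - F (v k)))" for F X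
    unfolding chain_of_append ev_add es(3) sum.lessThan_Suc using s
    by (cases s) (auto simp: ev_minus coch_def algebra_simps)
  ultimately show ?case using es(2) by (intro exI[of _ "es @ [(s, e)]"]) auto
qed

text \<open>The graph distance, cut off at \<open>l\<close>. The cut-off gives a value also to vertices in different components and
  does not destroy the Lipschitz property.\<close>

definition gdist :: "'v cell set \<Rightarrow> nat \<Rightarrow> 'v \<Rightarrow> 'v \<Rightarrow> nat" where
  "gdist L l x y = (LEAST n. l \<le> n \<or> (x, y) \<in> adj L ^^ n)"

lemma gdist_le: "(x, y) \<in> adj L ^^ n \<Longrightarrow> gdist L l x y \<le> n"
  unfolding gdist_def by (rule Least_le) simp

lemma gdist_cases: "l \<le> gdist L l x y \<or> (x, y) \<in> adj L ^^ gdist L l x y"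
  unfolding gdist_def by (rule LeastI[of _ l]) simp

lemma gdist_step: "(y, z) \<in> adj L \<Longrightarrow> gdist L l x z \<le> gdist L l x y + 1"
proof -
  assume "(y, z) \<in> adj L"
  then have "l \<le> gdist L l x y + 1 \<or> (x, z) \<in> adj L ^^ (gdist L l x y + 1)"
    using gdist_cases[of l L x y] by (auto intro: relpow_Suc_I)
  then show ?thesis unfolding gdist_def[of L l x z] by (rule Least_le)
qed

lemma relpow_adj_sym: "(x, y) \<in> adj L ^^ n \<Longrightarrow> (y, x) \<in> adj L ^^ n"
proof (induction n arbitrary: y)
  case (Suc n)
  then obtain z where "(x, z) \<in> adj L ^^ n" "(z, y) \<in> adj L" by auto
  then show ?case using Suc.IH sym_adj by (meson relpow_Suc_I2)
qed auto

lemma path_relpow: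
  assumes "\<And>k. k < l \<Longrightarrow> (v k, v (Suc k)) \<in> R" "j \<le> k" "k \<le> l"
  shows "(v j, v k) \<in> R ^^ (k - j)"
  using assms(2,3)
proof (induction k)
  case (Suc k)
  show ?case
  proof (cases "j = Suc k")
    case False
    then have "(v j, v k) \<in> R ^^ (k - j)" "(v k, v (Suc k)) \<in> R" using Suc assms(1) by auto
    then have "(v j, v (Suc k)) \<in> R ^^ Suc (k - j)" by (rule relpow_Suc_I)
    then show ?thesis using False Suc.prems by (simp add: Suc_diff_le)
  qed simp
qed simp

text \<open>A closed edge path in which distances in the graph are as large as in a cycle of length \<open>l\<close>.\<close>

definition isometric_loop :: "'v cell set \<Rightarrow> nat \<Rightarrow> (nat \<Rightarrow> 'v) \<Rightarrow> bool" where
  "isometric_loop L l v \<longleftrightarrow> (\<forall>k<l. (v k, v (Suc k)) \<in> adj L) \<and> v l = v 0 \<and>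
     (\<forall>j k n. j \<le> k \<longrightarrow> k \<le> l \<longrightarrow> (v j, v k) \<in> adj L ^^ n \<longrightarrow> min (k - j) (l - (k - j)) \<le> n)"

text \<open>The cochain \<open>coch F X\<close> is large on the loop and small on the boundaries of 2-cells. Along the first \<open>2m\<close> steps
  \<open>F\<close> grows by one at each step and \<open>X\<close> is a tent of height \<open>m\<close>, and on the rest of the loop \<open>X\<close> vanishes. On the
  boundary of a 2-cell \<open>X\<close> varies by at most \<open>N\<close>, and \<open>dF\<close> has sum zero.\<close>

lemma isometric_loop_filling:
  assumes v: "isometric_loop L l v" and m: "4 * m \<le> l"
    and bd: "\<forall>f\<in>cells_of_dim L 2. \<exists>x es. walk L x es x \<and> length es \<le> N \<and> boundary2 L (frag_of f) = chain_of es"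
  obtains z where "Poly_Mapping.keys z \<subseteq> cells_of_dim L 1" "boundary1 z = 0" "chain_norm z \<le> l"
    "\<And>A k. A \<in> carrier (chain_group L 2) \<Longrightarrow> boundary2 L A = frag_cmul k z \<Longrightarrow>
       \<bar>of_int k\<bar> * real m ^ 2 \<le> 2 * real N ^ 2 * chain_norm A"
proof -
  have step: "\<And>k. k < l \<Longrightarrow> (v k, v (Suc k)) \<in> adj L" and vl: "v l = v 0"
    and iso: "\<And>j k n. j \<le> k \<Longrightarrow> k \<le> l \<Longrightarrow> (v j, v k) \<in> adj L ^^ n \<Longrightarrow> min (k - j) (l - (k - j)) \<le> n"
    using v unfolding isometric_loop_def by blast+
  define F where "F x = real (gdist L l (v 0) x)" for x
  define X where "X x = real (m - gdist L l (v m) x)" for x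
  have lip: "\<bar>F w - F u\<bar> \<le> 1 \<and> \<bar>X w - X u\<bar> \<le> 1" if "(u, w) \<in> adj L" for u w
  proof -
    have "gdist L l x w \<le> gdist L l x u + 1" "gdist L l x u \<le> gdist L l x w + 1" for x
      using gdist_step[OF that, of l x] gdist_step[OF sym_adj[OF that], of l x] by auto
    from this[of "v 0"] this[of "v m"] show ?thesis by (auto simp: F_def X_def)
  qed
  obtain es where es: "walk L (v 0) es (v l)" "length es = l" "\<And>F X. ev (coch F X) (chain_of es) =
     (\<Sum>k<l. (X (v k) + X (v (Suc k))) * (F (v (Suc k)) - F (v k)))"
    using walk_of_path[of l v L] step by blast
  have Fv: "F (v k) = k" if k: "k \<le> 2 * m" for k
  proof -
    have "gdist L l (v 0) (v k) \<le> k" using path_relpow[of l v "adj L" 0 k] step k m by (intro gdist_le) auto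
    moreover have "k \<le> gdist L l (v 0) (v k)"
      using gdist_cases[of l L "v 0" "v k"]
    proof
      assume "(v 0, v k) \<in> adj L ^^ gdist L l (v 0) (v k)"
      from iso[OF _ _ this] k m show ?thesis by auto
    qed (use k m in linarith)
    ultimately show ?thesis by (simp add: F_def)
  qed
  have Xfar: "X (v k) = 0" if k: "2 * m \<le> k" "k \<le> l" for k
  proof -
    have "m \<le> gdist L l (v m) (v k)"
      using gdist_cases[of l L "v m" "v k"]
    proof
      assume "(v m, v k) \<in> adj L ^^ gdist L l (v m) (v k)"
      from iso[OF _ _ this] k m show ?thesis by auto
    qed (use m in linarith)
    then show ?thesis by (simp add: X_def)
  qed
  have Xnear: "X (v k) \<ge> k" if k: "k \<le> m" for k
  proof -
    have "(v k, v m) \<in> adj L ^^ (m - k)" using path_relpow[of l v "adj L" k m] step k m by auto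
    then have "gdist L l (v m) (v k) \<le> m - k" by (rule gdist_le[OF relpow_adj_sym])
    then have "k \<le> m - gdist L l (v m) (v k)" using k by linarith
    then show ?thesis by (simp add: X_def)
  qed
  have X0: "X x \<ge> 0" for x by (simp add: X_def)
  let ?t = "\<lambda>k. (X (v k) + X (v (Suc k))) * (F (v (Suc k)) - F (v k))"
  have big: "real m ^ 2 \<le> ev (coch F X) (chain_of es)"
  proof -
    have "real m ^ 2 = (\<Sum>k<m. real k + real (Suc k))"
      by (induction m) (auto simp: power2_eq_square algebra_simps)
    also have "\<dots> \<le> (\<Sum>k<m. ?t k)"
    proof (rule sum_mono)
      fix k assume "k \<in> {..<m}"
      then have k: "k < m" by simp
      have "F (v (Suc k)) - F (v k) = 1" using Fv[of k] Fv[of "Suc k"] k by simp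
      then show "real k + real (Suc k) \<le> ?t k" using Xnear[of k] Xnear[of "Suc k"] k by simp
    qed
    also have "\<dots> \<le> (\<Sum>k<l. ?t k)"
    proof (rule sum_mono2)
      fix k assume "k \<in> {..<l} - {..<m}"
      then have k: "k < l" "m \<le> k" by auto
      show "0 \<le> ?t k"
      proof (cases "k < 2 * m")
        case True
        then have "F (v (Suc k)) - F (v k) = 1" using Fv[of k] Fv[of "Suc k"] by simp
        then show ?thesis using X0 by simp
      next
        case False
        then show ?thesis using Xfar[of k] Xfar[of "Suc k"] k by simp
      qed
    qed (use m in auto)
    finally show ?thesis using es(3) by simp
  qed
  have small: "\<bar>ev (coch F X) (boundary2 L (frag_of f))\<bar> \<le> 2 * real N ^ 2" if f: "f \<in> cells_of_dim L 2" for f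
  proof -
    obtain x fs where fs: "walk L x fs x" "length fs \<le> N" "boundary2 L (frag_of f) = chain_of fs" using bd f by blast
    have "\<bar>ev (coch F X) (chain_of fs)\<bar> \<le> 2 * real (length fs) * real (length fs)"
      using walk_coch_bound[where F = F and X = X and c = "X x", OF fs(1) lip] by simp
    also have "\<dots> \<le> 2 * real N * real N" using fs(2) by (intro mult_mono) auto
    finally show ?thesis using fs(3) by (simp add: power2_eq_square mult.assoc)
  qed
  show ?thesis
  proof (rule that[of "chain_of es"])
    show "Poly_Mapping.keys (chain_of es) \<subseteq> cells_of_dim L 1" using keys_chain_of[OF es(1)] .
    show "boundary1 (chain_of es) = 0" using boundary1_walk[OF es(1)] vl by simp
    show "chain_norm (chain_of es) \<le> l" using chain_norm_chain_of[of es] es(2) by simp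
    fix A k assume A: "A \<in> carrier (chain_group L 2)" "boundary2 L A = frag_cmul k (chain_of es)"
    have "\<bar>of_int k\<bar> * real m ^ 2 \<le> \<bar>of_int k\<bar> * \<bar>ev (coch F X) (chain_of es)\<bar>"
      using big by (intro mult_left_mono) auto
    also have "\<dots> = \<bar>ev (coch F X) (boundary2 L A)\<bar>" unfolding A(2) ev_cmul by (simp add: abs_mult)
    also have "\<dots> \<le> 2 * real N ^ 2 * chain_norm A"
      unfolding boundary2_def
    proof (rule ev_frag_extend_bound)
      fix f assume "f \<in> Poly_Mapping.keys A"
      then have "f \<in> cells_of_dim L 2" using A(1) by (auto simp: chain_group_def)
      from small[OF this] show "\<bar>ev (coch F X) (\<Sum>e\<in>{e \<in> cells_of_dim L 1. incidence f e \<noteq> 0}. frag_cmul (incidence f e) (frag_of e))\<bar>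
         \<le> 2 * real N ^ 2" by (simp add: boundary2_def)
    qed
    finally show "\<bar>of_int k\<bar> * real m ^ 2 \<le> 2 * real N ^ 2 * chain_norm A" .
  qed
qed

section \<open>Isometric loops in the quotients of a residual chain\<close>

context deck_quotient
begin

text \<open>Take the least distance \<open>l\<close> between a vertex \<open>x\<close> and a different vertex \<open>h x\<close>, and a shortest path joining such a
  pair. A shortcut between two vertices of its image lifts to the cover and ends at a translate of a
  vertex of the path. If the translate is trivial, the path was not shortest, and otherwise the shortcut
  together with the segment that it replaces displaces a vertex by less than \<open>l\<close>.\<close>

lemma shortest_loop:
  assumes h0: "h0 \<in> H" "h0 b \<noteq> b"
    and long: "\<And>h x n. h \<in> H \<Longrightarrow> x \<in> skt 0 \<Longrightarrow> n \<le> L \<Longrightarrow> (x, h x) \<in> adj Kt ^^ n \<Longrightarrow> h x = x"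
  shows "\<exists>l>L. \<exists>v. isometric_loop Ki l v"
proof -
  (* D n: some vertex is moved by a nontrivial element along an edge path of length n *)
  define D where "D n \<longleftrightarrow> (\<exists>x\<in>skt 0. \<exists>h\<in>H. h x \<noteq> x \<and> (x, h x) \<in> adj Kt ^^ n)" for n
  obtain x0 where x0: "x0 \<in> skt 0" using vertex_exists by blast
  then have x0M: "x0 \<in> Mt" using skt_subset by blast
  have "h0 x0 \<noteq> x0"
  proof
    assume "h0 x0 = x0"
    then have "h0 b = id b" using deck_unique[OF H_deck[OF h0(1)] deck_id x0M _ b] by simp
    then show False using h0(2) by simp
  qed
  moreover have "h0 x0 \<in> skt 0"
    using x0 deckD(2,3)[OF H_deck[OF h0(1)]] by (auto simp: skt_def)
  then obtain n0 where "(x0, h0 x0) \<in> adj Kt ^^ n0" using graph_connected[OF x0] rtrancl_imp_relpow by blast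
  ultimately have "D n0" using x0 h0(1) by (auto simp: D_def)
  define l where "l = (LEAST n. D n)"
  have Dl: "D l" unfolding l_def by (rule LeastI) fact
  have least: "l \<le> n" if "D n" for n unfolding l_def using that by (rule Least_le)
  obtain x h where xh: "x \<in> skt 0" "h \<in> H" "h x \<noteq> x" "(x, h x) \<in> adj Kt ^^ l" using Dl by (auto simp: D_def)
  have lL: "L < l" using long[OF xh(2,1) _ xh(4)] xh(3) by (meson not_le)
  obtain f where f: "f 0 = x" "f l = h x" "\<forall>i<l. (f i, f (Suc i)) \<in> adj Kt" using xh(4) unfolding relpow_fun_conv by blast
  have f0: "f k \<in> skt 0" if "k \<le> l" for k
    using f adj_skt xh(1) that by (cases k) (auto dest!: spec[of _ "k - 1"])
  then have fM: "f k \<in> Mt" if "k \<le> l" for k using that skt_subset by blast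
  have geo: "k - j \<le> n" if jk: "j \<le> k" "k \<le> l" and n: "(f j, f k) \<in> adj Kt ^^ n" for j k n
  proof -
    have "(x, f j) \<in> adj Kt ^^ j" using path_relpow[of l f "adj Kt" 0 j] f jk by simp
    moreover have "(f k, h x) \<in> adj Kt ^^ (l - k)" using path_relpow[of l f "adj Kt" k l] f jk by simp
    ultimately have "(x, h x) \<in> adj Kt ^^ (j + n + (l - k))"
      using n by (auto simp: relpow_add)
    then have "l \<le> j + n + (l - k)" using xh by (intro least) (auto simp: D_def)
    then show ?thesis using jk by linarith
  qed
  have iso: "min (k - j) (l - (k - j)) \<le> n" if jk: "j \<le> k" "k \<le> l" and n: "(q (f j), q (f k)) \<in> adj Ki ^^ n" for j k n
  proof -
    have "f j \<in> Mt" using fM jk by simp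
    from adj_pow_lift[OF this n] obtain y where y: "(f j, y) \<in> adj Kt ^^ n" "q (f k) = q y" by blast
    obtain h' where h': "h' \<in> H" "h' (f k) = y" using q_eq[OF fM[OF jk(2)]] y(2) by blast
    show ?thesis
    proof (cases "y = f k")
      case True
      then show ?thesis using geo[OF jk] y(1) by (simp add: min.coboundedI1)
    next
      case False
      have "(f j, f k) \<in> adj Kt ^^ (k - j)" using path_relpow[of l f "adj Kt" j k] f jk by auto
      then have "(f k, f j) \<in> adj Kt ^^ (k - j)" by (rule relpow_adj_sym)
      then have "(f k, h' (f k)) \<in> adj Kt ^^ (k - j + n)" using y(1) h'(2) by (auto simp: relpow_add)
      then have "l \<le> k - j + n" using False h' f0[OF jk(2)] by (intro least) (auto simp: D_def)
      then show ?thesis by linarith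
    qed
  qed
  have "isometric_loop Ki l (\<lambda>k. q (f k))"
    unfolding isometric_loop_def using f adj_push iso q_deck[OF xh(2), of x] fM[of 0] by auto
  then show ?thesis using lL by blast
qed

end

context universal_cover
begin

lemma DS_deck_group:
  assumes "subgroup N \<pi>1"
  shows "deck_group_on Mt p (DS N)"
  unfolding deck_group_on_def
proof (intro conjI ballI)
  show "deck f" if "f \<in> DS N" for f using that by (simp add: deck_subgroup_def)
  show "\<exists>f'\<in>DS N. \<forall>x\<in>Mt. f' (f x) = x" if f: "f \<in> DS N" for f
  proof -
    have "deck f" using f by (simp add: deck_subgroup_def)
    then have "\<exists>f'. deck f' \<and> (\<forall>x\<in>Mt. f' (f x) = x)" by (rule deck_inverse) blast
    then obtain f' where "deck f'" "\<And>x. x \<in> Mt \<Longrightarrow> f' (f x) = x" by blast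
    then show ?thesis using DS_inv[OF assms f] by blast
  qed
qed (use DS_id[OF assms] DS_comp[OF assms] in auto)

end

theorem theorem4:
  fixes M :: "'a::topological_space set" and K :: "'a cell set"
    and Mt :: "'b::topological_space set" and p :: "'b \<Rightarrow> 'a" and b :: 'b
    and G :: "nat \<Rightarrow> (real \<Rightarrow> 'a) set set"
  assumes "finite_cell_complex (top_of_set M) K"
    and "connected M"
    and "covering_space Mt p M" and "simply_connected Mt" and "b \<in> Mt"
    and "infinite (carrier (fundamental_group M (p b)))"
    and "residually_finite (fundamental_group M (p b))"
    and "residual_chain (fundamental_group M (p b)) G"
  shows "(\<exists>i. betti1 (quotient_cells M K Mt p b (G i)) > 0) \<or>
    (\<forall>\<epsilon>::real. \<epsilon> > 0 \<longrightarrow>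
      (\<exists>i. let Ki = quotient_cells M K Mt p b (G i) in
        \<exists>z \<in> boundary2 Ki ` carrier (chain_group Ki 2). z \<noteq> 0 \<and>
          (\<forall>A \<in> carrier (chain_group Ki 2).
             boundary2 Ki A = z \<longrightarrow> chain_norm z < \<epsilon> * chain_norm A)))"
proof (cases "\<exists>i. betti1 (quotient_cells M K Mt p b (G i)) > 0")
  case False
  interpret universal_cover M K Mt p b
    using assms by unfold_locales
  have norm: "\<And>i. G i \<lhd> \<pi>1" and fini: "\<And>i. finite (rcosets\<^bsub>\<pi>1\<^esub> (G i))" and dec: "\<And>i. G (Suc i) \<subseteq> G i"
    and int: "(\<Inter>i. G i) = {\<one>\<^bsub>\<pi>1\<^esub>}"
    using assms(8) unfolding residual_chain_def by auto
  have sub: "subgroup (G i) \<pi>1" for i using norm normal_imp_subgroup by blast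
  obtain N where N: "\<forall>H. deck_group_on Mt p H \<longrightarrow> (\<forall>f\<in>cells_of_dim (pullback_cells K (orbit_space Mt H) (orbit_projection p)) 2.
     \<exists>x es. walk (pullback_cells K (orbit_space Mt H) (orbit_projection p)) x es x \<and> length es \<le> N \<and>
       boundary2 (pullback_cells K (orbit_space Mt H) (orbit_projection p)) (frag_of f) = chain_of es)"
    using boundary_walk_bound by blast
  show ?thesis
  proof (intro disjI2 allI impI)
    fix \<epsilon> :: real assume eps: "\<epsilon> > 0"
    (* A loop of length l > 4R gives the ratio 2 N^2 l / m^2 <= 16 N^2 / m with m >= R for m = l div 4. *)
    obtain R :: nat where R: "16 * real N ^ 2 / \<epsilon> < R" using reals_Archimedean2 by blast
    then have R1: "R \<ge> 1" using eps
      by (metis One_nat_def Suc_leI divide_nonneg_pos gr0I le_less_trans less_irrefl mult_nonneg_nonneg of_nat_0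
          order_less_imp_le zero_le_numeral zero_le_power2)
    obtain i where i: "\<forall>h\<in>DS (G i). \<forall>x\<in>skt 0. \<forall>n\<le>4 * R. (x, h x) \<in> adj Kt ^^ n \<longrightarrow> h x = x"
      using long_displacement[of G "4 * R"] norm dec int by blast
    interpret deck_quotient M K Mt p b "DS (G i)"
      by unfold_locales (rule DS_deck_group[OF sub])
    have qc: "quotient_cells M K Mt p b (G i) = Ki" by (simp add: quotient_cells_def)
    obtain h0 where h0: "h0 \<in> DS (G i)" "h0 b \<noteq> b" using DS_nontrivial[OF sub fini assms(6)] by blast
    have "\<exists>l>4 * R. \<exists>v. isometric_loop Ki l v" by (rule shortest_loop[OF h0]) (use i in blast)
    then obtain l v where l: "4 * R < l" "isometric_loop Ki l v" by blast
    define m where "m = l div 4"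
    have m: "4 * m \<le> l" "l \<le> 4 * m + 3" "R \<le> m" using l(1) by (auto simp: m_def)
    have bd: "\<forall>f\<in>cells_of_dim Ki 2. \<exists>x es. walk Ki x es x \<and> length es \<le> N \<and> boundary2 Ki (frag_of f) = chain_of es"
      using N H by blast
    obtain c where c: "Poly_Mapping.keys c \<subseteq> cells_of_dim Ki 1" "boundary1 c = 0" "chain_norm c \<le> l"
      and fill: "\<And>A k. A \<in> carrier (chain_group Ki 2) \<Longrightarrow> boundary2 Ki A = frag_cmul k c \<Longrightarrow>
       \<bar>of_int k\<bar> * real m ^ 2 \<le> 2 * real N ^ 2 * chain_norm A"
      by (rule isometric_loop_filling[OF l(2) m(1) bd]) (use that in blast)
    have "betti1 Ki = 0" using False qc by (metis not_gr_zero)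
    from betti1_zero_imp_torsion[OF this c(1,2)] obtain k :: int where
      k: "k \<noteq> 0" "frag_cmul k c \<in> boundary2 Ki ` carrier (chain_group Ki 2)" by blast
    let ?z = "frag_cmul k c"
    have k0: "\<bar>real_of_int k\<bar> > 0" using k(1) by simp
    have m0: "real m > 0" using m(3) R1 by simp
    have 1: "16 * real N ^ 2 < \<epsilon> * real m"
    proof -
      have "16 * real N ^ 2 < \<epsilon> * real R" using R eps by (simp add: field_simps)
      also have "\<dots> \<le> \<epsilon> * real m" using m(3) eps by simp
      finally show ?thesis .
    qed
    have key: "2 * real N ^ 2 * real l < \<epsilon> * real m ^ 2"
    proof -
      have 2: "real l \<le> 8 * real m" using m(2,3) R1 by linarith
      have "2 * real N ^ 2 * real l \<le> 2 * real N ^ 2 * (8 * real m)" using 2 by (intro mult_left_mono) auto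
      also have "\<dots> = (16 * real N ^ 2) * real m" by simp
      also have "\<dots> < (\<epsilon> * real m) * real m" using 1 m0 by (intro mult_strict_right_mono) auto
      finally show ?thesis by (simp add: power2_eq_square mult.assoc)
    qed
    have less: "chain_norm ?z < \<epsilon> * chain_norm A"
      if A: "A \<in> carrier (chain_group Ki 2)" "boundary2 Ki A = ?z" for A
    proof (rule ccontr)
      assume "\<not> chain_norm ?z < \<epsilon> * chain_norm A"
      then have 1: "\<epsilon> * chain_norm A \<le> \<bar>of_int k\<bar> * real l"
        using chain_norm_cmul[of k c] mult_left_mono[OF c(3), of "\<bar>of_int k\<bar>"] by simp
      have 2: "\<bar>of_int k\<bar> * real m ^ 2 \<le> 2 * real N ^ 2 * chain_norm A" using fill[OF A] .
      have "\<bar>of_int k\<bar> * (\<epsilon> * real m ^ 2) = \<epsilon> * (\<bar>of_int k\<bar> * real m ^ 2)" by simp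
      also have "\<dots> \<le> \<epsilon> * (2 * real N ^ 2 * chain_norm A)" using 2 eps by (intro mult_left_mono) auto
      also have "\<dots> = 2 * real N ^ 2 * (\<epsilon> * chain_norm A)" by simp
      also have "\<dots> \<le> 2 * real N ^ 2 * (\<bar>of_int k\<bar> * real l)" using 1 by (intro mult_left_mono) auto
      also have "\<dots> = \<bar>of_int k\<bar> * (2 * real N ^ 2 * real l)" by simp
      finally have "\<epsilon> * real m ^ 2 \<le> 2 * real N ^ 2 * real l" using k0 by (simp add: mult_le_cancel_left)
      then show False using key by simp
    qed
    have z0: "?z \<noteq> 0"
    proof
      assume z: "?z = 0"
      have "(0 :: _ \<Rightarrow>\<^sub>0 int) \<in> carrier (chain_group Ki 2)" "boundary2 Ki 0 = ?z"
        using z by (auto simp: chain_group_def boundary2_def)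
      from fill[OF this] have "\<bar>of_int k\<bar> * real m ^ 2 \<le> 0" by (simp add: chain_norm_def)
      moreover have "0 < \<bar>real_of_int k\<bar> * real m ^ 2" using k0 m0 by (intro mult_pos_pos) auto
      ultimately show False by linarith
    qed
    show "\<exists>i. let Ki = quotient_cells M K Mt p b (G i) in
        \<exists>z \<in> boundary2 Ki ` carrier (chain_group Ki 2). z \<noteq> 0 \<and>
          (\<forall>A \<in> carrier (chain_group Ki 2). boundary2 Ki A = z \<longrightarrow> chain_norm z < \<epsilon> * chain_norm A)"
      unfolding Let_def by (rule exI[of _ i], unfold qc) (use k(2) z0 less in blast)
  qed
qed blast

end
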